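(* Let $d\le 3$, $T>0$ and $\phi\in H^1(\mathbb T^d)$. For $R\in C^2_b(\mathbb R)$ let $u_R\in L^2([0,T];H^2)\cap H^1([0,T];L^2)$ be the unique strong solution of $$\partial_t u-\Delta u=R(u)\ \text{ in }(0,T)\times\mathbb T^d,\qquad u(0)=\phi .$$ Then the map $\mathcal G:C^2_b(\mathbb R)\to L^2([0,T];H^2)\cap H^1([0,T];L^2)$, $\mathcal G(R)=u_R$, is $C^1$ in the Fréchet sense. Moreover, for every $R,H\in C^2_b(\mathbb R)$, the Fréchet derivative $D\mathcal G(R)[H]=:i_H$ is the unique strong solution $i\in L^2([0,T];H^2)\cap H^1([0,T];L^2)$ of the linear parabolic problem $$\partial_t i-\Delta i-R'(u_R)\,i=H(u_R)\ \text{ in }(0,T)\times\mathbb T^d,\qquad i(0)=0 .$$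
   Context: $\mathbb T^d=\mathbb R^d/\mathbb Z^d$ is the flat torus; $H^s=H^s(\mathbb T^d)$ are periodic Sobolev spaces, $L^2=L^2(\mathbb T^d)$. $C^k_b(\mathbb R)$ is the Banach space of bounded $k$-times continuously differentiable functions on $\mathbb R$ with bounded derivatives up to order $k$, with norm $\|f\|_{C^k}=\sup_x\sum_{i=0}^k|f^{(i)}(x)|$. For a Banach space $B$, $L^2([0,T];B)$ and $H^1([0,T];B)$ are Bochner spaces; the intersection $L^2([0,T];H^2)\cap H^1([0,T];L^2)$ carries the sum norm. The solution $u_R$ is known to exist and be unique (in $C([0,T];L^2)$) for each $R\in C^2_b(\mathbb R)$. *)

theory Defs
  imports "HOL-Analysis.Analysis"
begin

coinductive smooth_fun :: "('a::real_normed_vector \<Rightarrow> real) \<Rightarrow> bool" where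
  smooth_funI: "(\<forall>x. f differentiable (at x)) \<Longrightarrow>
     (\<forall>v. smooth_fun (\<lambda>x. frechet_derivative f (at x) v)) \<Longrightarrow> smooth_fun f"

definition L2_on :: "'a::euclidean_space set \<Rightarrow> ('a \<Rightarrow> real) \<Rightarrow> bool" where
  "L2_on S w \<longleftrightarrow> (\<lambda>z. indicator S z * w z) \<in> borel_measurable lebesgue
     \<and> set_integrable lebesgue S (\<lambda>z. (w z)^2)"

definition sq_int :: "'a::euclidean_space set \<Rightarrow> ('a \<Rightarrow> real) \<Rightarrow> real" where
  "sq_int S w = (LINT z:S|lebesgue. (w z)^2)"

definition weak_deriv_on ::
  "'a::euclidean_space set \<Rightarrow> (('a \<Rightarrow> real) \<Rightarrow> bool) \<Rightarrow> ('a \<Rightarrow> real) \<Rightarrow> 'a \<Rightarrow> ('a \<Rightarrow> real) \<Rightarrow> bool" where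
  "weak_deriv_on S Test w v g \<longleftrightarrow> L2_on S w \<and> L2_on S g \<and>
     (\<forall>\<psi>. Test \<psi> \<longrightarrow>
        (LINT z:S|lebesgue. w z * frechet_derivative \<psi> (at z) v) = - (LINT z:S|lebesgue. g z * \<psi> z))"

definition wd_on ::
  "'a::euclidean_space set \<Rightarrow> (('a \<Rightarrow> real) \<Rightarrow> bool) \<Rightarrow> ('a \<Rightarrow> real) \<Rightarrow> 'a \<Rightarrow> ('a \<Rightarrow> real)" where
  "wd_on S Test w v = (SOME g. weak_deriv_on S Test w v g)"

(* fundamental cell of the torus T^d = R^d / Z^d *)
definition unit_cube :: "(real^'d) set" where
  "unit_cube = cbox 0 One"

definition torus_test :: "(real^'d \<Rightarrow> real) \<Rightarrow> bool" where
  "torus_test \<psi> \<longleftrightarrow> smooth_fun \<psi> \<and> (\<forall>x i. \<psi> (x + axis i 1) = \<psi> x)"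

definition H1_torus :: "(real^'d \<Rightarrow> real) \<Rightarrow> bool" where
  "H1_torus \<phi> \<longleftrightarrow> L2_on unit_cube \<phi> \<and>
     (\<forall>i. \<exists>g. weak_deriv_on unit_cube torus_test \<phi> (axis i 1) g)"

definition cyl :: "real \<Rightarrow> (real \<times> (real^'d)) set" where
  "cyl T = {0<..<T} \<times> unit_cube"

definition st_test :: "real \<Rightarrow> (real \<times> (real^'d) \<Rightarrow> real) \<Rightarrow> bool" where
  "st_test T \<psi> \<longleftrightarrow> smooth_fun \<psi> \<and> (\<forall>t x i. \<psi> (t, x + axis i 1) = \<psi> (t, x)) \<and>
     (\<exists>a b. 0 < a \<and> b < T \<and> (\<forall>t x. (t < a \<or> b < t) \<longrightarrow> \<psi> (t, x) = 0))"

definition e_t :: "real \<times> (real^'d)" where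
  "e_t = (1, 0)"

definition e_x :: "'d \<Rightarrow> real \<times> (real^'d)" where
  "e_x i = (0, axis i 1)"

definition dX :: "real \<Rightarrow> (real \<times> (real^'d) \<Rightarrow> real) \<Rightarrow> real \<times> (real^'d) \<Rightarrow> (real \<times> (real^'d) \<Rightarrow> real)" where
  "dX T w v = wd_on (cyl T) (st_test T) w v"

(* membership in  L^2([0,T];H^2) \<inter> H^1([0,T];L^2)  *)
definition in_X :: "real \<Rightarrow> (real \<times> (real^'d) \<Rightarrow> real) \<Rightarrow> bool" where
  "in_X T u \<longleftrightarrow> L2_on (cyl T) u \<and>
     (\<exists>g. weak_deriv_on (cyl T) (st_test T) u e_t g) \<and>
     (\<forall>i. \<exists>g. weak_deriv_on (cyl T) (st_test T) u (e_x i) g \<and>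
            (\<forall>j. \<exists>h. weak_deriv_on (cyl T) (st_test T) g (e_x j) h))"

(* norm of L^2([0,T];H^2) \<inter> H^1([0,T];L^2) (Hilbertian form, equivalent to the sum norm) *)
definition Xnorm :: "real \<Rightarrow> (real \<times> (real^'d) \<Rightarrow> real) \<Rightarrow> real" where
  "Xnorm T u = sqrt (sq_int (cyl T) u + sq_int (cyl T) (dX T u e_t)
      + (\<Sum>i\<in>UNIV. sq_int (cyl T) (dX T u (e_x i)))
      + (\<Sum>i\<in>UNIV. \<Sum>j\<in>UNIV. sq_int (cyl T) (dX T (dX T u (e_x i)) (e_x j))))"

definition lap :: "real \<Rightarrow> (real \<times> (real^'d) \<Rightarrow> real) \<Rightarrow> real \<times> (real^'d) \<Rightarrow> real" where
  "lap T u z = (\<Sum>i\<in>UNIV. dX T (dX T u (e_x i)) (e_x i) z)"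

definition init_test :: "real \<Rightarrow> (real \<times> (real^'d) \<Rightarrow> real) \<Rightarrow> bool" where
  "init_test T \<psi> \<longleftrightarrow> smooth_fun \<psi> \<and> (\<forall>t x i. \<psi> (t, x + axis i 1) = \<psi> (t, x)) \<and>
     (\<exists>b. b < T \<and> (\<forall>t x. b < t \<longrightarrow> \<psi> (t, x) = 0))"

(* u(0) = \<phi> in the trace sense:  \<integral>\<integral> (u \<psi>_t + u_t \<psi>) = - \<integral> \<phi> \<psi>(0,.) *)
definition initial_value :: "real \<Rightarrow> (real \<times> (real^'d) \<Rightarrow> real) \<Rightarrow> (real^'d \<Rightarrow> real) \<Rightarrow> bool" where
  "initial_value T u \<phi> \<longleftrightarrow> (\<forall>\<psi>. init_test T \<psi> \<longrightarrow>
     (LINT z:cyl T|lebesgue. u z * frechet_derivative \<psi> (at z) e_t + dX T u e_t z * \<psi> z)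
       = - (LINT x:unit_cube|lebesgue. \<phi> x * \<psi> (0, x)))"

definition strong_sol :: "real \<Rightarrow> (real^'d \<Rightarrow> real) \<Rightarrow> (real \<times> (real^'d) \<Rightarrow> real \<Rightarrow> real)
    \<Rightarrow> (real \<times> (real^'d) \<Rightarrow> real) \<Rightarrow> bool" where
  "strong_sol T \<phi> F u \<longleftrightarrow> in_X T u \<and>
     (AE z in lebesgue. z \<in> cyl T \<longrightarrow> dX T u e_t z - lap T u z = F z (u z)) \<and>
     initial_value T u \<phi>"

definition C2b :: "(real \<Rightarrow> real) \<Rightarrow> bool" where
  "C2b R \<longleftrightarrow> (\<forall>x. R differentiable (at x)) \<and> (\<forall>x. deriv R differentiable (at x)) \<and>
     continuous_on UNIV (deriv (deriv R)) \<and>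
     bounded (range R) \<and> bounded (range (deriv R)) \<and> bounded (range (deriv (deriv R)))"

definition c2norm :: "(real \<Rightarrow> real) \<Rightarrow> real" where
  "c2norm R = (SUP x. \<bar>R x\<bar> + \<bar>deriv R x\<bar> + \<bar>deriv (deriv R) x\<bar>)"

(* bounded linear operator C^2_b \<rightarrow> X (linearity modulo functions of X-norm zero) *)
definition bdd_lin_op :: "real \<Rightarrow> ((real \<Rightarrow> real) \<Rightarrow> (real \<times> (real^'d) \<Rightarrow> real)) \<Rightarrow> bool" where
  "bdd_lin_op T L \<longleftrightarrow> (\<forall>H. C2b H \<longrightarrow> in_X T (L H)) \<and>
     (\<forall>H1 H2 a b. C2b H1 \<and> C2b H2 \<longrightarrow>
        Xnorm T (\<lambda>z. L (\<lambda>x. a * H1 x + b * H2 x) z - (a * L H1 z + b * L H2 z)) = 0) \<and>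
     (\<exists>K. \<forall>H. C2b H \<longrightarrow> Xnorm T (L H) \<le> K * c2norm H)"

definition frechet_at :: "real \<Rightarrow> ((real \<Rightarrow> real) \<Rightarrow> (real \<times> (real^'d) \<Rightarrow> real)) \<Rightarrow> (real \<Rightarrow> real)
    \<Rightarrow> ((real \<Rightarrow> real) \<Rightarrow> (real \<times> (real^'d) \<Rightarrow> real)) \<Rightarrow> bool" where
  "frechet_at T G R L \<longleftrightarrow> bdd_lin_op T L \<and>
     (\<forall>\<epsilon>>0. \<exists>\<delta>>0. \<forall>H. C2b H \<and> c2norm H < \<delta> \<longrightarrow>
        Xnorm T (\<lambda>z. G (\<lambda>x. R x + H x) z - G R z - L H z) \<le> \<epsilon> * c2norm H)"

definition C1_frechet :: "real \<Rightarrow> ((real \<Rightarrow> real) \<Rightarrow> (real \<times> (real^'d) \<Rightarrow> real))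
    \<Rightarrow> ((real \<Rightarrow> real) \<Rightarrow> (real \<Rightarrow> real) \<Rightarrow> (real \<times> (real^'d) \<Rightarrow> real)) \<Rightarrow> bool" where
  "C1_frechet T G DG \<longleftrightarrow> (\<forall>R. C2b R \<longrightarrow> frechet_at T G R (DG R) \<and>
     (\<forall>\<epsilon>>0. \<exists>\<delta>>0. \<forall>R'. C2b R' \<and> c2norm (\<lambda>x. R' x - R x) < \<delta> \<longrightarrow>
        (\<forall>H. C2b H \<longrightarrow> Xnorm T (\<lambda>z. DG R' H z - DG R H z) \<le> \<epsilon> * c2norm H)))"

end

theory Submission
  imports Defs
begin

text \<open>
  Differences of solutions and the candidate derivatives all solve \<open>w\<^sub>t - \<Delta>w = f\<close>, \<open>w(0) = 0\<close>, for some
  \<open>f\<close> in \<open>L\<^sup>2\<close>. If \<open>f\<close> is a finite sum of products of a smooth function of time and a Fourier mode,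
  this problem is solved by an explicit smooth \<open>w\<close>, and testing with \<open>w\<^sub>t\<close>, \<open>\<Delta>w\<close> and \<open>w\<close> bounds \<open>w\<close>
  in \<open>L\<^sup>2(H\<^sup>2) \<inter> H\<^sup>1(L\<^sup>2)\<close> by the \<open>L\<^sup>2\<close> norm of \<open>f\<close>. Such sums are dense, hence the problem is
  solvable for every \<open>f\<close>. Pairing a solution with solutions of the backward equation gives uniqueness and,
  because the backward flow contracts \<open>L\<^sup>1\<close>, the pointwise estimate \<open>|w| \<le> (B/\<mu>) e\<^bsup>\<mu>t\<^esup>\<close> whenever
  \<open>|f| \<le> B e\<^bsup>\<mu>t\<^esup>\<close>. For large \<open>\<mu>\<close> it absorbs a bounded potential, which yields the solution \<open>i\<^sub>H\<close> of the
  linearised problem as the limit of a contraction and bounds \<open>i\<^sub>H\<close> and \<open>u\<^bsub>R+H\<^esub> - u\<^sub>R\<close> pointwise by a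
  multiple of the norm of \<open>H\<close>. The remainder \<open>u\<^bsub>R+H\<^esub> - u\<^sub>R - i\<^sub>H\<close> therefore solves the linearised
  equation up to a source which is pointwise quadratic in \<open>H\<close>, and the \<open>L\<^sup>2\<close> theory bounds its norm.
\<close>

section \<open>Square integrable functions\<close>

text \<open>The obstacle is the Taylor remainder \<open>R(v) - R(u) - R'(u) (v - u)\<close>. Its L2
  norm is governed by the square of \<open>v - u\<close>, so smallness of \<open>v - u\<close> in L2
  alone does not make it of second order; a bound on \<open>v - u\<close> in the sup norm does. Such
  a bound is not sought for a solution \<open>u\<close> itself, whose initial value need not be
  bounded. A difference of two solutions starts from zero and has a bounded source, because the
  reaction functions are bounded, and this is all that the pointwise estimate asks for. Solutions
  are functions on the cylinder up to null sets, without time slices. Hence Gronwall's lemma is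
  replaced by estimates over the whole cylinder with a weight exp(\<mu> t) or exp(-\<mu> t), and the
  comparison principle is not applied to the weak solution but, by duality, to smooth solutions of
  the backward equation, where it takes the form of an L1 estimate. Zero initial or final values of
  smooth functions are encoded by flatness near that end of the time interval, so that boundary
  terms either vanish or have a sign.\<close>

definition in_L2 :: "'a measure \<Rightarrow> ('a \<Rightarrow> real) \<Rightarrow> bool" where
  "in_L2 M f \<longleftrightarrow> f \<in> borel_measurable M \<and> integrable M (\<lambda>z. (f z)^2)"

text \<open>The squared L2 norm. Working with squares replaces Minkowski's inequality by
  \<open>nsq_add_le\<close>, whose factor 2 is harmless because only convergence and bounds up to a
  constant are needed.\<close>

definition nsq :: "'a measure \<Rightarrow> ('a \<Rightarrow> real) \<Rightarrow> real" where
  "nsq M f = (LINT z|M. (f z)^2)"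

lemma in_L2_measurable [measurable_dest]:
  "in_L2 M f \<Longrightarrow> f \<in> borel_measurable M"
  by (simp add: in_L2_def)

lemma in_L2_square [intro]: "in_L2 M f \<Longrightarrow> integrable M (\<lambda>z. (f z)^2)"
  by (simp add: in_L2_def)

lemma nsq_nonneg [simp]: "0 \<le> nsq M f"
  by (simp add: nsq_def)

lemma in_L2_mult:
  assumes "in_L2 M f" "in_L2 M g"
  shows "integrable M (\<lambda>z. f z * g z)"
proof (rule Bochner_Integration.integrable_bound)
  show "integrable M (\<lambda>z. (f z)^2 + (g z)^2)"
    using assms by auto
  have "\<bar>f z * g z\<bar> \<le> (f z)^2 + (g z)^2" for z
  proof -
    have "2 * (\<bar>f z\<bar> * \<bar>g z\<bar>) \<le> \<bar>f z\<bar>^2 + \<bar>g z\<bar>^2"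
      using sum_squares_bound[of "\<bar>f z\<bar>" "\<bar>g z\<bar>"] by (simp add: mult.assoc)
    moreover have "0 \<le> \<bar>f z\<bar> * \<bar>g z\<bar>" by simp
    ultimately show ?thesis unfolding abs_mult power2_abs by linarith
  qed
  then show "AE z in M. norm (f z * g z) \<le> norm ((f z)^2 + (g z)^2)" by simp
qed (use assms in measurable)

lemma in_L2_cmult:
  "in_L2 M f \<Longrightarrow> in_L2 M (\<lambda>z. c * f z)"
  by (auto simp: in_L2_def power_mult_distrib)

lemma in_L2_add:
  assumes "in_L2 M f" "in_L2 M g"
  shows "in_L2 M (\<lambda>z. f z + g z)"
  using assms in_L2_mult[OF assms]
  by (auto simp: in_L2_def power2_sum mult.assoc)

lemma in_L2_diff:
  assumes "in_L2 M f" "in_L2 M g"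
  shows "in_L2 M (\<lambda>z. f z - g z)"
  using in_L2_add[OF assms(1) in_L2_cmult[OF assms(2), of "-1"]] by simp

lemma in_L2_zero [simp]: "in_L2 M (\<lambda>z. 0)"
  by (simp add: in_L2_def)

lemma in_L2_sum:
  "(\<And>i. i \<in> I \<Longrightarrow> in_L2 M (f i)) \<Longrightarrow> in_L2 M (\<lambda>z. \<Sum>i\<in>I. f i z)"
  by (induction I rule: infinite_finite_induct) (auto intro: in_L2_add)

lemma in_L2_dominated:
  assumes "in_L2 M g" "f \<in> borel_measurable M" "AE z in M. \<bar>f z\<bar> \<le> \<bar>g z\<bar>"
  shows "in_L2 M f"
  unfolding in_L2_def
proof (intro conjI)
  show "integrable M (\<lambda>z. (f z)^2)"
    by (rule Bochner_Integration.integrable_bound[OF in_L2_square[OF assms(1)]])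
       (use assms in \<open>auto simp: abs_le_square_iff elim!: eventually_mono\<close>)
qed fact

lemma nsq_mono:
  assumes "in_L2 M g" "f \<in> borel_measurable M" "AE z in M. \<bar>f z\<bar> \<le> \<bar>g z\<bar>"
  shows "nsq M f \<le> nsq M g"
  unfolding nsq_def using assms in_L2_dominated[OF assms]
  by (intro integral_mono_AE) (auto simp: abs_le_square_iff elim!: eventually_mono)

lemma in_L2_cong_AE:
  assumes "in_L2 M f" "g \<in> borel_measurable M" "AE z in M. f z = g z"
  shows "in_L2 M g"
  using assms by (intro in_L2_dominated[OF assms(1)]) auto

lemma nsq_cong_AE:
  assumes "f \<in> borel_measurable M" "g \<in> borel_measurable M" "AE z in M. f z = g z"
  shows "nsq M f = nsq M g"
  unfolding nsq_def using assms by (intro integral_cong_AE) (auto elim!: eventually_mono)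

lemma nsq_cmult: "nsq M (\<lambda>z. c * f z) = c^2 * nsq M f"
  by (simp add: nsq_def power_mult_distrib)

lemma nsq_add_le:
  assumes "in_L2 M f" "in_L2 M g"
  shows "nsq M (\<lambda>z. f z + g z) \<le> 2 * nsq M f + 2 * nsq M g"
proof -
  have "nsq M (\<lambda>z. f z + g z) \<le> (LINT z|M. 2 * (f z)^2 + 2 * (g z)^2)"
    unfolding nsq_def
  proof (rule integral_mono)
    show "integrable M (\<lambda>z. (f z + g z)^2)" "integrable M (\<lambda>z. 2 * (f z)^2 + 2 * (g z)^2)"
      by (intro Bochner_Integration.integrable_add integrable_mult_right in_L2_square
          in_L2_add assms)+
    show "(f z + g z)^2 \<le> 2 * (f z)^2 + 2 * (g z)^2" for z
      using sum_squares_bound[of "f z" "g z"] by (simp add: power2_sum)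
  qed
  also have "\<dots> = 2 * nsq M f + 2 * nsq M g"
    unfolding nsq_def using assms by (subst Bochner_Integration.integral_add) auto
  finally show ?thesis .
qed

lemma nsq_diff_le:
  assumes "in_L2 M f" "in_L2 M g"
  shows "nsq M (\<lambda>z. f z - g z) \<le> 2 * nsq M f + 2 * nsq M g"
  using nsq_add_le[OF assms(1) in_L2_cmult[OF assms(2), of "-1"]]
    nsq_cmult[of M "-1" g] by simp

lemma nsq_triangle:
  assumes "in_L2 M f" "in_L2 M g"
  shows "nsq M f \<le> 2 * nsq M g + 2 * nsq M (\<lambda>z. f z - g z)"
  using nsq_add_le[OF assms(2) in_L2_diff[OF assms]] by simp

lemma nsq_minus_commute: "nsq M (\<lambda>z. f z - g z) = nsq M (\<lambda>z. g z - f z)"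
  by (simp add: nsq_def power2_commute)

lemma nsq_eq_0:
  assumes "in_L2 M f" "nsq M f = 0"
  shows "AE z in M. f z = 0"
  using assms integral_nonneg_eq_0_iff_AE[OF in_L2_square[OF assms(1)]]
  by (simp add: nsq_def)

text \<open>Young's inequality with a free parameter, obtained from the product of
  \<open>|f|\<close> and \<open>d * |g|\<close> after division by \<open>d\<close>. It takes the
  place of Cauchy-Schwarz: a small \<open>d\<close> makes the \<open>g\<close> term small, and then
  \<open>nsq M f\<close> has to be small compared with \<open>d\<close>.\<close>

lemma integral_mult_le_nsq:
  assumes "in_L2 M f" "in_L2 M g" "d > 0"
  shows "\<bar>LINT z|M. f z * g z\<bar> \<le> d * nsq M g + nsq M f / d"
proof -
  have "\<bar>LINT z|M. f z * g z\<bar> \<le> (LINT z|M. \<bar>f z * g z\<bar>)"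
    by (rule integral_abs_bound)
  also have "\<dots> \<le> (LINT z|M. d * (g z)^2 + (f z)^2 / d)"
  proof (rule integral_mono)
    show "integrable M (\<lambda>z. \<bar>f z * g z\<bar>)"
      using in_L2_mult[OF assms(1,2)] by simp
    show "integrable M (\<lambda>z. d * (g z)^2 + (f z)^2 / d)"
      by (intro Bochner_Integration.integrable_add integrable_mult_right integrable_divide
          in_L2_square assms)
    fix z
    have "2 * (\<bar>f z\<bar> * (d * \<bar>g z\<bar>)) \<le> \<bar>f z\<bar>^2 + (d * \<bar>g z\<bar>)^2"
      using sum_squares_bound[of "\<bar>f z\<bar>" "d * \<bar>g z\<bar>"] by (simp add: mult.assoc)
    moreover have "0 \<le> \<bar>f z\<bar> * (d * \<bar>g z\<bar>)" using assms(3) by simp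
    ultimately have "\<bar>f z\<bar> * (d * \<bar>g z\<bar>) \<le> (f z)^2 + (d * g z)^2"
      unfolding power_mult_distrib power2_abs by linarith
    then show "\<bar>f z * g z\<bar> \<le> d * (g z)^2 + (f z)^2 / d"
      using assms(3) by (simp add: abs_mult field_simps power2_eq_square)
  qed
  also have "\<dots> = d * nsq M g + nsq M f / d"
    unfolding nsq_def using assms by (subst Bochner_Integration.integral_add) auto
  finally show ?thesis .
qed

lemma tendsto_integral_mult:
  assumes "\<And>n. in_L2 M (f n)" "in_L2 M F" "in_L2 M g"
    and "(\<lambda>n. nsq M (\<lambda>z. f n z - F z)) \<longlonglongrightarrow> 0"
  shows "(\<lambda>n. LINT z|M. f n z * g z) \<longlonglongrightarrow> (LINT z|M. F z * g z)"
proof (rule LIMSEQ_I)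
  fix r :: real assume "r > 0"
  \<comment> \<open>Chosen so that \<open>d * nsq M g\<close> is at most \<open>r / 4\<close>; the
    summand 1 keeps the denominator positive when \<open>g\<close> vanishes.\<close>
  define d where "d = r / (4 * (nsq M g + 1))"
  have g: "0 < nsq M g + 1" using nsq_nonneg[of M g] by linarith
  have d: "d > 0" using \<open>r > 0\<close> g by (simp add: d_def)
  have dg: "d * nsq M g \<le> r / 4"
  proof -
    have "d * nsq M g \<le> d * (nsq M g + 1)" using d by simp
    also have "\<dots> = r / 4" using g unfolding d_def
      by (metis mult.commute nonzero_mult_divide_mult_cancel_left order_less_irrefl
          times_divide_eq_left)
    finally show ?thesis .
  qed
  have "0 < d * r / 4" using d \<open>r > 0\<close> by simp
  then obtain N where N: "\<And>n. n \<ge> N \<Longrightarrow> norm (nsq M (\<lambda>z. f n z - F z) - 0) < d * r / 4"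
    using LIMSEQ_D[OF assms(4)] by blast
  show "\<exists>no. \<forall>n\<ge>no. norm ((LINT z|M. f n z * g z) - (LINT z|M. F z * g z)) < r"
  proof (intro exI allI impI)
    fix n assume "n \<ge> N"
    have "(LINT z|M. f n z * g z) - (LINT z|M. F z * g z) = (LINT z|M. (f n z - F z) * g z)"
      unfolding left_diff_distrib
      by (rule Bochner_Integration.integral_diff[symmetric])
         (use assms in \<open>auto intro: in_L2_mult\<close>)
    also have "\<bar>\<dots>\<bar> \<le> d * nsq M g + nsq M (\<lambda>z. f n z - F z) / d"
      by (rule integral_mult_le_nsq[OF in_L2_diff[OF assms(1,2)] assms(3) d])
    also have "\<dots> < r / 4 + r / 2"
    proof -
      have "nsq M (\<lambda>z. f n z - F z) / d < r / 2"
        using N[OF \<open>n \<ge> N\<close>] d \<open>r > 0\<close> nsq_nonneg[of M "\<lambda>z. f n z - F z"]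
        by (simp add: field_simps del: nsq_nonneg)
      then show ?thesis using dg by linarith
    qed
    also have "\<dots> < r" using \<open>r > 0\<close> by simp
    finally show "norm ((LINT z|M. f n z * g z) - (LINT z|M. F z * g z)) < r" by simp
  qed
qed

text \<open>The rate 1/8 leaves room for a weight: the sum \<open>S\<close> of \<open>4^n\<close>
  times the squared increments is still integrable, since its terms have integrals at most
  \<open>C / 2^n\<close>. Hence the increments are almost everywhere at most
  \<open>sqrt S / 2^n\<close>. This gives pointwise convergence, and \<open>sqrt S\<close> is a
  square integrable majorant that turns it into convergence in L2.\<close>

lemma in_L2_complete:
  fixes w :: "nat \<Rightarrow> 'a \<Rightarrow> real"
  assumes w: "\<And>n. in_L2 M (w n)"
    and d: "\<And>n. nsq M (\<lambda>z. w (Suc n) z - w n z) \<le> C * (1/8)^n"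
  obtains W where "in_L2 M W" "(\<lambda>n. nsq M (\<lambda>z. w n z - W z)) \<longlonglongrightarrow> 0"
proof -
  define D where "D n z = w (Suc n) z - w n z" for n z
  have D: "in_L2 M (D n)" for n
    unfolding D_def by (intro in_L2_diff w)
  have [measurable]: "w n \<in> borel_measurable M" "D n \<in> borel_measurable M" for n
    using w D by (auto simp: in_L2_def)
  define f where "f n z = 4^n * (D n z)^2" for n z
  have f: "integrable M (f n)" for n
    unfolding f_def using D by auto
  have If: "(LINT z|M. norm (f n z)) \<le> C * (1/2)^n" for n
  proof -
    have "(LINT z|M. norm (f n z)) = 4^n * nsq M (D n)"
      by (simp add: f_def nsq_def abs_mult)
    also have "\<dots> \<le> 4^n * (C * (1/8)^n)"
      using d[of n] by (intro mult_left_mono) (auto simp: D_def[abs_def])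
    also have "\<dots> = C * (4 * (1/8))^n" by (simp only: power_mult_distrib) simp
    finally show ?thesis by simp
  qed
  have sumC: "summable (\<lambda>n. C * (1/2::real)^n)"
    by (intro summable_mult) simp
  have sumI: "summable (\<lambda>n. LINT z|M. norm (f n z))"
    by (rule summable_comparison_test'[OF sumC, of 0]) (use If in auto)
  define N where "N n z = ennreal (f n z)" for n z
  have "(\<integral>\<^sup>+z. (\<Sum>n. N n z) \<partial>M) = (\<Sum>n. \<integral>\<^sup>+z. N n z \<partial>M)"
    unfolding N_def f_def by (rule nn_integral_suminf) measurable
  also have "\<dots> = (\<Sum>n. ennreal (LINT z|M. norm (f n z)))"
  proof -
    have "(\<integral>\<^sup>+z. N n z \<partial>M) = ennreal (LINT z|M. norm (f n z))" for n
    proof -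
      have "(\<lambda>z. norm (f n z)) = f n" by (auto simp: f_def)
      moreover have "(\<integral>\<^sup>+z. N n z \<partial>M) = ennreal (integral\<^sup>L M (f n))"
        unfolding N_def by (rule nn_integral_eq_integral[OF f]) (simp add: f_def)
      ultimately show ?thesis by simp
    qed
    then show ?thesis by simp
  qed
  also have "\<dots> < \<infinity>"
    using sumI by (subst suminf_ennreal2) (auto simp: less_top)
  finally have fin: "(\<integral>\<^sup>+z. (\<Sum>n. N n z) \<partial>M) < \<infinity>" .
  have "AE z in M. (\<Sum>n. N n z) \<noteq> \<infinity>"
    by (rule nn_integral_PInf_AE) (use fin in \<open>auto simp: N_def f_def\<close>)
  then have sf: "AE z in M. summable (\<lambda>n. f n z)"
    by eventually_elim (auto simp: N_def f_def intro!: summable_suminf_not_top)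
  define S where "S z = (\<Sum>n. f n z)" for z
  have S: "integrable M S"
    unfolding S_def by (rule integrable_suminf[OF f]) (use sf sumI in \<open>auto simp: f_def\<close>)
  have Dle: "AE z in M. \<forall>n. \<bar>D n z\<bar> \<le> sqrt (S z) * (1/2)^n"
    using sf
  proof eventually_elim
    case (elim z)
    show ?case
    proof
      fix n
      have "f n z \<le> S z"
        unfolding S_def using sum_le_suminf[OF elim, of "{n}"] by (auto simp: f_def)
      then have "(2^n * \<bar>D n z\<bar>)^2 \<le> S z"
        by (simp add: f_def power_mult_distrib power_mult[symmetric] mult.commute[of n 2])
           (simp add: power_mult)
      then have "2^n * \<bar>D n z\<bar> \<le> sqrt (S z)"
        by (rule real_le_rsqrt)
      then show "\<bar>D n z\<bar> \<le> sqrt (S z) * (1/2)^n"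
        by (simp add: field_simps)
    qed
  qed
  define W where "W z = w 0 z + (\<Sum>n. D n z)" for z
  have tele: "w m z = w 0 z + (\<Sum>n<m. D n z)" for m z
    unfolding D_def by (induction m) auto
  have diff: "AE z in M. \<forall>m. \<bar>w m z - W z\<bar> \<le> 2 * (1/2)^m * sqrt (S z)"
    using Dle
  proof eventually_elim
    case (elim z)
    have sum0: "summable (\<lambda>n. sqrt (S z) * (1/2)^n)"
      by (intro summable_mult) simp
    have sabs: "summable (\<lambda>n. \<bar>D n z\<bar>)"
      by (rule summable_comparison_test'[OF sum0, of 0]) (use elim in auto)
    have sD: "summable (\<lambda>n. D n z)"
      using sabs by (rule summable_rabs_cancel)
    show ?case
    proof
      fix m
      have "W z - w m z = (\<Sum>n. D (n + m) z)"
        unfolding W_def tele[of m] using suminf_split_initial_segment[OF sD, of m] by simp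
      also have "\<bar>\<dots>\<bar> \<le> (\<Sum>n. \<bar>D (n + m) z\<bar>)"
        by (intro summable_rabs iffD2[OF summable_iff_shift[of "\<lambda>n. \<bar>D n z\<bar>"]] sabs)
      also have "\<dots> \<le> (\<Sum>n. (sqrt (S z) * (1/2)^m) * (1/2)^n)"
      proof (rule suminf_le)
        show "\<bar>D (n + m) z\<bar> \<le> (sqrt (S z) * (1/2)^m) * (1/2)^n" for n
        proof -
          have "\<bar>D (n + m) z\<bar> \<le> sqrt (S z) * (1/2)^(n + m)" using elim by blast
          also have "\<dots> = (sqrt (S z) * (1/2)^m) * (1/2)^n" by (simp only: power_add mult_ac)
          finally show ?thesis .
        qed
        show "summable (\<lambda>n. \<bar>D (n + m) z\<bar>)"
          by (intro iffD2[OF summable_iff_shift[of "\<lambda>n. \<bar>D n z\<bar>"]] sabs)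
        show "summable (\<lambda>n. (sqrt (S z) * (1/2)^m) * (1/2)^n)" by (intro summable_mult) simp
      qed
      also have "\<dots> = 2 * (1/2)^m * sqrt (S z)"
        by (subst suminf_mult) (auto simp: suminf_geometric)
      finally show "\<bar>w m z - W z\<bar> \<le> 2 * (1/2)^m * sqrt (S z)" by (simp add: abs_minus_commute)
    qed
  qed
  have [measurable]: "S \<in> borel_measurable M" using S by auto
  have Sn: "AE z in M. 0 \<le> S z"
    using sf by eventually_elim (auto simp: S_def f_def intro!: suminf_nonneg)
  have sqS: "in_L2 M (\<lambda>z. sqrt (S z))"
    unfolding in_L2_def
  proof
    have "integrable M (\<lambda>z. \<bar>S z\<bar>)" using S by simp
    then show "integrable M (\<lambda>z. (sqrt (S z))^2)"
      by (rule Bochner_Integration.integrable_bound) (auto simp: real_sqrt_abs2 power2_eq_square)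
  qed measurable
  have [measurable]: "W \<in> borel_measurable M"
    unfolding W_def by measurable
  have dom: "AE z in M. \<bar>w m z - W z\<bar> \<le> \<bar>2 * (1/2)^m * sqrt (S z)\<bar>" for m
    using diff by eventually_elim (smt (verit))
  have sdiff: "in_L2 M (\<lambda>z. w m z - W z)" for m
    by (rule in_L2_dominated[OF in_L2_cmult[OF sqS] _ dom]) measurable
  have "in_L2 M W"
    using in_L2_diff[OF w[of 0] sdiff[of 0]] by simp
  moreover have "(\<lambda>n. nsq M (\<lambda>z. w n z - W z)) \<longlonglongrightarrow> 0"
  proof (rule tendsto_sandwich[OF _ _ tendsto_const])
    have "nsq M (\<lambda>z. w m z - W z) \<le> 4 * nsq M (\<lambda>z. sqrt (S z)) * (1/4)^m" for m
    proof -
      have "nsq M (\<lambda>z. w m z - W z) \<le> nsq M (\<lambda>z. 2 * (1/2)^m * sqrt (S z))"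
        by (rule nsq_mono[OF in_L2_cmult[OF sqS] _ dom]) measurable
      also have "\<dots> = 4 * nsq M (\<lambda>z. sqrt (S z)) * (1/4)^m"
        unfolding nsq_cmult
        by (simp add: power_mult_distrib power_mult[symmetric] mult.commute[of _ 2] power_divide)
           (simp add: power_mult)
      finally show ?thesis .
    qed
    then show "\<forall>\<^sub>F m in sequentially. nsq M (\<lambda>z. w m z - W z) \<le> 4 * nsq M (\<lambda>z. sqrt (S z))
        * (1/4)^m"
      by simp
    show "(\<lambda>m. 4 * nsq M (\<lambda>z. sqrt (S z)) * (1/4)^m) \<longlonglongrightarrow> 0"
      by (rule tendsto_mult_right_zero) (rule LIMSEQ_realpow_zero, auto)
  qed auto
  ultimately show ?thesis by (rule that)
qed

section \<open>Smooth time profiles and trigonometric sums\<close>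

text \<open>Plain n-fold differentiability, with the derivative as an existential witness. Closure
  properties then follow by induction on the order, and \<open>Cinf\<close> inherits them by asking
  for all orders at once.\<close>

primrec smoothn :: "nat \<Rightarrow> (real \<Rightarrow> real) \<Rightarrow> bool" where
  "smoothn 0 f \<longleftrightarrow> True"
| "smoothn (Suc n) f \<longleftrightarrow> (\<exists>f'. (\<forall>t. (f has_real_derivative f' t) (at t)) \<and> smoothn n f')"

definition Cinf :: "(real \<Rightarrow> real) \<Rightarrow> bool" where
  "Cinf f \<longleftrightarrow> (\<forall>n. smoothn n f)"

lemma smoothn_Suc_imp: "smoothn (Suc n) f \<Longrightarrow> smoothn n f"
proof (induction n arbitrary: f)
  case (Suc n)
  then obtain f' where "\<forall>t. (f has_real_derivative f' t) (at t)" "smoothn (Suc n) f'"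
    using smoothn.simps(2)[of "Suc n" f] by blast
  with Suc.IH show ?case by auto
qed simp

lemma smoothn_add: "smoothn n f \<Longrightarrow> smoothn n g \<Longrightarrow> smoothn n (\<lambda>t. f t + g t)"
proof (induction n arbitrary: f g)
  case (Suc n)
  then obtain f' g' where "\<forall>t. (f has_real_derivative f' t) (at t)" "smoothn n f'"
     "\<forall>t. (g has_real_derivative g' t) (at t)" "smoothn n g'" by auto
  with Suc.IH[of f' g'] show ?case by (auto intro!: exI[of _ "\<lambda>t. f' t + g' t"] DERIV_add)
qed simp

lemma smoothn_mult: "smoothn n f \<Longrightarrow> smoothn n g \<Longrightarrow> smoothn n (\<lambda>t. f t * g t)"
proof (induction n arbitrary: f g)
  case (Suc n)
  then obtain f' g' where 1: "\<forall>t. (f has_real_derivative f' t) (at t)" "smoothn n f'"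
     "\<forall>t. (g has_real_derivative g' t) (at t)" "smoothn n g'" by auto
  have "smoothn n (\<lambda>t. f' t * g t + g' t * f t)"
    using 1 Suc.prems[THEN smoothn_Suc_imp] by (simp add: smoothn_add Suc.IH)
  with 1 show ?case
    by (auto intro!: exI[of _ "\<lambda>t. f' t * g t + g' t * f t"] DERIV_mult)
qed simp

lemma smoothn_const: "smoothn n (\<lambda>t. c)"
  by (induction n arbitrary: c) (auto intro!: exI[of _ "\<lambda>t. 0"])

lemma smoothn_affine: "smoothn n f \<Longrightarrow> smoothn n (\<lambda>t. f (a * t + b))"
proof (induction n arbitrary: f)
  case (Suc n)
  then obtain f' where f: "\<forall>t. (f has_real_derivative f' t) (at t)" "smoothn n f'" by auto
  have "((\<lambda>t. f (a * t + b)) has_real_derivative f' (a * t + b) * a) (at t)" for t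
    by (rule DERIV_chain2[of f]) (use f in \<open>auto intro!: derivative_eq_intros\<close>)
  moreover have "smoothn n (\<lambda>t. f' (a * t + b) * a)"
    using f Suc.IH by (intro smoothn_mult smoothn_const) auto
  ultimately show ?case
    by (auto intro!: exI[of _ "\<lambda>t. f' (a * t + b) * a"])
qed simp

lemma smoothn_exp: "smoothn n (\<lambda>t. k * exp (c * t))"
proof (induction n arbitrary: k)
  case (Suc n)
  have "((\<lambda>t. k * exp (c * t)) has_real_derivative k * c * exp (c * t)) (at t)" for t
    by (auto intro!: derivative_eq_intros)
  with Suc[of "k * c"] show ?case
    by (auto intro!: exI[of _ "\<lambda>t. k * c * exp (c * t)"])
qed simp

lemma Cinf_const: "Cinf (\<lambda>t. c)"
  and Cinf_exp: "Cinf (\<lambda>t. exp (c * t))"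
  and Cinf_mult: "Cinf f \<Longrightarrow> Cinf g \<Longrightarrow> Cinf (\<lambda>t. f t * g t)"
  and Cinf_affine: "Cinf f \<Longrightarrow> Cinf (\<lambda>t. f (a * t + b))"
  using smoothn_exp[of _ 1 c]
  by (auto simp: Cinf_def intro: smoothn_const smoothn_mult smoothn_affine)

lemma Cinf_obtain_deriv:
  assumes "Cinf f"
  obtains f' where "\<And>t. (f has_real_derivative f' t) (at t)" "Cinf f'"
proof -
  obtain f' where f': "\<And>t. (f has_real_derivative f' t) (at t)"
    using assms smoothn.simps(2)[of 0 f] by (auto simp: Cinf_def simp del: smoothn.simps)
  have "smoothn n f'" for n
  proof -
    obtain g where g: "\<forall>t. (f has_real_derivative g t) (at t)" "smoothn n g"
      using assms smoothn.simps(2)[of n f] by (auto simp: Cinf_def simp del: smoothn.simps)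
    have "g = f'" using g f' DERIV_unique by blast
    with g show ?thesis by simp
  qed
  with f' show ?thesis by (intro that) (auto simp: Cinf_def)
qed

lemma Cinf_deriv: "Cinf f \<Longrightarrow> (\<And>t. (f has_real_derivative f' t) (at t)) \<Longrightarrow> Cinf f'"
  by (metis Cinf_obtain_deriv DERIV_unique ext)

lemma Cinf_continuous: "Cinf f \<Longrightarrow> continuous_on A f"
  by (metis Cinf_obtain_deriv DERIV_isCont continuous_at_imp_continuous_on)

section \<open>Flat exponentials and the scalar equation of a Fourier mode\<close>

lemma poly_exp_tendsto_0: "((\<lambda>x::real. x^k * poly p x * exp (- x)) \<longlongrightarrow> 0) at_top"
proof (induction p arbitrary: k)
  case (pCons a p)
  \<comment> \<open>Splitting off the constant coefficient moves one factor \<open>x\<close> from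
    the polynomial into the power, which is why the claim is made for every
    \<open>k\<close>.\<close>
  have "((\<lambda>x::real. a * (x^k / exp x) + x^Suc k * poly p x * exp (- x)) \<longlongrightarrow> a * 0 + 0) at_top"
    by (intro tendsto_add tendsto_mult tendsto_const tendsto_power_div_exp_0 pCons.IH)
  then show ?case
    by (simp add: field_simps exp_minus)
qed simp

definition flat_exp :: "real poly \<Rightarrow> real \<Rightarrow> real" where
  "flat_exp p s = (if s > 0 then poly p (1/s) * exp (- (1/s)) else 0)"

text \<open>The functions \<open>p(1/s) exp(-1/s)\<close> are closed under differentiation, which turns \<open>p\<close> into
  \<open>X\<^sup>2 (p - p')\<close>; this makes all of them smooth at once.\<close>
lemma flat_exp_deriv:
  "(flat_exp p has_real_derivative flat_exp (monom 1 2 * (p - pderiv p)) s) (at s)"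
proof -
  consider "s > 0" | "s < 0" | "s = 0" by linarith
  then show ?thesis
  proof cases
    case 1
    have "((\<lambda>s. poly p (1/s) * exp (- (1/s))) has_real_derivative
       flat_exp (monom 1 2 * (p - pderiv p)) s) (at s)"
      using 1 by (auto intro!: derivative_eq_intros DERIV_chain2[OF poly_DERIV]
          simp: flat_exp_def poly_monom field_simps power2_eq_square)
    then show ?thesis
      by (rule has_field_derivative_transform_within_open[where S="{0<..}"])
         (use 1 in \<open>auto simp: flat_exp_def\<close>)
  next
    case 2
    have "((\<lambda>s::real. 0::real) has_real_derivative flat_exp (monom 1 2 * (p - pderiv p)) s) (at s)"
      using 2 by (simp add: flat_exp_def)
    then show ?thesis
      by (rule has_field_derivative_transform_within_open[where S="{..<0}"])
         (use 2 in \<open>auto simp: flat_exp_def\<close>)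
  next
    case 3
    have "((\<lambda>h. flat_exp p h / h) \<longlongrightarrow> 0) (at 0)"
    proof (rule filterlim_split_at)
      show "((\<lambda>h. flat_exp p h / h) \<longlongrightarrow> 0) (at_left 0)"
        by (rule tendsto_eventually) (auto simp: flat_exp_def eventually_at_filter)
      \<comment> \<open>Under \<open>x = 1/h\<close> the difference quotient at 0 becomes
        \<open>x * p(x) * exp (- x)\<close>, the case \<open>k = 1\<close> of the limit
        above.\<close>
      have "((\<lambda>h. (inverse h)^1 * poly p (inverse h) * exp (- inverse h)) \<longlongrightarrow> 0) (at_right (0::real))"
        by (rule filterlim_compose[OF poly_exp_tendsto_0 filterlim_inverse_at_top_right])
      then show "((\<lambda>h. flat_exp p h / h) \<longlongrightarrow> 0) (at_right 0)"
        by (rule Lim_transform_eventually)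
           (auto simp: flat_exp_def eventually_at_filter field_simps)
    qed
    then show ?thesis
      using 3 by (simp add: DERIV_def flat_exp_def)
  qed
qed

lemma Cinf_flat_exp: "Cinf (flat_exp p)"
proof -
  have "smoothn n (flat_exp p)" for n
    by (induction n arbitrary: p) (use flat_exp_deriv in auto)
  then show ?thesis by (simp add: Cinf_def)
qed

definition flat_step :: "real \<Rightarrow> real" where
  "flat_step = flat_exp 1"

lemma flat_step_eq: "flat_step s = (if s > 0 then exp (- (1/s)) else 0)"
  by (simp add: flat_step_def flat_exp_def)

lemma Cinf_flat_step: "Cinf flat_step"
  by (simp add: flat_step_def Cinf_flat_exp)

lemma flat_step_bounds: "0 \<le> flat_step s" "flat_step s \<le> 1" "s \<le> 0 \<Longrightarrow> flat_step s = 0"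
  by (auto simp: flat_step_eq)

lemma flat_step_tendsto:
  assumes "filterlim f at_top sequentially"
  shows "(\<lambda>n. flat_step (f n)) \<longlonglongrightarrow> 1"
proof -
  have "((\<lambda>n. exp (- inverse (f n))) \<longlonglongrightarrow> exp (- 0))"
    by (intro tendsto_intros filterlim_compose[OF tendsto_inverse_0_at_top[OF filterlim_ident]
        assms])
  moreover have "\<forall>\<^sub>F n in sequentially. exp (- inverse (f n)) = flat_step (f n)"
    using filterlim_at_top_dense[THEN iffD1, OF assms, rule_format, of 0]
    by eventually_elim (auto simp: flat_step_eq field_simps)
  ultimately show ?thesis
    using Lim_transform_eventually by fastforce
qed

text \<open>Variation of constants, with \<open>F\<close> an antiderivative of
  \<open>exp (l * x) * \<eta> x\<close>. Subtracting \<open>F c\<close> makes the solution vanish at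
  \<open>c\<close>, and left of \<open>c\<close> the function \<open>F\<close> is constant because
  the source is zero there. Smoothness is bootstrapped from the equation: the derivative of \<zeta>
  is a combination of \<eta> and \<zeta>. In the applications \<open>l\<close> is an eigenvalue of
  minus the Laplacian.\<close>

lemma Cinf_ode:
  assumes "Cinf \<eta>" and "\<And>t. t \<le> c \<Longrightarrow> \<eta> t = 0"
  obtains \<zeta> where "Cinf \<zeta>" "\<And>t. (\<zeta> has_real_derivative \<eta> t - l * \<zeta> t) (at t)"
    "\<And>t. t \<le> c \<Longrightarrow> \<zeta> t = 0"
proof -
  have "\<exists>F. \<forall>x::real. -\<infinity> < ereal x \<longrightarrow> ereal x < \<infinity> \<longrightarrow>
     (F has_vector_derivative (exp (l * x) * \<eta> x)) (at x)"
  proof (rule einterval_antiderivative)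
    fix x
    have "continuous_on UNIV (\<lambda>x. exp (l * x) * \<eta> x)"
      by (intro continuous_intros Cinf_continuous assms)
    then show "isCont (\<lambda>x. exp (l * x) * \<eta> x) x"
      by (simp add: continuous_on_eq_continuous_at)
  qed simp
  then obtain F where F: "\<And>x. (F has_real_derivative exp (l * x) * \<eta> x) (at x)"
    by (auto simp: has_real_derivative_iff_has_vector_derivative)
  define \<zeta> where "\<zeta> t = exp (- l * t) * (F t - F c)" for t
  have d: "(\<zeta> has_real_derivative \<eta> t - l * \<zeta> t) (at t)" for t
  proof -
    have "((\<lambda>t. exp (- l * t) * (F t - F c)) has_real_derivative exp (- l * t) * (exp (l * t) * \<eta> t)
        + (- l) * exp (- l * t) * (F t - F c)) (at t)"
      unfolding \<zeta>_def by (rule derivative_eq_intros F refl | simp)+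
    also have "exp (- l * t) * (exp (l * t) * \<eta> t) = \<eta> t"
      by (simp add: mult.assoc[symmetric] exp_add[symmetric])
    finally show ?thesis unfolding \<zeta>_def by (simp add: mult.assoc)
  qed
  have "smoothn n \<zeta>" for n
  proof (induction n)
    case (Suc n)
    have "smoothn n (\<lambda>t. \<eta> t + (- l) * \<zeta> t)"
      using assms(1) Suc by (intro smoothn_add smoothn_mult smoothn_const) (auto simp: Cinf_def)
    with d show ?case by (auto intro!: exI[of _ "\<lambda>t. \<eta> t - l * \<zeta> t"])
  qed simp
  moreover have "\<zeta> t = 0" if "t \<le> c" for t
  proof -
    have "F t = F c"
    proof (cases "t = c")
      case False
      then have "t < c" using that by simp
      have "\<exists>z>t. z < c \<and> F c - F t = (c - t) * (exp (l * z) * \<eta> z)"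
        by (rule MVT2[OF \<open>t < c\<close>]) (use F in blast)
      then show ?thesis using assms(2) by auto
    qed simp
    then show ?thesis by (simp add: \<zeta>_def)
  qed
  ultimately show ?thesis using d by (intro that[of \<zeta>]) (auto simp: Cinf_def)
qed

section \<open>Directional derivatives and space-time trigonometric sums\<close>

definition pd :: "('a::real_normed_vector \<Rightarrow> real) \<Rightarrow> 'a \<Rightarrow> 'a \<Rightarrow> real" where
  "pd f v = (\<lambda>z. frechet_derivative f (at z) v)"

lemma smooth_fun_differentiable: "smooth_fun f \<Longrightarrow> f differentiable (at z)"
  by (auto elim: smooth_fun.cases)

lemma smooth_fun_pd: "smooth_fun f \<Longrightarrow> smooth_fun (pd f v)"
  unfolding pd_def by (auto elim: smooth_fun.cases)

lemma smooth_fun_continuous: "smooth_fun f \<Longrightarrow> continuous_on A f"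
  by (meson continuous_at_imp_continuous_on differentiable_imp_continuous_within
      smooth_fun_differentiable)

lemma pd_eqI: "(f has_derivative F) (at z) \<Longrightarrow> pd f v z = F v"
  unfolding pd_def by (simp add: frechet_derivative_at[symmetric])

lemma has_derivative_pd: "f differentiable (at z) \<Longrightarrow> (f has_derivative (\<lambda>v. pd f v z)) (at z)"
  unfolding pd_def by (simp add: frechet_derivative_works)

lemma pd_add: "f differentiable (at z) \<Longrightarrow> g differentiable (at z) \<Longrightarrow>
   pd (\<lambda>z. f z + g z) v z = pd f v z + pd g v z"
  by (intro pd_eqI has_derivative_add has_derivative_pd)

lemma pd_mult: "f differentiable (at z) \<Longrightarrow> g differentiable (at z) \<Longrightarrow>
   pd (\<lambda>z. f z * g z) v z = f z * pd g v z + pd f v z * g z"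
  by (intro pd_eqI[where F="\<lambda>v. f z * pd g v z + pd f v z * g z"] has_derivative_mult
      has_derivative_pd)

lemma pd_cmult: "f differentiable (at z) \<Longrightarrow> pd (\<lambda>z. c * f z) v z = c * pd f v z"
  using has_derivative_mult_right[OF has_derivative_pd[of f z], of c] by (intro pd_eqI) auto

text \<open>The free phase \<theta> lets a cosine stand for a sine as well: a derivative in space
  only multiplies the profile by a constant and shifts the phase by \<open>pi/2\<close>. So
  real-valued waves are closed under differentiation.\<close>

definition plane_wave :: "(real \<Rightarrow> real) \<Rightarrow> real^'d \<Rightarrow> real \<Rightarrow> real \<times> (real^'d) \<Rightarrow> real" where
  "plane_wave \<eta> \<kappa> \<theta> z = \<eta> (fst z) * cos (2 * pi * (\<kappa> \<bullet> snd z) + \<theta>)"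

text \<open>The class \<open>P\<close> of time profiles is a parameter so that the closure
  properties are shared by forward solutions (flat near the initial time), backward solutions (flat
  near the final time) and test functions (flat near both). Integer frequencies make the sums
  periodic on the torus.\<close>

inductive trig_sum :: "((real \<Rightarrow> real) \<Rightarrow> bool) \<Rightarrow> (real \<times> (real^'d) \<Rightarrow> real) \<Rightarrow> bool" for P where
  wave: "P \<eta> \<Longrightarrow> (\<forall>i. \<kappa> $ i \<in> \<int>) \<Longrightarrow> trig_sum P (plane_wave \<eta> \<kappa> \<theta>)"
| add: "trig_sum P f \<Longrightarrow> trig_sum P g \<Longrightarrow> trig_sum P (\<lambda>z. f z + g z)"

locale profiles =
  fixes P :: "(real \<Rightarrow> real) \<Rightarrow> bool"
  assumes P_Cinf: "P \<eta> \<Longrightarrow> Cinf \<eta>"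
    and P_mult: "P \<eta> \<Longrightarrow> Cinf c \<Longrightarrow> P (\<lambda>t. c t * \<eta> t)"
    and P_deriv: "P \<eta> \<Longrightarrow> (\<And>t. (\<eta> has_real_derivative \<eta>' t) (at t)) \<Longrightarrow> P \<eta>'"

definition left_prof :: "(real \<Rightarrow> real) \<Rightarrow> bool" where
  "left_prof \<eta> \<longleftrightarrow> Cinf \<eta> \<and> (\<exists>a>0. \<forall>t\<le>a. \<eta> t = 0)"

definition right_prof :: "real \<Rightarrow> (real \<Rightarrow> real) \<Rightarrow> bool" where
  "right_prof T \<eta> \<longleftrightarrow> Cinf \<eta> \<and> (\<exists>b<T. \<forall>t\<ge>b. \<eta> t = 0)"

definition cpt_prof :: "real \<Rightarrow> (real \<Rightarrow> real) \<Rightarrow> bool" where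
  "cpt_prof T \<eta> \<longleftrightarrow> left_prof \<eta> \<and> right_prof T \<eta>"

lemma deriv_0_of_locally_0:
  assumes "(\<eta> has_real_derivative d) (at t)" "open A" "t \<in> A" "\<And>s. s \<in> A \<Longrightarrow> \<eta> s = 0"
  shows "d = 0"
proof -
  have "((\<lambda>s. 0::real) has_real_derivative d) (at t)"
    by (rule has_field_derivative_transform_within_open[OF assms(1,2,3)]) (use assms(4) in auto)
  then show ?thesis using DERIV_unique DERIV_const by blast
qed

interpretation Cinf: profiles Cinf
  by standard (auto intro: Cinf_mult Cinf_deriv)

interpretation left_prof: profiles left_prof
proof
  fix \<eta> \<eta>' assume \<eta>: "left_prof \<eta>" and d: "\<And>t. (\<eta> has_real_derivative \<eta>' t) (at t)"
  then obtain a where a: "a > 0" "\<And>t. t \<le> a \<Longrightarrow> \<eta> t = 0" by (auto simp: left_prof_def)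
  have "\<eta>' t = 0" if "t \<le> a/2" for t
    by (rule deriv_0_of_locally_0[OF d, of "{..<a}"]) (use that a in auto)
  moreover have "Cinf \<eta>'" using Cinf_deriv[OF _ d] \<eta> by (simp add: left_prof_def)
  ultimately show "left_prof \<eta>'"
    using a(1) unfolding left_prof_def by (metis half_gt_zero)
next
  fix \<eta> c assume *: "left_prof \<eta>" "Cinf c"
  then have "Cinf (\<lambda>t. c t * \<eta> t)" by (intro Cinf_mult) (auto simp: left_prof_def)
  with * show "left_prof (\<lambda>t. c t * \<eta> t)"
    unfolding left_prof_def by (metis mult_zero_right)
qed (simp add: left_prof_def)

interpretation right_prof: profiles "right_prof T" for T
proof
  fix \<eta> \<eta>' assume \<eta>: "right_prof T \<eta>" and d: "\<And>t. (\<eta> has_real_derivative \<eta>' t) (at t)"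
  then obtain b where b: "b < T" "\<And>t. t \<ge> b \<Longrightarrow> \<eta> t = 0" by (auto simp: right_prof_def)
  have "\<eta>' t = 0" if "t \<ge> (b + T)/2" for t
    by (rule deriv_0_of_locally_0[OF d, of "{b<..}"]) (use that b in auto)
  moreover have "Cinf \<eta>'" using Cinf_deriv[OF _ d] \<eta> by (simp add: right_prof_def)
  moreover have "(b + T)/2 < T" using b by simp
  ultimately show "right_prof T \<eta>'"
    unfolding right_prof_def by blast
next
  fix \<eta> c assume *: "right_prof T \<eta>" "Cinf c"
  then have "Cinf (\<lambda>t. c t * \<eta> t)" by (intro Cinf_mult) (auto simp: right_prof_def)
  with * show "right_prof T (\<lambda>t. c t * \<eta> t)"
    unfolding right_prof_def by (metis mult_zero_right)
qed (simp add: right_prof_def)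

interpretation cpt_prof: profiles "cpt_prof T" for T
  by standard
     (simp_all add: cpt_prof_def left_prof.P_Cinf left_prof.P_mult right_prof.P_mult,
       blast intro: left_prof.P_deriv right_prof.P_deriv)

lemma trig_sum_mono: "trig_sum P f \<Longrightarrow> (\<And>\<eta>. P \<eta> \<Longrightarrow> Q \<eta>) \<Longrightarrow> trig_sum Q f"
  by (induction rule: trig_sum.induct) (auto intro: trig_sum.intros)

lemma trig_sum_periodic: "trig_sum P f \<Longrightarrow> f (t, x + axis i 1) = f (t, x)"
proof (induction rule: trig_sum.induct)
  case (wave \<eta> \<kappa> \<theta>)
  from wave(2) obtain k :: int where k: "\<kappa> $ i = of_int k" by (metis Ints_cases)
  have "\<kappa> \<bullet> axis i 1 = of_int k" using k by (simp add: inner_axis)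
  then have "2 * pi * (\<kappa> \<bullet> (x + axis i 1)) + \<theta> = (2 * pi * (\<kappa> \<bullet> x) + \<theta>) + 2 * pi * of_int k"
    by (simp add: inner_add_right algebra_simps)
  moreover have "cos (y + 2 * pi * of_int k) = cos y" for y
    using cos_add[of y "2 * pi * of_int k"] sin_int_2pin[of k] cos_int_2pin[of k]
    by (simp add: mult.assoc)
  ultimately show ?case by (simp only: plane_wave_def fst_conv snd_conv)
qed simp

lemma trig_sum_mult_time:
  assumes "trig_sum P f" "\<And>\<eta>. P \<eta> \<Longrightarrow> Q (\<lambda>t. c t * \<eta> t)"
  shows "trig_sum Q (\<lambda>z. c (fst z) * f z)"
  using assms(1)
proof (induction rule: trig_sum.induct)
  case (wave \<eta> \<kappa> \<theta>)
  have "(\<lambda>z. c (fst z) * plane_wave \<eta> \<kappa> \<theta> z) = plane_wave (\<lambda>t. c t * \<eta> t) \<kappa> \<theta>"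
    by (auto simp: plane_wave_def)
  with wave assms(2) show ?case by (auto intro: trig_sum.wave)
next
  case (add f g)
  then show ?case by (simp add: distrib_left trig_sum.add)
qed

lemma plane_wave_has_derivative:
  assumes "\<And>t. (\<eta> has_real_derivative \<eta>' t) (at t)"
  shows "(plane_wave \<eta> \<kappa> \<theta> has_derivative (\<lambda>v. fst v * \<eta>' (fst z) * cos (2 * pi * (\<kappa> \<bullet> snd z) + \<theta>)
     + \<eta> (fst z) * (2 * pi * (\<kappa> \<bullet> snd v)) * cos (2 * pi * (\<kappa> \<bullet> snd z) + \<theta> + pi/2))) (at z)"
proof -
  have 1: "((\<lambda>z. \<eta> (fst z)) has_derivative (\<lambda>v. \<eta>' (fst z) * fst v)) (at z)"
    by (rule has_derivative_compose[where f=fst and g=\<eta>])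
       (use assms[unfolded has_field_derivative_def] in \<open>auto intro!: derivative_eq_intros\<close>)
  have 2: "((\<lambda>z. cos (2 * pi * (\<kappa> \<bullet> snd z) + \<theta>)) has_derivative
     (\<lambda>v. - sin (2 * pi * (\<kappa> \<bullet> snd z) + \<theta>) * (2 * pi * (\<kappa> \<bullet> snd v)))) (at z)"
    by (auto intro!: derivative_eq_intros)
  have 3: "cos (y + pi/2) = - sin y" for y
    by (simp add: cos_add)
  show ?thesis
    unfolding plane_wave_def
    by (rule has_derivative_eq_rhs[OF has_derivative_mult[OF 1 2]])
        (unfold 3, auto simp: algebra_simps)
qed

lemma pd_plane_wave:
  assumes "\<And>t. (\<eta> has_real_derivative \<eta>' t) (at t)"
  shows "pd (plane_wave \<eta> \<kappa> \<theta>) v = (\<lambda>z. plane_wave (\<lambda>t. fst v * \<eta>' t) \<kappa> \<theta> z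
     + plane_wave (\<lambda>t. (2 * pi * (\<kappa> \<bullet> snd v)) * \<eta> t) \<kappa> (\<theta> + pi/2) z)"
  by (auto simp: pd_eqI[OF plane_wave_has_derivative[OF assms]] plane_wave_def add.assoc)

context profiles
begin

lemma P_cmult: "P \<eta> \<Longrightarrow> P (\<lambda>t. c * \<eta> t)"
  using P_mult[of \<eta> "\<lambda>t. c"] Cinf_const by simp

lemma trig_sum_Cinf: "trig_sum P f \<Longrightarrow> trig_sum Cinf f"
  using trig_sum_mono[of P f Cinf] P_Cinf by blast

lemma trig_sum_differentiable: "trig_sum P f \<Longrightarrow> f differentiable (at z)"
proof (induction rule: trig_sum.induct)
  case (wave \<eta> \<kappa> \<theta>)
  obtain \<eta>' where d: "\<And>t. (\<eta> has_real_derivative \<eta>' t) (at t)"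
    using Cinf_obtain_deriv[OF P_Cinf[OF wave(1)]] by blast
  show ?case
    unfolding differentiable_def by (rule exI, rule plane_wave_has_derivative[OF d])
qed simp

lemma trig_sum_cmult: "trig_sum P f \<Longrightarrow> trig_sum P (\<lambda>z. c * f z)"
  using trig_sum_mult_time[of P f P "\<lambda>t. c"] P_cmult by simp

lemma trig_sum_diff: "trig_sum P f \<Longrightarrow> trig_sum P g \<Longrightarrow> trig_sum P (\<lambda>z. f z - g z)"
  using trig_sum.add[of P f "\<lambda>z. - 1 * g z"] trig_sum_cmult[of g "-1"] by simp

lemma trig_sum_pd: "trig_sum P f \<Longrightarrow> trig_sum P (pd f v)"
proof (induction rule: trig_sum.induct)
  case (wave \<eta> \<kappa> \<theta>)
  obtain \<eta>' where d: "\<And>t. (\<eta> has_real_derivative \<eta>' t) (at t)"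
    using Cinf_obtain_deriv[OF P_Cinf[OF wave(1)]] by blast
  show ?case
    unfolding pd_plane_wave[OF d]
    by (intro trig_sum.intros P_cmult wave P_deriv[OF wave(1) d])
next
  case (add f g)
  have "pd (\<lambda>z. f z + g z) v = (\<lambda>z. pd f v z + pd g v z)"
    using add by (auto simp: pd_add trig_sum_differentiable)
  then show ?case using trig_sum.add[OF add.IH] by simp
qed

text \<open>Symmetry of second derivatives, read off from the explicit double derivative of a plane
  wave, in which the two directions enter symmetrically.\<close>

lemma pd_trig_sum_commute: "trig_sum P f \<Longrightarrow> pd (pd f u) v = pd (pd f v) u"
proof (induction rule: trig_sum.induct)
  case (wave \<eta> \<kappa> \<theta>)
  obtain \<eta>' where d: "\<And>t. (\<eta> has_real_derivative \<eta>' t) (at t)" and "Cinf \<eta>'"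
    using Cinf_obtain_deriv[OF P_Cinf[OF wave(1)]] by blast
  then obtain \<eta>'' where d2: "\<And>t. (\<eta>' has_real_derivative \<eta>'' t) (at t)"
    using Cinf_obtain_deriv by blast
  have w: "trig_sum P (plane_wave (\<lambda>t. fst v * \<eta>' t) \<kappa> \<theta>)"
     "trig_sum P (plane_wave (\<lambda>t. (2 * pi * (\<kappa> \<bullet> snd v)) * \<eta> t) \<kappa> (\<theta> + pi/2))" for v \<theta>
    by (intro trig_sum.intros P_cmult wave P_deriv[OF wave(1) d])+
  have c: "((\<lambda>t. c * \<eta> t) has_real_derivative c * \<eta>' t) (at t)"
      "((\<lambda>t. c * \<eta>' t) has_real_derivative c * \<eta>'' t) (at t)" for c t
    by (intro DERIV_cmult d d2)+
  have "pd (pd (plane_wave \<eta> \<kappa> \<theta>) u) v z =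
       plane_wave (\<lambda>t. fst v * (fst u * \<eta>'' t)) \<kappa> \<theta> z
     + plane_wave (\<lambda>t. (2 * pi * (\<kappa> \<bullet> snd v)) * (fst u * \<eta>' t)) \<kappa> (\<theta> + pi/2) z
     + (plane_wave (\<lambda>t. fst v * ((2 * pi * (\<kappa> \<bullet> snd u)) * \<eta>' t)) \<kappa> (\<theta> + pi/2) z
     + plane_wave (\<lambda>t. (2 * pi * (\<kappa> \<bullet> snd v)) * ((2 * pi * (\<kappa> \<bullet> snd u)) * \<eta> t)) \<kappa> (\<theta> + pi/2 + pi/2)
         z)"
    for u v z
    unfolding pd_plane_wave[OF d]
    by (subst pd_add) (auto simp only: pd_plane_wave[OF c(1)] pd_plane_wave[OF c(2)] intro!:
        trig_sum_differentiable w)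
  note e = this
  show ?case
    by (intro ext) (unfold e, simp add: plane_wave_def algebra_simps)
next
  case (add f g)
  have "pd (\<lambda>z. f z + g z) v = (\<lambda>z. pd f v z + pd g v z)" for v
    using add by (auto simp: pd_add trig_sum_differentiable)
  note e = this
  show ?case
    using add.hyps unfolding e
    by (intro ext) (simp add: pd_add trig_sum_differentiable trig_sum_pd add.IH)
qed

lemma trig_sum_smooth: "trig_sum P f \<Longrightarrow> smooth_fun f"
proof (coinduction arbitrary: f rule: smooth_fun.coinduct)
  case (smooth_fun f)
  then show ?case
    using trig_sum_pd[OF smooth_fun] by (auto simp: pd_def intro: trig_sum_differentiable)
qed

end

lemma trig_sum_left_vanish: "trig_sum left_prof f \<Longrightarrow> \<exists>a>0. \<forall>z. fst z \<le> a \<longrightarrow> f z = 0"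
proof (induction rule: trig_sum.induct)
  case (add f g)
  then obtain a b where "a > 0" "b > 0" "\<forall>z. fst z \<le> a \<longrightarrow> f z = 0" "\<forall>z. fst z \<le> b \<longrightarrow> g z = 0"
    by blast
  then show ?case by (intro exI[of _ "min a b"]) auto
qed (auto simp: left_prof_def plane_wave_def)

lemma trig_sum_right_vanish: "trig_sum (right_prof T) f \<Longrightarrow> \<exists>b<T. \<forall>z. fst z \<ge> b \<longrightarrow> f z = 0"
proof (induction rule: trig_sum.induct)
  case (add f g)
  then obtain a b where "a < T" "b < T" "\<forall>z. fst z \<ge> a \<longrightarrow> f z = 0" "\<forall>z. fst z \<ge> b \<longrightarrow> g z = 0"
    by blast
  then show ?case by (intro exI[of _ "max a b"]) auto
qed (auto simp: right_prof_def plane_wave_def)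

section \<open>The heat equation on trigonometric sums\<close>

definition laplacian :: "(real \<times> (real^'d) \<Rightarrow> real) \<Rightarrow> real \<times> (real^'d) \<Rightarrow> real" where
  "laplacian w z = (\<Sum>i\<in>UNIV. pd (pd w (e_x i)) (e_x i) z)"

lemma laplacian_add:
  assumes "trig_sum Cinf f" "trig_sum Cinf g"
  shows "laplacian (\<lambda>z. f z + g z) = (\<lambda>z. laplacian f z + laplacian g z)"
proof -
  have "pd (\<lambda>z. f z + g z) v = (\<lambda>z. pd f v z + pd g v z)" for v
    using assms by (auto simp: pd_add Cinf.trig_sum_differentiable)
  note e = this
  show ?thesis
    using assms unfolding laplacian_def e
    by (simp add: pd_add Cinf.trig_sum_differentiable Cinf.trig_sum_pd sum.distrib)
qed

lemma laplacian_plane_wave: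
  assumes "Cinf \<eta>"
  shows "laplacian (plane_wave \<eta> \<kappa> \<theta>) z = - (\<Sum>i\<in>UNIV. (2 * pi * \<kappa> $ i)^2) * plane_wave \<eta> \<kappa> \<theta> z"
proof -
  obtain \<eta>' where d: "\<And>t. (\<eta> has_real_derivative \<eta>' t) (at t)" using Cinf_obtain_deriv assms
    by blast
  have c: "((\<lambda>t. c * \<eta> t) has_real_derivative c * \<eta>' t) (at t)" for c t
    by (intro DERIV_cmult d)
  have 0: "plane_wave (\<lambda>t. 0) \<kappa> \<theta> z = 0" for \<kappa> :: "real^'d" and \<theta> z by (simp add: plane_wave_def)
  have "pd (pd (plane_wave \<eta> \<kappa> \<theta>) (e_x i)) (e_x i) z
     = plane_wave (\<lambda>t. (2 * pi * \<kappa> $ i) * ((2 * pi * \<kappa> $ i) * \<eta> t)) \<kappa> (\<theta> + pi/2 + pi/2) z" for i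
    unfolding pd_plane_wave[OF d]
    by (simp add: e_x_def 0 pd_plane_wave[OF c] inner_axis)
  note e = this
  have "cos (y + (\<theta> + pi/2 + pi/2)) = - cos (y + \<theta>)" for y
  proof -
    have "y + (\<theta> + pi/2 + pi/2) = (y + \<theta>) + pi" by simp
    then show ?thesis by (simp only: cos_periodic_pi)
  qed
  then have "pd (pd (plane_wave \<eta> \<kappa> \<theta>) (e_x i)) (e_x i) z
     = - ((2 * pi * \<kappa> $ i)^2 * plane_wave \<eta> \<kappa> \<theta> z)" for i
    unfolding e plane_wave_def by (simp add: power2_eq_square)
  then show ?thesis
    by (simp add: laplacian_def sum_distrib_right sum_negf)
qed

text \<open>A plane wave is an eigenfunction of the Laplacian with eigenvalue \<open>- l\<close>, so
  keeping its spatial part reduces the equation to the scalar problem of \<open>Cinf_ode\<close> for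
  the profile. Flatness of the source near the initial time is inherited by the solution and amounts
  to zero initial value.\<close>

lemma heat_forward:
  assumes "trig_sum left_prof (f :: real \<times> (real^'d) \<Rightarrow> real)"
  shows "\<exists>w. trig_sum left_prof w \<and> (\<forall>z. pd w e_t z - laplacian w z = f z)"
  using assms
proof (induction rule: trig_sum.induct)
  case (wave \<eta> \<kappa> \<theta>)
  then obtain a where a: "a > 0" "\<And>t. t \<le> a \<Longrightarrow> \<eta> t = 0" and c: "Cinf \<eta>" by (auto simp: left_prof_def)
  define l where "l = (\<Sum>i\<in>UNIV. (2 * pi * \<kappa> $ i)^2)"
  obtain \<zeta> where z: "Cinf \<zeta>" "\<And>t. (\<zeta> has_real_derivative \<eta> t - l * \<zeta> t) (at t)"
    "\<And>t. t \<le> a \<Longrightarrow> \<zeta> t = 0"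
    using Cinf_ode[OF c a(2), where l=l] by blast
  have "trig_sum left_prof (plane_wave \<zeta> \<kappa> \<theta>)"
    using z a wave by (intro trig_sum.wave) (auto simp: left_prof_def)
  moreover have "pd (plane_wave \<zeta> \<kappa> \<theta>) e_t z - laplacian (plane_wave \<zeta> \<kappa> \<theta>) z = plane_wave \<eta> \<kappa> \<theta> z"
      for z
    unfolding laplacian_plane_wave[OF z(1)] l_def[symmetric] pd_plane_wave[OF z(2)]
    by (simp add: plane_wave_def e_t_def algebra_simps)
  ultimately show ?case by blast
next
  case (add f g)
  then obtain u v where uv: "trig_sum left_prof u" "\<And>z. pd u e_t z - laplacian u z = f z"
    "trig_sum left_prof v" "\<And>z. pd v e_t z - laplacian v z = g z" by blast
  have "pd (\<lambda>z. u z + v z) e_t z - laplacian (\<lambda>z. u z + v z) z = f z + g z" for z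
    using uv(2)[of z] uv(4)[of z] uv(1,3)
    by (simp add: laplacian_add left_prof.trig_sum_Cinf pd_add left_prof.trig_sum_differentiable)
  with trig_sum.add[OF uv(1,3)] show ?case by blast
qed

text \<open>Time reversal of the forward construction: the scalar equation is solved for the
  reflected profile, and flatness to the left of \<open>- b\<close> becomes flatness to the right of
  \<open>b\<close>.\<close>

lemma heat_backward:
  assumes "trig_sum (right_prof T) (f :: real \<times> (real^'d) \<Rightarrow> real)"
  shows "\<exists>w. trig_sum (right_prof T) w \<and> (\<forall>z. - pd w e_t z - laplacian w z = f z)"
  using assms
proof (induction rule: trig_sum.induct)
  case (wave \<eta> \<kappa> \<theta>)
  then obtain b where b: "b < T" "\<And>t. t \<ge> b \<Longrightarrow> \<eta> t = 0" and c: "Cinf \<eta>"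
    by (auto simp: right_prof_def)
  define l where "l = (\<Sum>i\<in>UNIV. (2 * pi * \<kappa> $ i)^2)"
  have c': "Cinf (\<lambda>t. \<eta> (- t))" using Cinf_affine[OF c, of "-1" 0] by simp
  obtain \<zeta> where z: "Cinf \<zeta>" "\<And>t. (\<zeta> has_real_derivative \<eta> (- t) - l * \<zeta> t) (at t)"
    "\<And>t. t \<le> - b \<Longrightarrow> \<zeta> t = 0"
    using Cinf_ode[OF c', where l=l and c="-b"] b by auto
  have d: "((\<lambda>t. \<zeta> (- t)) has_real_derivative l * \<zeta> (- t) - \<eta> t) (at t)" for t
    by (rule DERIV_cong[OF DERIV_chain2[where f=\<zeta> and g=uminus, OF z(2)]])
       (auto intro!: derivative_eq_intros)
  have z': "Cinf (\<lambda>t. \<zeta> (- t))" using Cinf_affine[OF z(1), of "-1" 0] by simp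
  have "trig_sum (right_prof T) (plane_wave (\<lambda>t. \<zeta> (- t)) \<kappa> \<theta>)"
    using z z' b wave by (intro trig_sum.wave) (auto simp: right_prof_def)
  moreover have "- pd (plane_wave (\<lambda>t. \<zeta> (- t)) \<kappa> \<theta>) e_t z - laplacian (plane_wave (\<lambda>t. \<zeta> (- t)) \<kappa>
      \<theta>) z
       = plane_wave \<eta> \<kappa> \<theta> z" for z
    unfolding laplacian_plane_wave[OF z'] l_def[symmetric] pd_plane_wave[OF d]
    by (simp add: plane_wave_def e_t_def algebra_simps)
  ultimately show ?case by blast
next
  case (add f g)
  then obtain u v where uv: "trig_sum (right_prof T) u" "\<And>z. - pd u e_t z - laplacian u z = f z"
    "trig_sum (right_prof T) v" "\<And>z. - pd v e_t z - laplacian v z = g z" by blast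
  have "- pd (\<lambda>z. u z + v z) e_t z - laplacian (\<lambda>z. u z + v z) z = f z + g z" for z
    using uv(2)[of z] uv(4)[of z] uv(1,3)
    by (simp add: laplacian_add right_prof.trig_sum_Cinf pd_add right_prof.trig_sum_differentiable)
  with trig_sum.add[OF uv(1,3)] show ?case by blast
qed

lemma trig_sum_zero: "P (\<lambda>t. 0) \<Longrightarrow> trig_sum P (\<lambda>z. 0)"
  using trig_sum.wave[of P "\<lambda>t. 0" 0 0] by (simp add: plane_wave_def[abs_def])

section \<open>Integration by parts on the space-time cylinder\<close>

abbreviation cylm :: "real \<Rightarrow> (real \<times> (real^'d)) measure" where
  "cylm T \<equiv> lebesgue_on (cyl T)"

lemma mem_cyl:
  fixes z :: "real \<times> (real^'d)"
  shows "z \<in> cyl T \<longleftrightarrow> 0 < fst z \<and> fst z < T \<and> (\<forall>i. 0 \<le> snd z $ i \<and> snd z $ i \<le> 1)"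
proof -
  have "snd z \<in> cbox 0 One \<longleftrightarrow> (\<forall>i. 0 \<le> snd z $ i \<and> snd z $ i \<le> 1)"
  proof -
    have "(One :: real^'d) $ i = 1" for i
    proof -
      have "(One :: real^'d) $ i = (\<Sum>b\<in>(Basis :: (real^'d) set). b \<bullet> axis i 1)"
        by (simp add: cart_eq_inner_axis inner_sum_left)
      also have "\<dots> = (\<Sum>b\<in>(Basis :: (real^'d) set). if b = axis i 1 then 1 else 0)"
        by (intro sum.cong refl) (auto simp: inner_Basis axis_in_Basis_iff)
      also have "\<dots> = 1" by (simp add: axis_in_Basis_iff)
      finally show ?thesis .
    qed
    then show ?thesis by (simp only: mem_box_cart zero_index simp_thms)
  qed
  then show ?thesis by (auto simp: cyl_def unit_cube_def mem_Times_iff)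
qed

lemma cyl_borel [measurable]: "cyl T \<in> sets borel"
  unfolding cyl_def unit_cube_def by (intro borel_Times) auto

lemma cyl_subset_cbox: "cyl T \<subseteq> cbox (0, 0) (T, One)"
  unfolding cyl_def unit_cube_def by (auto simp: cbox_Pair_eq)

lemma cyl_lmeasurable: "cyl T \<in> lmeasurable"
  by (rule bounded_set_imp_lmeasurable)
     (use bounded_subset[OF bounded_cbox cyl_subset_cbox] in auto)

lemma cyl_lebesgue [simp, measurable]: "cyl T \<in> sets lebesgue"
  by simp

lemma finite_measure_cylm: "finite_measure (cylm T)"
  by (rule finite_measure_lebesgue_on[OF cyl_lmeasurable])

lemma set_integral_cylm: "(LINT z:cyl T|lebesgue. f z) = integral\<^sup>L (cylm T) (f :: _ \<Rightarrow> real)"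
  unfolding set_lebesgue_integral_def by (subst integral_restrict_space) auto

lemma AE_cylm: "(AE z in cylm T. Q z) \<longleftrightarrow> (AE z in lebesgue. z \<in> cyl T \<longrightarrow> Q z)"
  by (subst AE_restrict_space_iff) auto

lemma continuous_bounded_on:
  fixes f :: "'a::euclidean_space \<Rightarrow> real"
  assumes "continuous_on UNIV f" "bounded A"
  obtains B where "\<And>z. z \<in> A \<Longrightarrow> \<bar>f z\<bar> \<le> B"
proof -
  have "compact (f ` closure A)"
    by (intro compact_continuous_image continuous_on_subset[OF assms(1)])
       (use assms in \<open>auto simp: compact_closure\<close>)
  then obtain B where "\<forall>y \<in> f ` closure A. norm y \<le> B"
    using bounded_iff compact_imp_bounded by metis
  then show ?thesis using closure_subset by (intro that[of B]) auto
qed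

lemma bounded_cyl: "bounded (cyl T)"
  by (rule bounded_subset[OF bounded_cbox cyl_subset_cbox])

lemma continuous_measurable_cylm: "continuous_on UNIV (f :: _ \<Rightarrow> real) \<Longrightarrow> f
    \<in> borel_measurable (cylm T)"
  by (rule measurable_restrict_space1) (simp add: borel_measurable_continuous_onI
      measurable_completion)

lemma bounded_in_L2_cylm:
  assumes "f \<in> borel_measurable (cylm T)" "AE z in cylm T. \<bar>f z\<bar> \<le> B"
  shows "in_L2 (cylm T) f"
proof -
  interpret finite_measure "cylm T" by (rule finite_measure_cylm)
  show ?thesis
    by (rule in_L2_dominated[of _ "\<lambda>z. B"])
       (use assms in \<open>auto simp: in_L2_def elim!: eventually_mono\<close>)
qed

lemma continuous_in_L2_cylm:
  assumes "continuous_on UNIV f"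
  shows "in_L2 (cylm T) f"
proof -
  obtain B where "\<And>z. z \<in> cyl T \<Longrightarrow> \<bar>f z\<bar> \<le> B"
    using continuous_bounded_on[OF assms bounded_cyl] by blast
  then show ?thesis
    using assms by (intro bounded_in_L2_cylm[of _ _ B] continuous_measurable_cylm AE_I2)
      (auto simp: space_restrict_space)
qed

lemma in_L2_one_cylm: "in_L2 (cylm T) (\<lambda>z. c)"
  by (intro continuous_in_L2_cylm continuous_intros)

lemma in_L2_imp_integrable_cylm: "in_L2 (cylm T) f \<Longrightarrow> integrable (cylm T) f"
  using in_L2_mult[OF _ in_L2_one_cylm[of T 1], of f] by simp

lemma continuous_integrable_cylm:
  "continuous_on UNIV (f :: real \<times> (real^'d) \<Rightarrow> real) \<Longrightarrow> integrable (cylm T) f"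
  by (rule in_L2_imp_integrable_cylm[OF continuous_in_L2_cylm])

text \<open>Integrals of derivatives are evaluated without Fubini: differentiate the integral of
  \<open>F(z + s e)\<close> at \<open>s = 0\<close>, where for a periodic \<open>F\<close> this integral does not depend on \<open>s\<close>. The
  half-open cell makes the comparison of the shifted domains an exact identity of indicators.\<close>
definition cell :: "real \<Rightarrow> (real \<times> (real^'d)) set" where
  "cell T = {z. 0 < fst z \<and> fst z < T \<and> (\<forall>i. 0 \<le> snd z $ i \<and> snd z $ i < 1)}"

lemma cell_subset: "cell T \<subseteq> cyl T"
  by (auto simp: cell_def mem_cyl less_imp_le)

lemma cell_borel [measurable]: "cell T \<in> sets borel"
proof -
  have 1: "{z::real\<times>(real^'d). 0 < fst z} \<in> sets borel" "{z::real\<times>(real^'d). fst z < T}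
      \<in> sets borel"
    by (intro borel_open open_Collect_less continuous_intros)+
  have 2: "{z::real\<times>(real^'d). snd z $ i < 1} \<in> sets borel" "{z::real\<times>(real^'d). 0 \<le> snd z $ i}
      \<in> sets borel" for i
    by (intro borel_open open_Collect_less borel_closed closed_Collect_le continuous_intros)+
  have "cell T = {z. 0 < fst z} \<inter> {z. fst z < T} \<inter> (\<Inter>i\<in>UNIV. {z::real\<times>(real^'d). 0 \<le> snd z $ i} \<inter>
      {z. snd z $ i < 1})"
    by (auto simp: cell_def)
  also have "\<dots> \<in> sets borel"
    by (intro sets.Int 1 2 sets.finite_INT) auto
  finally show ?thesis .
qed

lemma bounded_cell: "bounded (cell T)"
  by (rule bounded_subset[OF bounded_cyl cell_subset])

text \<open>The closed cylinder and the half-open cell differ only in points with some space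
  coordinate equal to 1, which lie in finitely many hyperplanes.\<close>

lemma integral_cylm_cell:
  fixes F :: "real \<times> (real^'d) \<Rightarrow> real"
  assumes "continuous_on UNIV F"
  shows "integral\<^sup>L (cylm T) F = (LINT z|lborel. indicator (cell T) z * F z)"
proof -
  have [measurable]: "F \<in> borel_measurable borel" using assms
    by (rule borel_measurable_continuous_onI)
  have "negligible (\<Union>i\<in>UNIV. {z::real \<times> (real^'d). z \<bullet> (0, axis i 1) = 1})"
    by (intro negligible_Union ballI finite_imageI finite)
       (auto intro!: negligible_standard_hyperplane simp: Basis_prod_def axis_in_Basis_iff)
  then have N: "(\<Union>i\<in>UNIV. {z::real \<times> (real^'d). z \<bullet> (0, axis i 1) = 1}) \<in> null_sets lebesgue"
    by (simp add: negligible_iff_null_sets)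
  have "integral\<^sup>L (cylm T) F = (LINT z|lebesgue. indicator (cyl T) z * F z)"
    by (subst integral_restrict_space) auto
  also have "\<dots> = (LINT z|lebesgue. indicator (cell T) z * F z)"
  proof (rule integral_cong_AE)
    have "(\<lambda>z. indicator (cyl T) z * F z) \<in> borel_measurable lborel"
         "(\<lambda>z. indicator (cell T) z * F z) \<in> borel_measurable lborel" by measurable
    then show "(\<lambda>z. indicator (cyl T) z * F z) \<in> borel_measurable lebesgue"
         "(\<lambda>z. indicator (cell T) z * F z) \<in> borel_measurable lebesgue"
      by (auto intro: measurable_completion)
    show "AE z in lebesgue. indicator (cyl T) z * F z = indicator (cell T) z * F z"
    proof (rule AE_I'[OF N], rule subsetI)
      fix z :: "real \<times> (real^'d)"
      assume "z \<in> {z \<in> space lebesgue. indicator (cyl T) z * F z \<noteq> indicator (cell T) z * F z}"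
      then have "z \<in> cyl T - cell T" using cell_subset[of T]
        by (cases "z \<in> cyl T"; cases "z \<in> cell T") auto
      then obtain i where "snd z $ i = 1"
        unfolding Diff_iff mem_cyl cell_def mem_Collect_eq by (meson order_le_imp_less_or_eq)
      then show "z \<in> (\<Union>i\<in>UNIV. {z. z \<bullet> (0, axis i 1) = 1})"
        by (cases z) (auto simp: inner_axis)
    qed
  qed
  also have "\<dots> = (LINT z|lborel. indicator (cell T) z * F z)"
    by (rule integral_completion) measurable
  finally show ?thesis .
qed

lemma integral_translate:
  fixes F :: "'a::euclidean_space \<Rightarrow> real"
  assumes [measurable]: "F \<in> borel_measurable borel" "A \<in> sets borel"
  shows "(LINT z|lborel. indicator A z * F (z + e)) = (LINT z|lborel. indicator A (z - e) * F z)"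
proof -
  have "(LINT z|lborel. indicator A (z - e) * F z)
      = (LINT z|distr lborel borel ((+) e). indicator A (z - e) * F z)"
    by (simp add: lborel_distr_plus)
  also have "\<dots> = (LINT z|lborel. indicator A (e + z - e) * F (e + z))"
    by (rule integral_distr) measurable
  finally show ?thesis by (simp add: add.commute)
qed

lemma integrable_indicator_continuous:
  fixes F :: "'a::euclidean_space \<Rightarrow> real"
  assumes "continuous_on UNIV F" "A \<in> sets borel" "bounded A"
  shows "integrable lborel (\<lambda>z. indicator A z * F z)"
proof -
  have [measurable]: "F \<in> borel_measurable borel" "A \<in> sets borel"
    using assms by (auto intro: borel_measurable_continuous_onI)
  obtain B where B: "\<And>z. z \<in> A \<Longrightarrow> \<bar>F z\<bar> \<le> B" using continuous_bounded_on assms(1,3) by blast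
  have "integrable lborel (\<lambda>z. B * indicator A z)"
    using emeasure_bounded_finite[OF assms(3)]
      by (intro integrable_mult_right integrable_real_indicator) auto
  then show ?thesis
    by (rule Bochner_Integration.integrable_bound)
        (use B in \<open>auto simp: indicator_def intro: order_trans[OF _ abs_ge_self]\<close>)
qed

lemma bounded_translate: "bounded (A :: 'a::euclidean_space set) \<Longrightarrow> bounded {z. z - e \<in> A}"
proof -
  assume "bounded A"
  then have "bounded ((\<lambda>z. e + z) ` A)" by (rule bounded_translation)
  moreover have "{z. z - e \<in> A} = (\<lambda>z. e + z) ` A" by (force simp: image_iff)
  ultimately show ?thesis by simp
qed

lemma borel_translate: "(A :: 'a::euclidean_space set) \<in> sets borel \<Longrightarrow> {z. z - e \<in> A} \<in> sets borel"
proof -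
  assume [measurable]: "A \<in> sets borel"
  have "(\<lambda>z. z - e) -` A \<inter> space borel \<in> sets borel" by measurable
  then show ?thesis by (simp add: vimage_def)
qed

text \<open>Moves the translation from the integrand to the domain, so that translated integrals can
  be compared through indicator functions alone.\<close>

lemma integral_shift_cell:
  fixes F :: "real \<times> (real^'d) \<Rightarrow> real"
  assumes "continuous_on UNIV F"
  shows "(LINT z|cylm T. F (z + e)) = (LINT z|lborel. indicator {z. z - e \<in> cell T} z * F z)"
proof -
  have "(LINT z|cylm T. F (z + e)) = (LINT z|lborel. indicator (cell T) z * F (z + e))"
    by (rule integral_cylm_cell) (intro continuous_intros continuous_on_compose2[OF assms], auto)
  also have "\<dots> = (LINT z|lborel. indicator (cell T) (z - e) * F z)"
    by (rule integral_translate) (auto intro: borel_measurable_continuous_onI assms)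
  also have "(\<lambda>z. indicator (cell T) (z - e)) = indicator {z. z - e \<in> cell T}"
    by (auto simp: indicator_def)
  finally show ?thesis .
qed

text \<open>Shifting the cell by \<open>s\<close> in direction \<open>i\<close> removes the slab
  \<open>A\<close> of points whose coordinate is below \<open>s\<close> and adds the translate of
  \<open>A\<close> by one full period. By periodicity \<open>F\<close> has the same integral over
  both slabs.\<close>

lemma integral_shift_space:
  fixes F :: "real \<times> (real^'d) \<Rightarrow> real"
  assumes c: "continuous_on UNIV F" and per: "\<And>t x. F (t, x + axis i 1) = F (t, x)"
    and s: "0 \<le> s" "s \<le> 1"
  shows "(LINT z|cylm T. F (z + s *\<^sub>R e_x i)) = (LINT z|cylm T. F z)"
proof -
  define A where "A = cell T \<inter> {z. snd z $ i < s}"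
  have "{z::real\<times>(real^'d). snd z $ i < s} \<in> sets borel"
    by (intro borel_open open_Collect_less continuous_intros)
  then have A: "A \<in> sets borel" unfolding A_def by (intro sets.Int cell_borel)
  have bA: "bounded A" by (rule bounded_subset[OF bounded_cell]) (auto simp: A_def)
  have ind: "indicator {z. z - s *\<^sub>R e_x i \<in> cell T} z
     = indicator (cell T) z + indicator {z. z - e_x i \<in> A} z - (indicator A z :: real)" for z
  proof -
    have a: "snd (z - r *\<^sub>R e_x i) $ j = (if j = i then snd z $ i - r else snd z $ j)"
        "fst (z - r *\<^sub>R e_x i) = fst z" for r j
      by (auto simp: e_x_def axis_def)
    define Q where "Q \<longleftrightarrow> 0 < fst z \<and> fst z < T \<and> (\<forall>j. j \<noteq> i \<longrightarrow> 0 \<le> snd z $ j \<and> snd z $ j < 1)"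
    have m: "z - r *\<^sub>R e_x i \<in> cell T \<longleftrightarrow> Q \<and> r \<le> snd z $ i \<and> snd z $ i < 1 + r" for r
      unfolding cell_def mem_Collect_eq a Q_def by (auto split: if_splits)
    have 1: "z - s *\<^sub>R e_x i \<in> cell T \<longleftrightarrow> Q \<and> s \<le> snd z $ i \<and> snd z $ i < 1 + s" by (rule m)
    have 2: "z \<in> cell T \<longleftrightarrow> Q \<and> 0 \<le> snd z $ i \<and> snd z $ i < 1" using m[of 0] by simp
    have 3: "z - e_x i \<in> A \<longleftrightarrow> Q \<and> 1 \<le> snd z $ i \<and> snd z $ i < 2 \<and> snd z $ i < 1 + s"
      using m[of 1] a(1)[of 1 i] by (auto simp: A_def)
    have 4: "z \<in> A \<longleftrightarrow> Q \<and> 0 \<le> snd z $ i \<and> snd z $ i < 1 \<and> snd z $ i < s"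
      using 2 by (auto simp: A_def)
    show ?thesis using s unfolding indicator_def mem_Collect_eq 1 2 3 4
      by (cases Q) (auto simp: of_bool_def split: if_splits)
  qed
  have "(LINT z|cylm T. F (z + s *\<^sub>R e_x i))
      = (LINT z|lborel. indicator {z. z - s *\<^sub>R e_x i \<in> cell T} z * F z)"
    by (rule integral_shift_cell[OF c])
  also have "\<dots> = (LINT z|lborel. indicator (cell T) z * F z + indicator {z. z - e_x i \<in> A} z * F z
      - indicator A z * F z)"
    unfolding ind by (simp add: algebra_simps)
  also have "\<dots> = (LINT z|lborel. indicator (cell T) z * F z)
      + (LINT z|lborel. indicator {z. z - e_x i \<in> A} z * F z)
       - (LINT z|lborel. indicator A z * F z)"
    using A bA by (simp add: integrable_indicator_continuous c bounded_cell bounded_translate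
        borel_translate)
  also have "(LINT z|lborel. indicator {z. z - e_x i \<in> A} z * F z)
      = (LINT z|lborel. indicator A (z - e_x i) * F z)"
    by (simp add: indicator_def)
  also have "\<dots> = (LINT z|lborel. indicator A z * F (z + e_x i))"
    by (rule integral_translate[symmetric]) (auto intro: borel_measurable_continuous_onI c A)
  also have "(\<lambda>z. F (z + e_x i)) = F"
    using per by (auto simp: e_x_def)
  finally show ?thesis by (simp add: integral_cylm_cell[OF c])
qed

lemma fst_minus_e_t: "z - s *\<^sub>R e_t \<in> cell T \<longleftrightarrow> s < fst z \<and> fst z < T + s
    \<and> (\<forall>i. 0 \<le> snd z $ i \<and> snd z $ i < 1)"
  by (auto simp: cell_def e_t_def)

lemma integral_shift_mono:
  fixes F :: "real \<times> (real^'d) \<Rightarrow> real"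
  assumes c: "continuous_on UNIV F"
    and le: "\<And>z. indicator (cell T) z * F z \<le> indicator {z. z - e \<in> cell T} z * F z"
  shows "(LINT z|cylm T. F z) \<le> (LINT z|cylm T. F (z + e))"
  unfolding integral_shift_cell[OF c] integral_cylm_cell[OF c]
  by (intro integral_mono le integrable_indicator_continuous c cell_borel bounded_cell
      bounded_translate borel_translate)

text \<open>The mean value theorem writes each difference quotient as the derivative at an
  intermediate point. Continuity of the derivative gives the pointwise limit, and its bound on a
  ball containing all the segments is the majorant for dominated convergence.\<close>

lemma shift_quotient_tendsto:
  fixes F :: "real \<times> (real^'d) \<Rightarrow> real"
  assumes d: "\<And>z. F differentiable (at z)" and c: "continuous_on UNIV (pd F e)"
  shows
      "(\<lambda>n. real (Suc n) * ((LINT z|cylm T. F (z + (1 / real (Suc n)) *\<^sub>R e))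
      - (LINT z|cylm T. F z)))
     \<longlonglongrightarrow> (LINT z|cylm T. pd F e z)"
proof -
  have cF: "continuous_on UNIV F"
    by (meson continuous_at_imp_continuous_on differentiable_imp_continuous_within d)
  have cFs: "continuous_on UNIV (\<lambda>z. F (z + v))" for v
    by (intro continuous_on_compose2[OF cF] continuous_intros) auto
  define q where "q n z = real (Suc n) * (F (z + (1 / real (Suc n)) *\<^sub>R e) - F z)" for n z
  have mvt: "\<exists>x. 0 < x \<and> x < 1 / real (Suc n) \<and> q n z = pd F e (z + x *\<^sub>R e)" for n z
  proof -
    have D: "((\<lambda>s. F (z + s *\<^sub>R e)) has_real_derivative pd F e (z + x *\<^sub>R e)) (at x)" for x
    proof -
      have "((\<lambda>s. F (z + s *\<^sub>R e)) has_derivative (\<lambda>h. pd F (h *\<^sub>R e) (z + x *\<^sub>R e))) (at x)"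
        by (rule has_derivative_compose[where f="\<lambda>s. z + s *\<^sub>R e" and g=F])
           (auto intro!: derivative_eq_intros has_derivative_pd d)
      moreover have "pd F (h *\<^sub>R e) y = h * pd F e y" for h y
        using linear_frechet_derivative[OF d[of y]] by (simp add: pd_def linear_scale)
      ultimately show ?thesis by (simp add: has_field_derivative_def mult.commute[of _ "pd F e _"])
    qed
    have "\<exists>x>0. x < 1 / real (Suc n) \<and> F (z + (1 / real (Suc n)) *\<^sub>R e) - F (z + 0 *\<^sub>R e)
        = (1 / real (Suc n) - 0) * pd F e (z + x *\<^sub>R e)"
      by (rule MVT2) (use D in auto)
    then show ?thesis by (auto simp: q_def)
  qed
  have "(\<lambda>n. LINT z|cylm T. q n z) \<longlonglongrightarrow> (LINT z|cylm T. pd F e z)"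
  proof -
    obtain R where R: "\<And>z :: real \<times> (real^'d). z \<in> cyl T \<Longrightarrow> norm z \<le> R"
      using bounded_cyl[of T] bounded_iff by metis
    obtain B where B: "\<And>z. z \<in> cball 0 (R + norm e) \<Longrightarrow> \<bar>pd F e z\<bar> \<le> B"
      using continuous_bounded_on[OF c bounded_cball] by blast
    show ?thesis
    proof (rule integral_dominated_convergence)
      show "pd F e \<in> borel_measurable (cylm T)" by (rule continuous_measurable_cylm[OF c])
      show "q n \<in> borel_measurable (cylm T)" for n
        unfolding q_def by (intro continuous_measurable_cylm continuous_intros cFs cF)
      show "integrable (cylm T) (\<lambda>z. B)"
        by (intro continuous_integrable_cylm continuous_intros)
      show "AE z in cylm T. (\<lambda>n. q n z) \<longlonglongrightarrow> pd F e z"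
      proof (rule AE_I2)
        fix z
        have "\<forall>n. \<exists>x. 0 < x \<and> x < 1 / real (Suc n) \<and> q n z = pd F e (z + x *\<^sub>R e)"
          using mvt by blast
        from choice[OF this] obtain x
          where x: "\<And>n. 0 < x n \<and> x n < 1 / real (Suc n) \<and> q n z = pd F e (z + x n *\<^sub>R e)"
          by blast
        have "x \<longlonglongrightarrow> 0"
          by (rule tendsto_sandwich[OF _ _ tendsto_const LIMSEQ_inverse_real_of_nat])
             (use x in \<open>auto simp: field_simps intro!: less_imp_le always_eventually\<close>)
        then have "(\<lambda>n. z + x n *\<^sub>R e) \<longlonglongrightarrow> z + 0 *\<^sub>R e" by (intro tendsto_intros)
        then have "(\<lambda>n. pd F e (z + x n *\<^sub>R e)) \<longlonglongrightarrow> pd F e z"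
          using c by (intro continuous_on_tendsto_compose[OF c]) auto
        then show "(\<lambda>n. q n z) \<longlonglongrightarrow> pd F e z" using x by simp
      qed
      show "AE z in cylm T. norm (q n z) \<le> B" for n
      proof (rule AE_I2)
        fix z :: "real \<times> (real^'d)" assume "z \<in> space (cylm T)"
        then have z: "norm z \<le> R" using R by (simp add: space_restrict_space)
        obtain x where x: "0 < x" "x < 1 / real (Suc n)" "q n z = pd F e (z + x *\<^sub>R e)"
          using mvt by blast
        have "x \<le> 1" using less_le_trans[OF x(2), of 1] by simp
        have "norm (z + x *\<^sub>R e) \<le> norm z + x * norm e"
          using norm_triangle_ineq[of z "x *\<^sub>R e"] x(1) by simp
        also have "\<dots> \<le> R + 1 * norm e"
          using z \<open>x \<le> 1\<close> by (intro add_mono mult_right_mono) auto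
        finally show "norm (q n z) \<le> B" using B x(3) by simp
      qed
    qed
  qed
  moreover have "(LINT z|cylm T. q n z)
      = real (Suc n) * ((LINT z|cylm T. F (z + (1 / real (Suc n)) *\<^sub>R e)) - (LINT z|cylm T. F z))"
      for n
    unfolding q_def by (simp add: continuous_integrable_cylm cFs cF)
  ultimately show ?thesis by simp
qed

lemma integral_pd_space:
  fixes F :: "real \<times> (real^'d) \<Rightarrow> real"
  assumes d: "\<And>z. F differentiable (at z)" and c: "continuous_on UNIV (pd F (e_x i))"
    and per: "\<And>t x. F (t, x + axis i 1) = F (t, x)"
  shows "(LINT z|cylm T. pd F (e_x i) z) = 0"
proof -
  have cF: "continuous_on UNIV F"
    by (meson continuous_at_imp_continuous_on differentiable_imp_continuous_within d)
  have "(LINT z|cylm T. F (z + (1 / real (Suc n)) *\<^sub>R e_x i)) = (LINT z|cylm T. F z)" for n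
    by (rule integral_shift_space[OF cF per]) auto
  then show ?thesis
    using shift_quotient_tendsto[OF d c, of T] LIMSEQ_unique[OF _ tendsto_const] by fastforce
qed

text \<open>Only the sign of the difference quotients matters, so an inequality between the two
  indicators weighted by \<open>F\<close> suffices. This replaces boundary values at the ends of the
  time interval.\<close>

lemma integral_pd_nonneg:
  fixes F :: "real \<times> (real^'d) \<Rightarrow> real"
  assumes d: "\<And>z. F differentiable (at z)" and c: "continuous_on UNIV (pd F e)" and "a > 0"
    and le: "\<And>s z. 0 < s \<Longrightarrow> s \<le> a \<Longrightarrow> indicator (cell T) z * F z \<le> indicator {z. z - s *\<^sub>R e \<in> cell T}
        z * F z"
  shows "0 \<le> (LINT z|cylm T. pd F e z)"
proof (rule tendsto_lowerbound[OF shift_quotient_tendsto[OF d c, of T]])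
  have cF: "continuous_on UNIV F"
    by (meson continuous_at_imp_continuous_on differentiable_imp_continuous_within d)
  have "\<forall>\<^sub>F n in sequentially. 1 / real (Suc n) < a"
    using order_tendstoD(2)[OF LIMSEQ_inverse_real_of_nat \<open>a > 0\<close>] by (simp add: inverse_eq_divide)
  then show "\<forall>\<^sub>F n in sequentially. 0
      \<le> real (Suc n) * ((LINT z|cylm T. F (z + (1 / real (Suc n)) *\<^sub>R e)) - (LINT z|cylm T. F z))"
  proof eventually_elim
    case (elim n)
    then have "(LINT z|cylm T. F z) \<le> (LINT z|cylm T. F (z + (1 / real (Suc n)) *\<^sub>R e))"
      by (intro integral_shift_mono[OF cF] le) auto
    then show ?case by simp
  qed
qed simp

text \<open>Shifting the domain forward by \<open>s\<close> loses times up to \<open>s\<close>,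
  where \<open>F\<close> vanishes, and gains times beyond \<open>T\<close>, where \<open>F\<close>
  is nonnegative. The integral of the derivative is morally that of \<open>F\<close> at the final
  time.\<close>

lemma integral_pd_time_left:
  fixes F :: "real \<times> (real^'d) \<Rightarrow> real"
  assumes d: "\<And>z. F differentiable (at z)" and c: "continuous_on UNIV (pd F e_t)" and "a > 0"
    and 0: "\<And>z. fst z \<le> a \<Longrightarrow> F z = 0" and nn: "\<And>z. 0 \<le> F z"
  shows "0 \<le> (LINT z|cylm T. pd F e_t z)"
proof (rule integral_pd_nonneg[OF d c \<open>a > 0\<close>])
  fix s z assume s: "0 < s" "s \<le> a"
  show "indicator (cell T) z * F z \<le> indicator {z. z - s *\<^sub>R e_t \<in> cell T} z * F z"
    using s 0[of z] nn[of z] by (auto simp: indicator_def fst_minus_e_t) (auto simp: cell_def)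
qed

lemma pd_uminus: "F differentiable (at z) \<Longrightarrow> pd F (- e) z = - pd F e z"
  using linear_neg[OF linear_frechet_derivative] by (auto simp: pd_def)

lemma integral_pd_time_right:
  fixes F :: "real \<times> (real^'d) \<Rightarrow> real"
  assumes d: "\<And>z. F differentiable (at z)" and c: "continuous_on UNIV (pd F e_t)" and "b < T"
    and 0: "\<And>z. b \<le> fst z \<Longrightarrow> F z = 0" and nn: "\<And>z. 0 \<le> F z"
  shows "(LINT z|cylm T. pd F e_t z) \<le> 0"
proof -
  have e: "pd F (- e_t) = (\<lambda>z. - pd F e_t z)" by (simp add: pd_uminus d fun_eq_iff)
  have "0 \<le> (LINT z|cylm T. pd F (- e_t) z)"
  proof (rule integral_pd_nonneg[OF d, where a="T - b"])
    show "continuous_on UNIV (pd F (- e_t))" unfolding e by (intro continuous_intros c)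
    show "0 < T - b" using \<open>b < T\<close> by simp
    fix s and z :: "real \<times> (real^'d)" assume s: "0 < s" "s \<le> T - b"
    have "z - s *\<^sub>R (- e_t) \<in> cell T \<longleftrightarrow> - s < fst z \<and> fst z < T - s \<and> (\<forall>i. 0 \<le> snd z $ i \<and> snd z $ i
        < 1)"
      using fst_minus_e_t[of z "- s" T] by simp
    then show "indicator (cell T) z * F z \<le> indicator {z. z - s *\<^sub>R (- e_t) \<in> cell T} z * F z"
      using s 0[of z] nn[of z] by (auto simp: indicator_def cell_def)
  qed
  then show ?thesis unfolding e by simp
qed

lemma integral_pd_time_zero:
  fixes F :: "real \<times> (real^'d) \<Rightarrow> real"
  assumes d: "\<And>z. F differentiable (at z)" and c: "continuous_on UNIV (pd F e_t)"
      and "0 < a" "b < T"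
    and 0: "\<And>z. fst z \<le> a \<Longrightarrow> F z = 0" "\<And>z. b < fst z \<Longrightarrow> F z = 0"
  shows "(LINT z|cylm T. pd F e_t z) = 0"
proof -
  have *: "0 \<le> (LINT z|cylm T. pd G e_t z)"
    if d: "\<And>z. G differentiable (at z)" and c: "continuous_on UNIV (pd G e_t)"
      and 0: "\<And>z. fst z \<le> a \<Longrightarrow> G z = 0" "\<And>z. b < fst z \<Longrightarrow> G z = 0" for G :: "real \<times> (real^'d) \<Rightarrow> real"
  proof (rule integral_pd_nonneg[OF d c \<open>a > 0\<close>])
    fix s z assume s: "0 < s" "s \<le> a"
    show "indicator (cell T) z * G z \<le> indicator {z. z - s *\<^sub>R e_t \<in> cell T} z * G z"
    proof (cases "fst z \<le> a \<or> b < fst z")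
      case False
      then have "z \<in> cell T \<longleftrightarrow> z - s *\<^sub>R e_t \<in> cell T"
        using s \<open>0 < a\<close> \<open>b < T\<close> unfolding fst_minus_e_t by (auto simp: cell_def)
      then show ?thesis by (simp add: indicator_def)
    qed (use 0[of z] in auto)
  qed
  have e: "pd (\<lambda>z. - 1 * F z) e_t = (\<lambda>z. - pd F e_t z)" by (intro ext, subst pd_cmult[OF d]) simp
  have "0 \<le> (LINT z|cylm T. pd F e_t z)" by (rule *[OF d c 0])
  moreover have "0 \<le> (LINT z|cylm T. pd (\<lambda>z. - 1 * F z) e_t z)"
  proof (rule *)
    show "continuous_on UNIV (pd (\<lambda>z. - 1 * F z) e_t)" unfolding e by (intro continuous_intros c)
    show "(\<lambda>z. - 1 * F z) differentiable at z" for z by (intro derivative_intros d)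
  qed (use 0 in auto)
  ultimately show ?thesis unfolding e by simp
qed

section \<open>Integration by parts for smooth periodic functions\<close>

definition periodic_smooth :: "(real \<times> (real^'d) \<Rightarrow> real) \<Rightarrow> bool" where
  "periodic_smooth f \<longleftrightarrow> smooth_fun f \<and> (\<forall>t x i. f (t, x + axis i 1) = f (t, x))"

lemma (in profiles) trig_sum_periodic_smooth: "trig_sum P f \<Longrightarrow> periodic_smooth f"
  by (simp add: periodic_smooth_def trig_sum_smooth trig_sum_periodic)

lemma integral_by_parts_space:
  assumes "periodic_smooth f" "periodic_smooth g"
  shows "(LINT z|cylm T. pd f (e_x i) z * g z) = - (LINT z|cylm T. f z * pd g (e_x i) z)"
proof -
  have s: "smooth_fun f" "smooth_fun g" using assms by (auto simp: periodic_smooth_def)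
  note d = s[THEN smooth_fun_differentiable] and c = s[THEN smooth_fun_continuous]
      s[THEN smooth_fun_pd, THEN smooth_fun_continuous]
  have e: "pd (\<lambda>z. f z * g z) (e_x i) = (\<lambda>z. f z * pd g (e_x i) z + pd f (e_x i) z * g z)"
    by (simp add: fun_eq_iff pd_mult d)
  have "(LINT z|cylm T. pd (\<lambda>z. f z * g z) (e_x i) z) = 0"
  proof (rule integral_pd_space)
    show "continuous_on UNIV (pd (\<lambda>z. f z * g z) (e_x i))" unfolding e
      by (intro continuous_intros c)
    show "f (t, x + axis i 1) * g (t, x + axis i 1) = f (t, x) * g (t, x)" for t x
      using assms by (simp add: periodic_smooth_def)
  qed (intro differentiable_mult d)
  also have "(LINT z|cylm T. pd (\<lambda>z. f z * g z) (e_x i) z) =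
     (LINT z|cylm T. f z * pd g (e_x i) z) + (LINT z|cylm T. pd f (e_x i) z * g z)"
    unfolding e by (intro Bochner_Integration.integral_add continuous_integrable_cylm
        continuous_intros c)
  finally show ?thesis by linarith
qed

text \<open>Only the product has to vanish near both ends. A solution flat near the initial time may
  therefore be paired with a test function that vanishes merely near the final time.\<close>

lemma integral_by_parts_time:
  assumes "smooth_fun f" "smooth_fun g" "0 < a" "b < T"
    and "\<And>z. fst z \<le> a \<Longrightarrow> f z * g z = 0" "\<And>z. b < fst z \<Longrightarrow> f z * g z = 0"
  shows "(LINT z|cylm T. pd f e_t z * g z) = - (LINT z|cylm T. f z * pd g e_t z)"
proof -
  note s = assms(1,2)
  note d = s[THEN smooth_fun_differentiable] and c = s[THEN smooth_fun_continuous]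
      s[THEN smooth_fun_pd, THEN smooth_fun_continuous]
  have e: "pd (\<lambda>z. f z * g z) e_t = (\<lambda>z. f z * pd g e_t z + pd f e_t z * g z)"
    by (simp add: fun_eq_iff pd_mult d)
  have "(LINT z|cylm T. pd (\<lambda>z. f z * g z) e_t z) = 0"
  proof (rule integral_pd_time_zero)
    show "continuous_on UNIV (pd (\<lambda>z. f z * g z) e_t)" unfolding e by (intro continuous_intros c)
    show "(\<lambda>z. f z * g z) differentiable at z" for z by (intro differentiable_mult d)
  qed (use assms in auto)
  also have "(LINT z|cylm T. pd (\<lambda>z. f z * g z) e_t z) =
     (LINT z|cylm T. f z * pd g e_t z) + (LINT z|cylm T. pd f e_t z * g z)"
    unfolding e by (intro Bochner_Integration.integral_add continuous_integrable_cylm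
        continuous_intros c)
  finally show ?thesis by linarith
qed

section \<open>Energy and \<open>L\<^sup>1\<close> estimates\<close>

lemma integral_laplacian_mult:
  assumes w: "trig_sum Cinf w" and f: "periodic_smooth f"
  shows "(LINT z|cylm T. laplacian w z * f z)
    = - (\<Sum>i\<in>UNIV. LINT z|cylm T. pd w (e_x i) z * pd f (e_x i) z)"
proof -
  note c = smooth_fun_continuous[OF Cinf.trig_sum_smooth]
  have cf: "continuous_on UNIV f" using f by (simp add: periodic_smooth_def smooth_fun_continuous)
  have "(LINT z|cylm T. laplacian w z * f z) = (\<Sum>i\<in>UNIV. LINT z|cylm T. pd (pd w (e_x i)) (e_x i) z
      * f z)"
    unfolding laplacian_def sum_distrib_right
    by (rule Bochner_Integration.integral_sum)
       (intro continuous_integrable_cylm continuous_intros c cf Cinf.trig_sum_pd w)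
  also have "\<dots> = (\<Sum>i\<in>UNIV. - (LINT z|cylm T. pd w (e_x i) z * pd f (e_x i) z))"
    by (intro sum.cong refl integral_by_parts_space Cinf.trig_sum_periodic_smooth Cinf.trig_sum_pd w
        f)
  finally show ?thesis by (simp add: sum_negf)
qed

lemma trig_sum_laplacian: "trig_sum Cinf w \<Longrightarrow> smooth_fun (laplacian w)"
proof -
  assume w: "trig_sum Cinf w"
  have *: "trig_sum Cinf (\<lambda>z. \<Sum>i\<in>I. pd (pd w (e_x i)) (e_x i) z)" if "finite I" for I
    using that
  proof induction
    case (insert i I)
    then show ?case
      using trig_sum.add[OF Cinf.trig_sum_pd[OF Cinf.trig_sum_pd[OF w]] insert.IH] by simp
  qed (simp add: trig_sum_zero Cinf_const)
  have "trig_sum Cinf (laplacian w)"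
    using *[of UNIV] by (simp add: laplacian_def[abs_def])
  then show ?thesis by (rule Cinf.trig_sum_smooth)
qed

text \<open>Two integrations by parts and symmetry of the second derivatives turn the product of the
  \<open>ii\<close> and \<open>jj\<close> derivatives into the square of the \<open>ij\<close>
  derivative. The torus has no boundary terms, so the Laplacian controls the full Hessian with
  constant 1.\<close>

lemma nsq_laplacian:
  assumes w: "trig_sum Cinf w"
  shows "nsq (cylm T) (laplacian w) = (\<Sum>i\<in>UNIV. \<Sum>j\<in>UNIV. nsq (cylm T) (pd (pd w (e_x i)) (e_x j)))"
proof -
  note c = smooth_fun_continuous[OF Cinf.trig_sum_smooth] and p = Cinf.trig_sum_pd[OF w]
  have ps: "periodic_smooth (pd (pd w u) v)" "periodic_smooth (pd w v)" for u v
    by (intro Cinf.trig_sum_periodic_smooth Cinf.trig_sum_pd p)+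
  have *: "(LINT z|cylm T. pd (pd w (e_x i)) (e_x i) z * pd (pd w (e_x j)) (e_x j) z)
     = nsq (cylm T) (pd (pd w (e_x i)) (e_x j))" for i j
  proof -
    have "(LINT z|cylm T. pd (pd w (e_x i)) (e_x i) z * pd (pd w (e_x j)) (e_x j) z)
       = - (LINT z|cylm T. pd w (e_x i) z * pd (pd (pd w (e_x j)) (e_x j)) (e_x i) z)"
      by (rule integral_by_parts_space[OF ps(2) ps(1)])
    also have "pd (pd (pd w (e_x j)) (e_x j)) (e_x i) = pd (pd (pd w (e_x j)) (e_x i)) (e_x j)"
      by (rule Cinf.pd_trig_sum_commute[OF p])
    also have "- (LINT z|cylm T. pd w (e_x i) z * pd (pd (pd w (e_x j)) (e_x i)) (e_x j) z)
       = (LINT z|cylm T. pd (pd w (e_x i)) (e_x j) z * pd (pd w (e_x j)) (e_x i) z)"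
      by (rule integral_by_parts_space[OF ps(2) ps(1), symmetric])
    also have "pd (pd w (e_x j)) (e_x i) = pd (pd w (e_x i)) (e_x j)"
      by (rule Cinf.pd_trig_sum_commute[OF w])
    finally show ?thesis by (simp add: nsq_def power2_eq_square)
  qed
  have "nsq (cylm T) (laplacian w)
      = (LINT z|cylm T. (\<Sum>i\<in>UNIV. \<Sum>j\<in>UNIV. pd (pd w (e_x i)) (e_x i) z * pd (pd w (e_x j)) (e_x j)
      z))"
    by (simp add: nsq_def power2_eq_square laplacian_def sum_product)
  also have "\<dots> = (\<Sum>i\<in>UNIV. \<Sum>j\<in>UNIV. LINT z|cylm T. pd (pd w (e_x i)) (e_x i) z * pd (pd w (e_x j))
      (e_x j) z)"
    by (subst Bochner_Integration.integral_sum Bochner_Integration.integral_sum,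
        intro continuous_integrable_cylm continuous_intros c Cinf.trig_sum_pd p,
        intro sum.cong refl Bochner_Integration.integral_sum continuous_integrable_cylm
            continuous_intros c Cinf.trig_sum_pd p)
  finally show ?thesis by (simp add: *)
qed

text \<open>The integrand is half the time derivative of the nonnegative function
  \<open>w^2\<close>, which vanishes near the initial time.\<close>

lemma integral_time_square_nonneg:
  assumes "trig_sum left_prof w"
  shows "0 \<le> (LINT z|cylm T. w z * pd w e_t z)"
proof -
  obtain a where a: "a > 0" "\<And>z. fst z \<le> a \<Longrightarrow> w z = 0" using trig_sum_left_vanish[OF assms] by blast
  note d = left_prof.trig_sum_differentiable[OF assms]
  have e: "pd (\<lambda>z. w z * w z) e_t = (\<lambda>z. 2 * (w z * pd w e_t z))"
    by (simp add: fun_eq_iff pd_mult d)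
  have "0 \<le> (LINT z|cylm T. pd (\<lambda>z. w z * w z) e_t z)"
  proof (rule integral_pd_time_left)
    show "continuous_on UNIV (pd (\<lambda>z. w z * w z) e_t)" unfolding e
      by (intro continuous_intros smooth_fun_continuous left_prof.trig_sum_smooth
          left_prof.trig_sum_pd assms)
  qed (use a d in auto)
  then show ?thesis unfolding e by simp
qed

text \<open>Expanding the square of \<open>g\<close>, every mixed term has the good sign:
  \<open>w * w_t\<close> and the products of each \<open>pd w (e_x i)\<close> with its time
  derivative integrate to nonnegative numbers, and the product of \<open>w\<close> with its
  Laplacian gives minus the squared gradient. The term \<open>\<mu> * w\<close> is what an
  exponential weight in time produces.\<close>

lemma heat_energy:
  fixes w :: "real \<times> (real^'d) \<Rightarrow> real"
  assumes w: "trig_sum left_prof w" and \<mu>: "\<mu> \<ge> 0"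
  defines "g \<equiv> \<lambda>z. pd w e_t z - laplacian w z + \<mu> * w z"
  shows "nsq (cylm T) (pd w e_t) + nsq (cylm T) (laplacian w) + \<mu>^2 * nsq (cylm T) w
    + 2 * \<mu> * (\<Sum>i\<in>UNIV. nsq (cylm T) (pd w (e_x i))) \<le> nsq (cylm T) g"
proof -
  note wC = left_prof.trig_sum_Cinf[OF w]
  note c = smooth_fun_continuous[OF left_prof.trig_sum_smooth[OF w]]
     smooth_fun_continuous[OF left_prof.trig_sum_smooth[OF left_prof.trig_sum_pd[OF w]]]
     smooth_fun_continuous[OF trig_sum_laplacian[OF wC]]
  let ?I = "integral\<^sup>L (cylm T)"
  have 1: "?I (\<lambda>z. laplacian w z * w z) = - (\<Sum>i\<in>UNIV. nsq (cylm T) (pd w (e_x i)))"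
    using integral_laplacian_mult[OF wC left_prof.trig_sum_periodic_smooth[OF w], of T]
    by (simp add: nsq_def power2_eq_square)
  have 2: "?I (\<lambda>z. laplacian w z * pd w e_t z) \<le> 0"
  proof -
    have "?I (\<lambda>z. laplacian w z * pd w e_t z)
        = - (\<Sum>i\<in>UNIV. ?I (\<lambda>z. pd w (e_x i) z * pd (pd w e_t) (e_x i) z))"
      by
          (rule integral_laplacian_mult[OF wC
          left_prof.trig_sum_periodic_smooth[OF left_prof.trig_sum_pd[OF w]]])
    moreover have "0 \<le> ?I (\<lambda>z. pd w (e_x i) z * pd (pd w e_t) (e_x i) z)" for i
      using integral_time_square_nonneg[OF left_prof.trig_sum_pd[OF w], of T "e_x i"]
      by (simp add: left_prof.pd_trig_sum_commute[OF w, of "e_x i" e_t])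
    ultimately show ?thesis by (simp add: sum_nonneg)
  qed
  have 3: "0 \<le> ?I (\<lambda>z. w z * pd w e_t z)" by (rule integral_time_square_nonneg[OF w])
  have "nsq (cylm T) g = ?I (\<lambda>z. ((pd w e_t z)^2 + (laplacian w z)^2 + \<mu>^2 * (w z)^2)
      + (2 * \<mu> * (w z * pd w e_t z) - 2 * (laplacian w z * pd w e_t z) - 2 * \<mu>
          * (laplacian w z * w z)))"
    unfolding nsq_def g_def by (intro Bochner_Integration.integral_cong refl)
        (simp add: power2_eq_square algebra_simps)
  also have "\<dots> = (?I (\<lambda>z. (pd w e_t z)^2) + ?I (\<lambda>z. (laplacian w z)^2) + ?I (\<lambda>z. \<mu>^2 * (w z)^2))
      + (?I (\<lambda>z. 2 * \<mu> * (w z * pd w e_t z)) - ?I (\<lambda>z. 2 * (laplacian w z * pd w e_t z)) - ?I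
          (\<lambda>z. 2 * \<mu> * (laplacian w z * w z)))"
  proof -
    have I: "integrable (cylm T) (\<lambda>z. (pd w e_t z)^2)" "integrable (cylm T) (\<lambda>z. (laplacian w z)^2)"
      "integrable (cylm T) (\<lambda>z. \<mu>^2 * (w z)^2)"
          "integrable (cylm T) (\<lambda>z. 2 * \<mu> * (w z * pd w e_t z))"
      "integrable (cylm T) (\<lambda>z. 2 * (laplacian w z * pd w e_t z))"
          "integrable (cylm T) (\<lambda>z. 2 * \<mu> * (laplacian w z * w z))"
      by (intro continuous_integrable_cylm continuous_intros c)+
    show ?thesis using I by simp
  qed
  also have "\<dots> = nsq (cylm T) (pd w e_t) + nsq (cylm T) (laplacian w) + \<mu>^2 * nsq (cylm T) w
     + (2 * \<mu> * ?I (\<lambda>z. w z * pd w e_t z) - 2 * ?I (\<lambda>z. laplacian w z * pd w e_t z)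
     + 2 * \<mu> * (\<Sum>i\<in>UNIV. nsq (cylm T) (pd w (e_x i))))"
    using 1 by (simp add: nsq_def)
  finally show ?thesis using 2 mult_nonneg_nonneg[OF \<mu> 3] by linarith
qed

text \<open>Here \<open>J\<close> is a smooth substitute for the absolute value, with first and second derivatives
  \<open>p\<close> and \<open>q\<close>; the equation is tested with \<open>p w\<close>.\<close>
lemma heat_L1_smooth:
  fixes w :: "real \<times> (real^'d) \<Rightarrow> real" and p q J :: "real \<Rightarrow> real"
  assumes w: "trig_sum (right_prof T) w"
    and J: "\<And>s. (J has_real_derivative p s) (at s)" "\<And>s. 0 \<le> J s" "J 0 = 0"
    and p: "\<And>s. (p has_real_derivative q s) (at s)" "\<And>s. \<bar>p s\<bar> \<le> 1"
    and q: "\<And>s. 0 \<le> q s" "continuous_on UNIV q"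
  shows "\<mu> * (LINT z|cylm T. w z * p (w z)) \<le> (LINT z|cylm T. \<bar>- pd w e_t z - laplacian w z
      + \<mu> * w z\<bar>)"
proof -
  note wC = right_prof.trig_sum_Cinf[OF w]
  note c = smooth_fun_continuous[OF right_prof.trig_sum_smooth[OF w]]
     smooth_fun_continuous[OF right_prof.trig_sum_smooth[OF right_prof.trig_sum_pd[OF w]]]
     smooth_fun_continuous[OF right_prof.trig_sum_smooth[OF
         right_prof.trig_sum_pd[OF right_prof.trig_sum_pd[OF w]]]]
     smooth_fun_continuous[OF trig_sum_laplacian[OF wC]]
  note d = right_prof.trig_sum_differentiable[OF w]
  let ?I = "integral\<^sup>L (cylm T)"
  have cp: "continuous_on UNIV (\<lambda>z. p (w z))" "continuous_on UNIV (\<lambda>z. q (w z))"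
  proof -
    have "continuous_on UNIV p" by (meson DERIV_isCont continuous_at_imp_continuous_on p(1))
    then show "continuous_on UNIV (\<lambda>z. p (w z))" by (rule continuous_on_compose2) (auto intro: c)
    show "continuous_on UNIV (\<lambda>z. q (w z))" by (rule continuous_on_compose2[OF q(2)])
        (auto intro: c)
  qed
  have chain: "((\<lambda>z. f (w z)) has_derivative (\<lambda>v. f' * pd w v z)) (at z)"
    if "(f has_real_derivative f') (at (w z))" for f f' z
    using has_derivative_compose[OF has_derivative_pd[OF d], of f "(*) f'"] that
    by (simp add: has_field_derivative_def)
  obtain b where b: "b < T" "\<And>z. fst z \<ge> b \<Longrightarrow> w z = 0" using trig_sum_right_vanish[OF w] by blast
  have 1: "?I (\<lambda>z. p (w z) * pd w e_t z) \<le> 0"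
  proof -
    have e: "pd (\<lambda>z. J (w z)) e_t = (\<lambda>z. p (w z) * pd w e_t z)"
      by (intro ext pd_eqI chain J)
    have "?I (pd (\<lambda>z. J (w z)) e_t) \<le> 0"
    proof (rule integral_pd_time_right)
      show "(\<lambda>z. J (w z)) differentiable (at z)" for z
        by (rule differentiableI[OF chain[OF J(1)]])
      show "continuous_on UNIV (pd (\<lambda>z. J (w z)) e_t)"
        unfolding e by (intro continuous_intros c cp)
    qed (use b J in auto)
    then show ?thesis unfolding e .
  qed
  \<comment> \<open>The divergence of \<open>pd w (e_x i) z * p (w z)\<close> integrates to zero and
    splits into this integrand and a square times \<open>q (w z)\<close>, so convexity of the
    primitive, \<open>q \<ge> 0\<close>, fixes the sign.\<close>
  have 2: "?I (\<lambda>z. pd (pd w (e_x i)) (e_x i) z * p (w z)) \<le> 0" for i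
  proof -
    let ?F = "\<lambda>z. pd w (e_x i) z * p (w z)"
    have dp: "(\<lambda>z. p (w z)) differentiable (at z)" for z
      by (rule differentiableI[OF chain[OF p(1)]])
    have dw: "pd w (e_x i) differentiable (at z)" for z
      by (rule right_prof.trig_sum_differentiable[OF right_prof.trig_sum_pd[OF w]])
    have e: "pd ?F (e_x i) = (\<lambda>z. q (w z) * (pd w (e_x i) z)^2 + pd (pd w (e_x i)) (e_x i) z
        * p (w z))"
      by (intro ext) (simp add: pd_mult[OF dw dp] pd_eqI[OF chain[OF p(1)]] power2_eq_square)
    have "?I (pd ?F (e_x i)) = 0"
    proof (rule integral_pd_space)
      show "?F differentiable (at z)" for z by (intro differentiable_mult dp dw)
      show "continuous_on UNIV (pd ?F (e_x i))" unfolding e by (intro continuous_intros c cp)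
    qed (simp add: trig_sum_periodic[OF w] trig_sum_periodic[OF right_prof.trig_sum_pd[OF w]])
    also have "?I (pd ?F (e_x i)) = ?I (\<lambda>z. q (w z) * (pd w (e_x i) z)^2)
        + ?I (\<lambda>z. pd (pd w (e_x i)) (e_x i) z * p (w z))"
      unfolding e by (intro Bochner_Integration.integral_add continuous_integrable_cylm
          continuous_intros c cp)
    moreover have "0 \<le> ?I (\<lambda>z. q (w z) * (pd w (e_x i) z)^2)" using q(1) by simp
    ultimately show ?thesis by linarith
  qed
  let ?G = "\<lambda>z. - pd w e_t z - laplacian w z + \<mu> * w z"
  have "?I (\<lambda>z. ?G z * p (w z))
      = ?I (\<lambda>z. - (p (w z) * pd w e_t z) - (\<Sum>i\<in>UNIV. pd (pd w (e_x i)) (e_x i) z * p (w z)) + \<mu>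
      * (w z * p (w z)))"
    unfolding laplacian_def by (simp add: algebra_simps sum_distrib_left)
  also have "\<dots> = - ?I (\<lambda>z. p (w z) * pd w e_t z)
      - (\<Sum>i\<in>UNIV. ?I (\<lambda>z. pd (pd w (e_x i)) (e_x i) z * p (w z))) + \<mu> * ?I (\<lambda>z. w z * p (w z))"
  proof -
    have I: "integrable (cylm T) (\<lambda>z. p (w z) * pd w e_t z)"
        "integrable (cylm T) (\<lambda>z. pd (pd w (e_x i)) (e_x i) z * p (w z))"
      "integrable (cylm T) (\<lambda>z. w z * p (w z))" for i
      by (intro continuous_integrable_cylm continuous_intros c cp)+
    show ?thesis using I by simp
  qed
  finally have "\<mu> * ?I (\<lambda>z. w z * p (w z)) \<le> ?I (\<lambda>z. ?G z * p (w z))"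
    using 1 sum_nonpos[of UNIV "\<lambda>i. ?I (\<lambda>z. pd (pd w (e_x i)) (e_x i) z * p (w z))"] 2 by auto
  also have "\<dots> \<le> ?I (\<lambda>z. \<bar>?G z\<bar>)"
  proof (rule integral_mono)
    show "integrable (cylm T) (\<lambda>z. ?G z * p (w z))" "integrable (cylm T) (\<lambda>z. \<bar>?G z\<bar>)"
      by (intro continuous_integrable_cylm continuous_intros c cp)+
    show "?G z * p (w z) \<le> \<bar>?G z\<bar>" for z
    proof -
      have "?G z * p (w z) \<le> \<bar>?G z\<bar> * \<bar>p (w z)\<bar>"
        by (rule order_trans[OF abs_ge_self]) (simp only: abs_mult order_refl)
      also have "\<dots> \<le> \<bar>?G z\<bar> * 1" by (intro mult_left_mono p abs_ge_zero)
      finally show ?thesis by (simp only: mult_1_right)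
    qed
  qed
  finally show ?thesis .
qed

text \<open>The absolute value is smoothed to \<open>sqrt (s^2 + \<delta>^2)\<close>. Since
  \<open>|s|\<close> exceeds \<open>s * p s\<close> by at most \<delta>, the error in the conclusion
  is \<mu> \<delta> times the volume \<open>K\<close> of the cylinder, and \<delta> is
  arbitrary.\<close>

lemma heat_L1:
  fixes w :: "real \<times> (real^'d) \<Rightarrow> real"
  assumes w: "trig_sum (right_prof T) w" and \<mu>: "\<mu> \<ge> 0"
  shows "\<mu> * (LINT z|cylm T. \<bar>w z\<bar>) \<le> (LINT z|cylm T. \<bar>- pd w e_t z - laplacian w z + \<mu> * w z\<bar>)"
proof -
  note cw = smooth_fun_continuous[OF right_prof.trig_sum_smooth[OF w]]
  define K where "K = (LINT z|(cylm T :: (real \<times> (real^'d)) measure). (1::real))"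
  have K: "0 \<le> K" unfolding K_def by simp
  let ?R = "LINT z|cylm T. \<bar>- pd w e_t z - laplacian w z + \<mu> * w z\<bar>"
  have *: "\<mu> * (LINT z|cylm T. \<bar>w z\<bar>) \<le> ?R + \<mu> * \<delta> * K" if \<delta>: "\<delta> > 0" for \<delta> :: real
  proof -
    define j p q where "j s = sqrt (s^2 + \<delta>^2)" and "p s = s / sqrt (s^2 + \<delta>^2)"
      and "q s = \<delta>^2 / (sqrt (s^2 + \<delta>^2))^3" for s :: real
    have pos: "0 < s^2 + \<delta>^2" for s using \<delta> by (simp add: add_nonneg_pos)
    have j0: "0 < sqrt (s^2 + \<delta>^2)" for s using pos by simp
    have j2: "(sqrt (s^2 + \<delta>^2))^2 = s^2 + \<delta>^2" for s using pos[of s] by simp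
    have dj: "(j has_real_derivative p s) (at s)" for s
      unfolding j_def p_def using pos[of s]
      by (auto intro!: derivative_eq_intros simp: field_simps)
    have dp: "(p has_real_derivative q s) (at s)" for s
    proof -
      have "(p has_real_derivative (1 * sqrt (s^2 + \<delta>^2) - s * (s / sqrt (s^2 + \<delta>^2)))
          / (sqrt (s^2 + \<delta>^2) * sqrt (s^2 + \<delta>^2))) (at s)"
        unfolding p_def by (rule DERIV_divide[OF DERIV_ident dj[unfolded j_def p_def]])
            (use j0[of s] in auto)
      also have "(1 * sqrt (s^2 + \<delta>^2) - s * (s / sqrt (s^2 + \<delta>^2)))
          / (sqrt (s^2 + \<delta>^2) * sqrt (s^2 + \<delta>^2)) = q s"
      proof -
        have "(r - s * (s / r)) / (r * r) = (r^2 - s^2) / r^3" if "r > 0" for r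
          using that by (simp add: field_simps power2_eq_square power3_eq_cube)
        from this[OF j0[of s]] show ?thesis unfolding q_def j2 by simp
      qed
      finally show ?thesis .
    qed
    have le: "\<bar>s\<bar> \<le> sqrt (s^2 + \<delta>^2)" for s using real_sqrt_le_mono[of "s^2" "s^2 + \<delta>^2"] by simp
    have "\<mu> * (LINT z|cylm T. w z * p (w z)) \<le> ?R"
    proof (rule heat_L1_smooth[OF w, where J="\<lambda>s. j s - \<delta>" and q=q])
      show "((\<lambda>s. j s - \<delta>) has_real_derivative p s) (at s)" for s
        using DERIV_diff[OF dj DERIV_const] by simp
      show "0 \<le> j s - \<delta>" for s
        using real_sqrt_le_mono[of "\<delta>^2" "s^2 + \<delta>^2"] \<delta> by (simp add: j_def)
      show "j 0 - \<delta> = 0" using \<delta> by (simp add: j_def)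
      show "\<bar>p s\<bar> \<le> 1" for s using le[of s] j0[of s] by (simp add: p_def abs_divide)
      show "0 \<le> q s" for s using j0[of s] by (simp add: q_def)
      show "continuous_on UNIV q" unfolding q_def
        by (intro continuous_intros) (use j0 in \<open>auto simp: less_imp_neq[symmetric]\<close>)
    qed (rule dp)
    have cp: "continuous_on UNIV (\<lambda>z. p (w z))"
      unfolding p_def by (intro continuous_intros cw)
          (use j0 in \<open>auto simp: less_imp_neq[symmetric]\<close>)
    have "(LINT z|cylm T. \<bar>w z\<bar>) \<le> (LINT z|cylm T. w z * p (w z) + \<delta>)"
    proof (rule integral_mono)
      show "integrable (cylm T) (\<lambda>z. \<bar>w z\<bar>)" "integrable (cylm T) (\<lambda>z. w z * p (w z) + \<delta>)"
        by (intro continuous_integrable_cylm continuous_intros cw cp)+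
      have "\<bar>s\<bar> \<le> s * p s + \<delta>" for s
      proof -
        let ?r = "sqrt (s^2 + \<delta>^2)"
        have "?r \<le> \<bar>s\<bar> + \<delta>"
          using sqrt_add_le_add_sqrt[of "s^2" "\<delta>^2"] \<delta> by simp
        then have "\<bar>s\<bar> * ?r \<le> \<bar>s\<bar> * (\<bar>s\<bar> + \<delta>)" by (intro mult_left_mono) auto
        also have "\<dots> = s^2 + \<bar>s\<bar> * \<delta>" by (simp add: power2_eq_square algebra_simps)
        also have "\<dots> \<le> s^2 + ?r * \<delta>" using le[of s] \<delta> by (intro add_left_mono mult_right_mono) auto
        finally have "\<bar>s\<bar> \<le> (s^2 + ?r * \<delta>) / ?r" using j0[of s] by (simp only: pos_le_divide_eq)
        also have "\<dots> = s * p s + \<delta>" using j0[of s]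
          by (simp add: p_def add_divide_distrib power2_eq_square)
        finally show ?thesis .
      qed
      then show "\<bar>w z\<bar> \<le> w z * p (w z) + \<delta>" for z .
    qed
    also have "\<dots> = (LINT z|cylm T. w z * p (w z)) + \<delta> * K"
    proof -
      have "integrable (cylm T) (\<lambda>z. w z * p (w z))"
          "integrable (cylm T) (\<lambda>z :: real \<times> (real^'d). \<delta> * 1)"
        by (intro continuous_integrable_cylm continuous_intros cw cp)+
      then have "(LINT z|cylm T. w z * p (w z) + \<delta> * 1) = (LINT z|cylm T. w z * p (w z))
          + (LINT z|(cylm T :: (real \<times> (real^'d)) measure). \<delta> * 1)"
        by (rule Bochner_Integration.integral_add)
      then show ?thesis unfolding K_def integral_mult_right_zero[symmetric] by simp
    qed
    finally have "\<mu> * (LINT z|cylm T. \<bar>w z\<bar>) \<le> \<mu> * ((LINT z|cylm T. w z * p (w z)) + \<delta> * K)"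
      by (rule mult_left_mono[OF _ \<mu>])
    also have "\<dots> \<le> ?R + \<mu> * \<delta> * K"
      using \<open>\<mu> * (LINT z|cylm T. w z * p (w z)) \<le> ?R\<close> by (simp add: algebra_simps)
    finally show ?thesis .
  qed
  show ?thesis
  proof (rule field_le_epsilon)
    fix e :: real assume "e > 0"
    \<comment> \<open>Makes the smoothing error at most \<open>e\<close>; the summand 1 covers the
      case \<open>\<mu> * K = 0\<close>.\<close>
    define \<delta> where "\<delta> = e / (\<mu> * K + 1)"
    have 0: "0 < \<mu> * K + 1" using \<mu> K by (simp add: add_nonneg_pos)
    then have \<delta>: "\<delta> > 0" using \<open>e > 0\<close> by (simp add: \<delta>_def)
    have "\<mu> * \<delta> * K \<le> \<delta> * (\<mu> * K + 1)" using \<delta> by (simp add: algebra_simps)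
    also have "\<dots> = e" using 0 by (simp add: \<delta>_def)
    finally show "\<mu> * (LINT z|cylm T. \<bar>w z\<bar>) \<le> ?R + e" using *[OF \<delta>] by linarith
  qed
qed

section \<open>Density of trigonometric sums\<close>

lemma nsq_tendsto_dominated:
  assumes f: "f \<in> borel_measurable M" and g: "\<And>n. g n \<in> borel_measurable M" and h: "in_L2 M h"
    and b: "\<And>n. AE z in M. \<bar>f z - g n z\<bar> \<le> \<bar>h z\<bar>" and l: "AE z in M. (\<lambda>n. g n z) \<longlonglongrightarrow> f z"
  shows "(\<lambda>n. nsq M (\<lambda>z. f z - g n z)) \<longlonglongrightarrow> 0"
proof -
  have "(\<lambda>n. LINT z|M. (f z - g n z)^2) \<longlonglongrightarrow> (LINT z|M. 0)"
  proof (rule integral_dominated_convergence)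
    show "integrable M (\<lambda>z. (h z)^2)" using h by auto
    show "AE z in M. (\<lambda>n. (f z - g n z)^2) \<longlonglongrightarrow> 0"
      using l
    proof eventually_elim
      case (elim z)
      have "(\<lambda>n. (f z - g n z)^2) \<longlonglongrightarrow> (f z - f z)^2" by (intro tendsto_intros elim)
      then show ?case by simp
    qed
    show "AE z in M. norm ((f z - g n z)^2) \<le> (h z)^2" for n
      using b[of n] by eventually_elim (simp add: abs_le_square_iff)
    show "(\<lambda>z. (f z - g n z)^2) \<in> borel_measurable M" for n using f g by measurable
  qed simp
  then show ?thesis by (simp add: nsq_def)
qed

text \<open>The approximants are flat near both ends of the time interval, so that they can serve as
  sources for the forward equation, as sources for the backward equation and as test functions of
  weak derivatives.\<close>

definition approximable :: "real \<Rightarrow> (real \<times> (real^'d) \<Rightarrow> real) \<Rightarrow> bool" where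
  "approximable T f \<longleftrightarrow> in_L2 (cylm T) f \<and>
     (\<forall>\<epsilon>>0. \<exists>g. trig_sum (cpt_prof T) g \<and> nsq (cylm T) (\<lambda>z. f z - g z) < \<epsilon>)"

lemma trig_sum_in_L2: "trig_sum Cinf g \<Longrightarrow> in_L2 (cylm T) g"
  by (intro continuous_in_L2_cylm smooth_fun_continuous Cinf.trig_sum_smooth)

lemma approximable_in_L2: "approximable T f \<Longrightarrow> in_L2 (cylm T) f"
  by (simp add: approximable_def)

lemma approximable_trig_sum: "trig_sum (cpt_prof T) g \<Longrightarrow> approximable T g"
  unfolding approximable_def
  by (auto intro!: trig_sum_in_L2 cpt_prof.trig_sum_Cinf exI[of _ g] simp: nsq_def)

lemma approximable_limit:
  assumes f: "in_L2 (cylm T) f"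
    and l: "\<And>\<epsilon>. \<epsilon> > 0 \<Longrightarrow> \<exists>h. approximable T h \<and> nsq (cylm T) (\<lambda>z. f z - h z) < \<epsilon>"
  shows "approximable T f"
  unfolding approximable_def
proof (intro conjI f allI impI)
  fix \<epsilon> :: real assume "\<epsilon> > 0"
  then obtain h where h: "approximable T h" "nsq (cylm T) (\<lambda>z. f z - h z) < \<epsilon>/4" using l[of "\<epsilon>/4"]
    by auto
  then obtain g where g: "trig_sum (cpt_prof T) g" "nsq (cylm T) (\<lambda>z. h z - g z) < \<epsilon>/4"
    using \<open>\<epsilon> > 0\<close> unfolding approximable_def by (meson zero_less_divide_iff zero_less_numeral)
  have "nsq (cylm T) (\<lambda>z. (f z - h z) + (h z - g z)) \<le> 2 * nsq (cylm T) (\<lambda>z. f z - h z)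
      + 2 * nsq (cylm T) (\<lambda>z. h z - g z)"
    by (intro nsq_add_le in_L2_diff f approximable_in_L2[OF h(1)]
        trig_sum_in_L2[OF cpt_prof.trig_sum_Cinf[OF g(1)]])
  then show "\<exists>g. trig_sum (cpt_prof T) g \<and> nsq (cylm T) (\<lambda>z. f z - g z) < \<epsilon>"
    using g h(2) by (intro exI[of _ g] conjI) simp_all
qed

lemma approximable_tendsto:
  assumes f: "in_L2 (cylm T) f" and "\<And>n::nat. approximable T (h n)"
    and l: "(\<lambda>n. nsq (cylm T) (\<lambda>z. f z - h n z)) \<longlonglongrightarrow> 0"
  shows "approximable T f"
proof (rule approximable_limit[OF f])
  fix \<epsilon> :: real assume "\<epsilon> > 0"
  from order_tendstoD(2)[OF l this] obtain n where "nsq (cylm T) (\<lambda>z. f z - h n z) < \<epsilon>"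
    by (auto simp: eventually_sequentially)
  then show "\<exists>h. approximable T h \<and> nsq (cylm T) (\<lambda>z. f z - h z) < \<epsilon>" using assms(2) by blast
qed

lemma approximable_bounded_tendsto:
  assumes f: "f \<in> borel_measurable (cylm T)" and h: "\<And>n::nat. approximable T (h n)"
    and b: "\<And>n. AE z in cylm T. \<bar>h n z\<bar> \<le> B" and l: "AE z in cylm T. (\<lambda>n. h n z) \<longlonglongrightarrow> f z"
  shows "approximable T f"
proof -
  have "AE z in cylm T. \<forall>n. \<bar>h n z\<bar> \<le> B" using b by (simp add: AE_all_countable)
  with l have bf: "AE z in cylm T. \<bar>f z\<bar> \<le> B"
  proof eventually_elim
    case (elim z)
    show ?case by (rule LIMSEQ_le_const2[OF tendsto_rabs[OF elim(1)]]) (use elim in auto)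
  qed
  have "B \<le> \<bar>B\<bar>" by simp
  show ?thesis
  proof (rule approximable_tendsto[OF _ h])
    show "in_L2 (cylm T) f" by (rule bounded_in_L2_cylm[OF f bf])
    show "(\<lambda>n. nsq (cylm T) (\<lambda>z. f z - h n z)) \<longlonglongrightarrow> 0"
    proof (rule nsq_tendsto_dominated[OF f _ in_L2_one_cylm[of T "2 * B"] _ l])
      show "h n \<in> borel_measurable (cylm T)" for n
        using h approximable_in_L2 in_L2_measurable by blast
      show "AE z in cylm T. \<bar>f z - h n z\<bar> \<le> \<bar>2 * B\<bar>" for n
        using bf b[of n] by eventually_elim (use \<open>B \<le> \<bar>B\<bar>\<close> in linarith)
    qed
  qed
qed

lemma approximable_cong_AE:
  fixes f g :: "real \<times> (real^'d) \<Rightarrow> real"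
  assumes f: "approximable T f" and g: "g \<in> borel_measurable (cylm T)" "AE z in cylm T. f z = g z"
  shows "approximable T g"
proof (rule approximable_tendsto[where h="\<lambda>_. f"])
  note sf = approximable_in_L2[OF f]
  show sg: "in_L2 (cylm T) g" by (rule in_L2_cong_AE[OF sf g])
  have "nsq (cylm T) (\<lambda>z. g z - f z) = nsq (cylm T) (\<lambda>z :: real \<times> (real^'d). 0)"
    using g(2) by (intro nsq_cong_AE in_L2_measurable[OF in_L2_diff[OF sg sf]])
      (auto elim!: eventually_mono)
  then show "(\<lambda>n. nsq (cylm T) (\<lambda>z. g z - f z)) \<longlonglongrightarrow> 0" by (simp add: nsq_def)
qed (rule f)

lemma approximable_add:
  assumes f: "approximable T f" and g: "approximable T g"
  shows "approximable T (\<lambda>z. f z + g z)"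
  unfolding approximable_def
proof (intro conjI allI impI)
  note s = approximable_in_L2[OF f] approximable_in_L2[OF g]
  show "in_L2 (cylm T) (\<lambda>z. f z + g z)" by (intro in_L2_add s)
  fix \<epsilon> :: real assume "\<epsilon> > 0"
  then have "\<epsilon>/4 > 0" by simp
  then obtain f' g' where fg: "trig_sum (cpt_prof T) f'" "nsq (cylm T) (\<lambda>z. f z - f' z) < \<epsilon>/4"
     "trig_sum (cpt_prof T) g'" "nsq (cylm T) (\<lambda>z. g z - g' z) < \<epsilon>/4"
    using f g unfolding approximable_def by meson
  have "nsq (cylm T) (\<lambda>z. (f z - f' z) + (g z - g' z)) \<le> 2 * nsq (cylm T) (\<lambda>z. f z - f' z)
      + 2 * nsq (cylm T) (\<lambda>z. g z - g' z)"
    by (intro nsq_add_le in_L2_diff s fg(1,3)[THEN cpt_prof.trig_sum_Cinf, THEN trig_sum_in_L2])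
  then have "nsq (cylm T) (\<lambda>z. f z + g z - (f' z + g' z)) < \<epsilon>"
    using fg(2,4) by (simp add: algebra_simps)
  with trig_sum.add[OF fg(1,3)] show "\<exists>h. trig_sum (cpt_prof T) h
      \<and> nsq (cylm T) (\<lambda>z. f z + g z - h z) < \<epsilon>"
    by blast
qed

lemma approximable_cmult:
  assumes f: "approximable T f"
  shows "approximable T (\<lambda>z. c * f z)"
  unfolding approximable_def
proof (intro conjI allI impI)
  note s = approximable_in_L2[OF f]
  show "in_L2 (cylm T) (\<lambda>z. c * f z)" by (intro in_L2_cmult s)
  fix \<epsilon> :: real assume "\<epsilon> > 0"
  have pos: "0 < c^2 + 1" by (simp add: add_nonneg_pos)
  with \<open>\<epsilon> > 0\<close> have "\<epsilon> / (c^2 + 1) > 0" by simp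
  then obtain g where g: "trig_sum (cpt_prof T) g" "nsq (cylm T) (\<lambda>z. f z - g z) < \<epsilon> / (c^2 + 1)"
    using f unfolding approximable_def by meson
  have "nsq (cylm T) (\<lambda>z. c * f z - c * g z) = c^2 * nsq (cylm T) (\<lambda>z. f z - g z)"
    unfolding right_diff_distrib[symmetric] by (rule nsq_cmult)
  also have "\<dots> \<le> (c^2 + 1) * nsq (cylm T) (\<lambda>z. f z - g z)"
    by (intro mult_right_mono) auto
  also have "\<dots> < \<epsilon>" using g(2) pos by (simp add: field_simps)
  finally show "\<exists>h. trig_sum (cpt_prof T) h \<and> nsq (cylm T) (\<lambda>z. c * f z - h z) < \<epsilon>"
    using cpt_prof.trig_sum_cmult[OF g(1), of c] by blast
qed

lemma approximable_zero: "T > 0 \<Longrightarrow> approximable T (\<lambda>z. 0)"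
  by (intro approximable_trig_sum trig_sum_zero)
     (auto simp: cpt_prof_def left_prof_def right_prof_def Cinf_const intro: exI[of _ 1]
         exI[of _ "T - 1"])

section \<open>Trigonometric polynomials in space and indicators of intervals\<close>

inductive trig_poly :: "(real^'d \<Rightarrow> real) \<Rightarrow> bool" where
  wave: "(\<forall>i. \<kappa> $ i \<in> \<int>) \<Longrightarrow> trig_poly (\<lambda>x. c * cos (2 * pi * (\<kappa> \<bullet> x) + \<theta>))"
| add: "trig_poly p \<Longrightarrow> trig_poly q \<Longrightarrow> trig_poly (\<lambda>x. p x + q x)"

lemma trig_poly_const: "trig_poly (\<lambda>x. c)"
  using trig_poly.wave[of 0 c 0] by simp

text \<open>The product-to-sum formula keeps the frequencies integral. The resulting closure under
  products makes a polynomial in a trigonometric polynomial again one, which gives access to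
  Weierstrass approximation.\<close>

lemma trig_poly_mult_wave:
  assumes "\<forall>i. \<kappa> $ i \<in> \<int>" "trig_poly q"
  shows "trig_poly (\<lambda>x. c * cos (2 * pi * (\<kappa> \<bullet> x) + \<theta>) * q x)"
  using assms(2)
proof (induction rule: trig_poly.induct)
  case (wave \<kappa>' c' \<theta>')
  have "c * cos (2 * pi * (\<kappa> \<bullet> x) + \<theta>) * (c' * cos (2 * pi * (\<kappa>' \<bullet> x) + \<theta>')) =
     (c * c' / 2) * cos (2 * pi * ((\<kappa> - \<kappa>') \<bullet> x) + (\<theta> - \<theta>')) + (c * c' / 2) * cos
         (2 * pi * ((\<kappa> + \<kappa>') \<bullet> x) + (\<theta> + \<theta>'))" for x
  proof -
    have "2 * pi * ((\<kappa> - \<kappa>') \<bullet> x) + (\<theta> - \<theta>') = (2 * pi * (\<kappa> \<bullet> x) + \<theta>) - (2 * pi * (\<kappa>' \<bullet> x) + \<theta>')"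
      "2 * pi * ((\<kappa> + \<kappa>') \<bullet> x) + (\<theta> + \<theta>') = (2 * pi * (\<kappa> \<bullet> x) + \<theta>) + (2 * pi * (\<kappa>' \<bullet> x) + \<theta>')"
      by (simp_all add: inner_diff_left inner_add_left algebra_simps)
    moreover have "c * cos A * (c' * cos B) = (c * c' / 2) * cos (A - B) + (c * c' / 2)
        * cos (A + B)" for A B
      by (simp add: cos_diff cos_add algebra_simps)
    ultimately show ?thesis by (simp only:)
  qed
  note e = this
  show ?case
    unfolding e using assms(1) wave by (intro trig_poly.add trig_poly.wave) auto
next
  case (add p q)
  then show ?case using trig_poly.add[OF add.IH] by (simp add: distrib_left)
qed

lemma trig_poly_mult:
  assumes "trig_poly p" "trig_poly q"
  shows "trig_poly (\<lambda>x. p x * q x)"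
  using assms(1)
proof (induction rule: trig_poly.induct)
  case (wave \<kappa> c \<theta>)
  then show ?case using trig_poly_mult_wave assms(2) by blast
next
  case (add p q')
  then show ?case using trig_poly.add[OF add.IH] by (simp add: distrib_right)
qed

lemma trig_poly_prod: "finite I \<Longrightarrow> (\<And>i. i \<in> I \<Longrightarrow> trig_poly (p i)) \<Longrightarrow> trig_poly (\<lambda>x. \<Prod>i\<in>I. p i x)"
  by (induction I rule: finite_induct) (auto intro: trig_poly_const trig_poly_mult)

lemma trig_poly_polynomial:
  fixes P :: "real \<Rightarrow> real"
  assumes "real_polynomial_function P" "trig_poly q"
  shows "trig_poly (\<lambda>x. P (q x))"
  using assms(1)
proof (induction rule: real_polynomial_function.induct)
  case (linear f)
  have scale: "f y = f 1 * y" for y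
    using linear_scale[OF bounded_linear.linear[OF linear], of y 1] by (simp add: mult.commute)
  have "(\<lambda>x. f (q x)) = (\<lambda>x. f 1 * q x)" by (intro ext scale)
  then show ?case using trig_poly_mult[OF trig_poly_const assms(2), of "f 1"] by simp
next
  case (const c)
  show ?case by (rule trig_poly_const)
next
  case (add f g)
  show ?case by (rule trig_poly.add[OF add.IH])
next
  case (mult f g)
  show ?case by (rule trig_poly_mult[OF mult.IH])
qed

lemma (in profiles) trig_sum_of_trig_poly:
  assumes "trig_poly p" "P \<eta>"
  shows "trig_sum P (\<lambda>z. \<eta> (fst z) * p (snd z))"
  using assms(1)
proof (induction rule: trig_poly.induct)
  case (wave \<kappa> c \<theta>)
  have "(\<lambda>z. \<eta> (fst z) * (c * cos (2 * pi * (\<kappa> \<bullet> snd z) + \<theta>))) = plane_wave (\<lambda>t. c * \<eta> t) \<kappa> \<theta>"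
    by (auto simp: plane_wave_def)
  moreover have "trig_sum P (plane_wave (\<lambda>t. c * \<eta> t) \<kappa> \<theta>)"
    using P_cmult[OF assms(2)] wave by (rule trig_sum.wave)
  ultimately show ?case by simp
next
  case (add p q)
  then show ?case using trig_sum.add[OF add.IH] by (simp add: distrib_left)
qed

text \<open>Weierstrass approximation of the ramps \<open>min 1 (max 0 (n s))\<close>, which
  increase to the indicator of the positive half line. The range \<open>|s| \<le> 2\<close> contains
  all differences of two cosines, and the bound 2 is the height 1 of the ramp plus an error of at
  most 1.\<close>

lemma polynomial_heaviside:
  "\<exists>P. (\<forall>n. real_polynomial_function (P n)) \<and> (\<forall>n s. \<bar>s\<bar> \<le> 2 \<longrightarrow> \<bar>P n s\<bar> \<le> (2::real)) \<and>
    (\<forall>s::real. \<bar>s\<bar> \<le> 2 \<longrightarrow> (\<lambda>n. P n s) \<longlonglongrightarrow> indicator {0<..} s)"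
proof -
  define \<phi> where "\<phi> n s = min 1 (max 0 (real n * s))" for n s
  have "\<exists>P. real_polynomial_function P \<and> (\<forall>s\<in>{-2..2}. \<bar>\<phi> n s - P s\<bar> < 1 / real (Suc n))" for n
  proof -
    have "continuous_on {-2..2} (\<phi> n)" unfolding \<phi>_def by (intro continuous_intros)
    then show ?thesis
      by (rule Stone_Weierstrass_real_polynomial_function[OF compact_Icc, of "-2" 2 "\<phi> n"
          "1 / real (Suc n)"]) auto
  qed
  then obtain P where P: "\<And>n. real_polynomial_function (P n)"
    "\<And>n s. s \<in> {-2..2} \<Longrightarrow> \<bar>\<phi> n s - P n s\<bar> < 1 / real (Suc n)" by metis
  show ?thesis
  proof (intro exI[of _ P] conjI allI impI)
    show "real_polynomial_function (P n)" for n by (rule P)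
  next
    fix n and s :: real assume s: "\<bar>s\<bar> \<le> 2"
    then have s': "s \<in> {-2..2}" by auto
    have "0 \<le> \<phi> n s" "\<phi> n s \<le> 1" by (auto simp: \<phi>_def)
    moreover have "1 / real (Suc n) \<le> 1" by simp
    ultimately show "\<bar>P n s\<bar> \<le> 2" using P(2)[OF s', of n] by linarith
  next
    fix s :: real assume s: "\<bar>s\<bar> \<le> 2"
    then have s': "s \<in> {-2..2}" by auto
    have "(\<lambda>n. \<phi> n s - P n s) \<longlonglongrightarrow> 0"
    proof (rule Lim_null_comparison[OF _ LIMSEQ_inverse_real_of_nat])
      show "\<forall>\<^sub>F n in sequentially. norm (\<phi> n s - P n s) \<le> inverse (real (Suc n))"
        using P(2)[OF s'] by (auto simp: inverse_eq_divide less_imp_le)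
    qed
    moreover have "(\<lambda>n. \<phi> n s) \<longlonglongrightarrow> indicator {0<..} s"
    proof (cases "s > 0")
      case True
      obtain N where N: "real N * s > 1" using reals_Archimedean3[OF True] by blast
      have "\<phi> n s = 1" if "n \<ge> N" for n
      proof -
        have "real N * s \<le> real n * s" using that True by (intro mult_right_mono) auto
        then show ?thesis using N by (simp add: \<phi>_def)
      qed
      then show ?thesis using True
        by (intro tendsto_eventually) (auto simp: eventually_sequentially)
    next
      case False
      then have "\<phi> n s = 0" for n by (simp add: \<phi>_def mult_nonneg_nonpos)
      with False show ?thesis by simp
    qed
    ultimately show "(\<lambda>n. P n s) \<longlonglongrightarrow> indicator {0<..} s"
      using tendsto_diff[of "\<lambda>n. \<phi> n s" "indicator {0<..} s" sequentially "\<lambda>n. \<phi> n s - P n s" 0] by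
          simp
  qed
qed

text \<open>With \<open>m\<close> the midpoint and \<open>r\<close> half the length of the interval,
  \<open>cos(2\<pi>(x - m)) - cos(2\<pi>r)\<close> is positive exactly on the interval modulo 1, so its composition with
  polynomial approximations of the Heaviside function converges to the indicator.\<close>
lemma trig_poly_interval:
  fixes i :: "'d::finite"
  obtains p :: "nat \<Rightarrow> real^'d \<Rightarrow> real"
  where "\<And>n. trig_poly (p n)" "\<And>n x. \<bar>p n x\<bar> \<le> 2"
    "\<And>x. 0 < x $ i \<Longrightarrow> x $ i < 1 \<Longrightarrow> (\<lambda>n. p n x) \<longlonglongrightarrow> indicator {c<..<d} (x $ i)"
proof -
  \<comment> \<open>Clipping to the unit interval guarantees \<open>r \<le> 1/2\<close> and keeps
    the interval inside a single period.\<close>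
  define c' d' where "c' = max c 0" and "d' = min d 1"
  have ind: "indicator {c<..<d} y = (indicator {c'<..<d'} y :: real)" if "0 < y" "y < 1" for y
    using that by (auto simp: indicator_def c'_def d'_def)
  show ?thesis
  proof (cases "c' < d'")
    case False
    then have "indicator {c'<..<d'} y = (0::real)" for y by simp
    then show ?thesis
      by (intro that[of "\<lambda>_ _. 0"]) (auto simp: ind trig_poly_const)
  next
    case True
    define m r where "m = (c' + d') / 2" and "r = (d' - c') / 2"
    have mr: "0 < r" "r \<le> 1/2" "r \<le> m" "m \<le> 1 - r" "c' = m - r" "d' = m + r"
      using True by (auto simp: m_def r_def c'_def d'_def field_simps)
    define q where "q x = cos (2 * pi * (x $ i - m)) - cos (2 * pi * r)" for x :: "real^'d"
    have tq: "trig_poly q"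
    proof -
      have "\<forall>j. (axis i 1 :: real^'d) $ j \<in> \<int>" by (simp add: axis_def)
      from trig_poly.add[OF trig_poly.wave[OF this, of 1 "- (2 * pi * m)"]
          trig_poly_const[of "- cos (2 * pi * r)"]]
      show ?thesis unfolding q_def[abs_def]
        by (simp add: inner_axis' algebra_simps)
    qed
    have bq: "\<bar>q x\<bar> \<le> 2" for x
      using abs_cos_le_one[of "2 * pi * (x $ i - m)"] abs_cos_le_one[of "2 * pi * r"]
        unfolding q_def by linarith
    have pos: "q x > 0 \<longleftrightarrow> x $ i \<in> {c'<..<d'}" if "0 < x $ i" "x $ i < 1" for x
    proof -
      define y where "y = \<bar>x $ i - m\<bar>"
      have qy: "q x = cos (2 * pi * y) - cos (2 * pi * r)"
        unfolding q_def y_def using cos_abs_real[of "2 * pi * (x $ i - m)"] by (simp add: abs_mult)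
      have y: "0 \<le> y" "y \<le> 1 - r" "x $ i \<in> {c'<..<d'} \<longleftrightarrow> y < r" using that mr unfolding y_def by auto
      show ?thesis
      proof (cases "y < r")
        case True
        then have "2 * pi * y < 2 * pi * r" "2 * pi * r \<le> pi" using mr by auto
        then have "cos (2 * pi * r) < cos (2 * pi * y)" using y by (intro cos_monotone_0_pi) auto
        then show ?thesis using True y(3) qy by simp
      next
        case False
        have "cos (2 * pi * y) \<le> cos (2 * pi * r)"
        proof (cases "y \<le> 1/2")
          case True
          then show ?thesis using False mr by (intro cos_monotone_0_pi_le) auto
        next
          \<comment> \<open>Beyond half a period the cosine increases again; reflecting
            \<open>y\<close> to \<open>1 - y\<close>, which is still at least \<open>r\<close>,
            returns to the range where it decreases.\<close>
          case F: False
          have "cos (2 * pi * y) = cos (2 * pi * (1 - y))"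
            using cos_2pi_minus[of "2 * pi * y"] by (simp add: algebra_simps)
          also have "\<dots> \<le> cos (2 * pi * r)"
            using F mr y by (intro cos_monotone_0_pi_le) auto
          finally show ?thesis .
        qed
        then show ?thesis using False y(3) qy by simp
      qed
    qed
    obtain P :: "nat \<Rightarrow> real \<Rightarrow> real" where P: "\<And>n. real_polynomial_function (P n)" "\<And>n s. \<bar>s\<bar> \<le> 2 \<Longrightarrow>
        \<bar>P n s\<bar> \<le> 2"
      "\<And>s. \<bar>s\<bar> \<le> 2 \<Longrightarrow> (\<lambda>n. P n s) \<longlonglongrightarrow> indicator {0<..} s"
      using polynomial_heaviside by metis
    show ?thesis
    proof (rule that[of "\<lambda>n x. P n (q x)"])
      show "trig_poly (\<lambda>x. P n (q x))" for n by (rule trig_poly_polynomial[OF P(1) tq])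
      show "\<bar>P n (q x)\<bar> \<le> 2" for n x by (rule P(2)[OF bq])
      fix x :: "real^'d" assume x: "0 < x $ i" "x $ i < 1"
      have "indicator {0<..} (q x) = (indicator {c<..<d} (x $ i) :: real)"
        using pos[OF x] ind[OF x] by (simp add: indicator_def)
      then show "(\<lambda>n. P n (q x)) \<longlonglongrightarrow> indicator {c<..<d} (x $ i)" using P(3)[OF bq, of x] by simp
    qed
  qed
qed

text \<open>A product of two steepening flat steps, one at each end. The shift by 1 in their
  arguments makes each factor vanish on a margin of width \<open>1 / (n + 1)\<close> inside the
  clipped interval; this yields the compact support in the open interval from 0 to \<open>T\<close>,
  and the margin shrinks away in the limit.\<close>

lemma cpt_prof_interval:
  obtains \<eta> :: "nat \<Rightarrow> real \<Rightarrow> real"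
  where "\<And>n. cpt_prof T (\<eta> n)" "\<And>n t. \<bar>\<eta> n t\<bar> \<le> 1"
    "\<And>t. 0 < t \<Longrightarrow> t < T \<Longrightarrow> (\<lambda>n. \<eta> n t) \<longlonglongrightarrow> indicator {a<..<b} t"
proof -
  define a' b' where "a' = max a 0" and "b' = min b T"
  define L R where "L n t = flat_step (real (Suc n) * (t - a') - 1)"
     and "R n t = flat_step (real (Suc n) * (b' - t) - 1)" for n t
  have CL: "Cinf (L n)" for n
    using Cinf_affine[OF Cinf_flat_step, of "real (Suc n)" "- real (Suc n) * a' - 1"]
    unfolding L_def by (simp add: algebra_simps)
  have CR: "Cinf (R n)" for n
    using Cinf_affine[OF Cinf_flat_step, of "- real (Suc n)" "real (Suc n) * b' - 1"]
    unfolding R_def by (simp add: algebra_simps)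
  have L0: "L n t = 0" if "t \<le> a' + 1 / real (Suc n)" for n t
    unfolding L_def using that by (intro flat_step_bounds) (simp add: field_simps)
  have R0: "R n t = 0" if "t \<ge> b' - 1 / real (Suc n)" for n t
    unfolding R_def using that by (intro flat_step_bounds) (simp add: field_simps)
  have lim: "(\<lambda>n. flat_step (real (Suc n) * s - 1)) \<longlonglongrightarrow> indicator {0<..} s" for s
  proof (cases "s > 0")
    case True
    have "filterlim (\<lambda>n. - 1 + real (Suc n) * s) at_top sequentially"
      by (intro filterlim_tendsto_add_at_top[OF tendsto_const]
          filterlim_at_top_mult_tendsto_pos[OF tendsto_const True]
          filterlim_compose[OF filterlim_real_sequentially filterlim_Suc])
    then show ?thesis using True flat_step_tendsto by simp
  next
    case False
    then have "real (Suc n) * s - 1 \<le> 0" for n using mult_nonneg_nonpos[of "real (Suc n)" s]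
      by linarith
    then show ?thesis using False by (simp add: flat_step_bounds)
  qed
  show ?thesis
  proof (rule that[of "\<lambda>n t. L n t * R n t"])
    fix n
    have C: "Cinf (\<lambda>t. L n t * R n t)" by (intro Cinf_mult CL CR)
    have p: "0 < 1 / real (Suc n)" by simp
    have "\<forall>t\<le>a' + 1 / real (Suc n). L n t * R n t = 0" "0 < a' + 1 / real (Suc n)"
      using L0 p by (auto simp: a'_def add_nonneg_pos)
    then have "left_prof (\<lambda>t. L n t * R n t)" using C unfolding left_prof_def by blast
    have "\<forall>t\<ge>b' - 1 / real (Suc n). L n t * R n t = 0" using R0 by simp
    moreover have "b' - 1 / real (Suc n) < T"
    proof -
      have "b' \<le> T" by (simp add: b'_def)
      then show ?thesis using p by linarith
    qed
    ultimately have "right_prof T (\<lambda>t. L n t * R n t)" using C unfolding right_prof_def by blast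
    with \<open>left_prof (\<lambda>t. L n t * R n t)\<close> show "cpt_prof T (\<lambda>t. L n t * R n t)"
      by (simp add: cpt_prof_def)
  next
    fix n t show "\<bar>L n t * R n t\<bar> \<le> 1"
      unfolding L_def R_def abs_mult using flat_step_bounds by (intro mult_le_one) auto
  next
    fix t assume t: "0 < t" "t < T"
    have "(\<lambda>n. L n t * R n t) \<longlonglongrightarrow> indicator {0<..} (t - a') * indicator {0<..} (b' - t)"
      unfolding L_def R_def by (intro tendsto_mult lim)
    moreover have "indicator {0<..} (t - a') * indicator {0<..} (b' - t)
        = (indicator {a<..<b} t :: real)"
      using t by (auto simp: indicator_def a'_def b'_def)
    ultimately show "(\<lambda>n. L n t * R n t) \<longlonglongrightarrow> indicator {a<..<b} t" by simp
  qed
qed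

section \<open>From boxes to all square integrable functions\<close>

lemma AE_cylm_interior: "AE z in cylm T. \<forall>i. 0 < snd z $ i \<and> snd z $ i < 1"
proof -
  have "negligible (\<Union>(i, c)\<in>UNIV \<times> {0, 1}. {z::real \<times> (real^'d). z \<bullet> (0, axis i 1) = c})"
    by (intro negligible_Union ballI finite_imageI)
       (auto intro!: negligible_standard_hyperplane simp: Basis_prod_def axis_in_Basis_iff)
  then have N: "(\<Union>(i, c)\<in>UNIV \<times> {0, 1}. {z::real \<times> (real^'d). z \<bullet> (0, axis i 1) = c})
      \<in> null_sets lebesgue"
    by (simp add: negligible_iff_null_sets)
  show ?thesis
    unfolding AE_cylm
  proof (rule AE_I'[OF N], rule subsetI)
    fix z :: "real \<times> (real^'d)"
    assume "z \<in> {z \<in> space lebesgue. \<not> (z \<in> cyl T \<longrightarrow> (\<forall>i. 0 < snd z $ i \<and> snd z $ i < 1))}"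
    then obtain i where "z \<in> cyl T" "\<not> (0 < snd z $ i \<and> snd z $ i < 1)" by auto
    then have "snd z $ i = 0 \<or> snd z $ i = 1" unfolding mem_cyl by (metis order_le_less)
    then have "z \<bullet> (0, axis i 1) \<in> {0, 1}" by (cases z) (auto simp: inner_axis)
    then show "z \<in> (\<Union>(i, c)\<in>UNIV \<times> {0, 1}. {z. z \<bullet> (0, axis i 1) = c})" by blast
  qed
qed

lemma borel_measurable_cylm: "f \<in> borel_measurable borel \<Longrightarrow> f \<in> borel_measurable (cylm T)"
  by (rule measurable_restrict_space1) (simp add: measurable_completion)

text \<open>The indicator of a box is a product of indicators of intervals, so products of the
  one-dimensional approximants converge to it. They are uniformly bounded by a power of 2, and
  convergence can fail only on the faces of the unit cube, a null set.\<close>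

lemma approximable_box:
  fixes a b :: "real \<times> (real^'d)"
  shows "approximable T (indicator (box a b))"
proof -
  obtain \<eta> where \<eta>: "\<And>n. cpt_prof T (\<eta> n)" "\<And>n t. \<bar>\<eta> n t\<bar> \<le> 1"
    "\<And>t. 0 < t \<Longrightarrow> t < T \<Longrightarrow> (\<lambda>n. \<eta> n t) \<longlonglongrightarrow> indicator {fst a<..<fst b} t"
    using cpt_prof_interval by blast
  have "\<exists>p. (\<forall>n. trig_poly (p n)) \<and> (\<forall>n x. \<bar>p n x\<bar> \<le> 2) \<and>
     (\<forall>x. 0 < x $ i \<longrightarrow> x $ i < 1 \<longrightarrow> (\<lambda>n. p n x) \<longlonglongrightarrow> indicator {snd a $ i<..<snd b $ i} (x $ i))" for i
    by (rule trig_poly_interval[of i "snd a $ i" "snd b $ i"]) blast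
  then obtain p where p: "\<And>i n. trig_poly (p i n)" "\<And>i n x. \<bar>p i n x\<bar> \<le> 2"
    "\<And>i x. 0 < x $ i \<Longrightarrow> x $ i < 1 \<Longrightarrow> (\<lambda>n. p i n x) \<longlonglongrightarrow> indicator {snd a $ i<..<snd b $ i} (x $ i)"
      by metis
  have box: "indicator (box a b) z = indicator {fst a<..<fst b} (fst z)
      * (\<Prod>i\<in>UNIV. indicator {snd a $ i<..<snd b $ i} (snd z $ i) :: real)" for z
  proof -
    have *: "z \<in> box a b \<longleftrightarrow> fst z \<in> {fst a<..<fst b} \<and> (\<forall>i. snd z $ i \<in> {snd a $ i<..<snd b $ i})"
    proof -
      have "z \<in> box a b \<longleftrightarrow> fst z \<in> box (fst a) (fst b) \<and> snd z \<in> box (snd a) (snd b)"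
        by (auto simp: mem_box Basis_prod_def inner_prod_def)
      then show ?thesis by (simp add: mem_box_cart)
    qed
    have pr: "(\<Prod>i\<in>UNIV. indicator (A i) (y i) :: real) = (if \<forall>i. y i \<in> A i then 1 else 0)" for A
        and y :: "'d \<Rightarrow> real"
      by (auto simp: indicator_def prod_zero_iff)
    show ?thesis unfolding pr using * by (auto simp: indicator_def)
  qed
  define g where "g n z = \<eta> n (fst z) * (\<Prod>i\<in>UNIV. p i n (snd z))" for n and z :: "real \<times> (real^'d)"
  show ?thesis
  proof (rule approximable_bounded_tendsto)
    show "indicator (box a b) \<in> borel_measurable (cylm T)"
      by (intro borel_measurable_cylm borel_measurable_indicator) simp
    show "approximable T (g n)" for n
      unfolding g_def by (intro approximable_trig_sum cpt_prof.trig_sum_of_trig_poly trig_poly_prod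
          p \<eta>) auto
    show "AE z in cylm T. \<bar>g n z\<bar> \<le> 2 ^ CARD('d)" for n
    proof (rule AE_I2)
      fix z :: "real \<times> (real^'d)"
      have "\<bar>\<Prod>i\<in>UNIV. p i n (snd z)\<bar> \<le> (\<Prod>i\<in>(UNIV::'d set). 2)"
        unfolding abs_prod by (intro prod_mono) (use p in auto)
      then have "\<bar>\<Prod>i\<in>UNIV. p i n (snd z)\<bar> \<le> 2 ^ CARD('d)" by simp
      with \<eta>(2)[of n "fst z"] have "\<bar>\<eta> n (fst z)\<bar> * \<bar>\<Prod>i\<in>UNIV. p i n (snd z)\<bar> \<le> 1 * 2 ^ CARD('d)"
        by (intro mult_mono) auto
      then show "\<bar>g n z\<bar> \<le> 2 ^ CARD('d)" by (simp add: g_def abs_mult)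
    qed
    have "AE z in cylm T. 0 < fst z \<and> fst z < T"
      by (rule AE_I2) (auto simp: space_restrict_space mem_cyl)
    with AE_cylm_interior show "AE z in cylm T. (\<lambda>n. g n z) \<longlonglongrightarrow> indicator (box a b) z"
    proof eventually_elim
      case (elim z)
      then show ?case unfolding g_def box by (intro tendsto_mult tendsto_prod \<eta> p) auto
    qed
  qed
qed

text \<open>Dynkin's theorem applied to boxes, which are stable under intersection and generate the
  Borel sets.\<close>

lemma approximable_borel:
  fixes A :: "(real \<times> (real^'d)) set"
  assumes "T > 0" "A \<in> sets borel"
  shows "approximable T (indicator A)"
proof -
  define G where "G = range (\<lambda>(a, b). box a b :: (real \<times> (real^'d)) set)"
  have "Int_stable G" by (auto simp: G_def Int_stable_def box_Int_box)
  moreover have "G \<subseteq> Pow UNIV" by simp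
  moreover have "A \<in> sigma_sets UNIV G"
    using assms(2) by (simp add: borel_eq_box G_def)
  ultimately show ?thesis
  proof (induction rule: sigma_sets_induct_disjoint)
    case (basic A)
    then show ?case by (auto simp: G_def approximable_box)
  next
    case empty
    then show ?case using approximable_zero[OF assms(1)] by (simp add: indicator_def[abs_def])
  next
    case (compl A)
    obtain c :: "real \<times> (real^'d)" where c: "cyl T \<subseteq> box (- c) c"
      using bounded_subset_box_symmetric[OF bounded_cyl] by blast
    have A: "A \<in> sets borel" using compl by (simp add: borel_eq_box G_def)
    \<comment> \<open>On the bounded cylinder the constant 1 agrees with the indicator of a large
      box, so complements reduce to differences.\<close>
    have one: "approximable T (\<lambda>z :: real \<times> (real^'d). 1)"
      by (rule approximable_cong_AE[OF approximable_box[of T "- c" c]])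
         (use c in \<open>auto simp: space_restrict_space intro!: AE_I2\<close>)
    from approximable_add[OF one approximable_cmult[OF compl(2), of "-1"]]
    have "approximable T (\<lambda>z. 1 - indicator A z)" by simp
    also have "(\<lambda>z. 1 - indicator A z) = (indicator (UNIV - A) :: _ \<Rightarrow> real)"
      by (auto simp: indicator_def)
    finally show ?case .
  next
    case (union A)
    have A: "A i \<in> sets borel" for i using union(2) by (auto simp: borel_eq_box G_def)
    have s: "approximable T (\<lambda>z. \<Sum>i<n. indicator (A i) z)" for n :: nat
      by (induction n) (auto intro: approximable_zero[OF assms(1)] approximable_add union)
    have ind: "(\<Sum>i<n. indicator (A i) z) = (indicator (\<Union>i<n. A i) z :: real)" for n z
      by (rule indicator_UN_disjoint[symmetric])
          (auto intro: disjoint_family_on_mono[OF _ union(1)])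
    show ?case
    proof (rule approximable_bounded_tendsto[OF _ s])
      show "indicator (\<Union> (range A)) \<in> borel_measurable (cylm T)"
        by (intro borel_measurable_cylm borel_measurable_indicator) (use A in auto)
      show "AE z in cylm T. \<bar>\<Sum>i<n. indicator (A i) z\<bar> \<le> (1::real)" for n
        unfolding ind by (rule AE_I2) (auto simp: indicator_def)
      show "AE z in cylm T. (\<lambda>n. \<Sum>i<n. indicator (A i) z) \<longlonglongrightarrow> (indicator (\<Union> (range A)) z :: real)"
        unfolding ind by (rule AE_I2) (rule LIMSEQ_indicator_UN)
    qed
  qed
qed

text \<open>Square integrability is a premise inside the induction because each intermediate
  function must inherit it: summands and increasing approximants are dominated by the nonnegative
  function they build up.\<close>

lemma approximable_borel_nonneg:
  fixes u :: "real \<times> (real^'d) \<Rightarrow> real"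
  assumes T: "T > 0" and u: "u \<in> borel_measurable borel" "\<And>z. 0 \<le> u z"
  shows "in_L2 (cylm T) u \<longrightarrow> approximable T u"
  using u
proof (induction rule: borel_measurable_induct_real)
  case (set A)
  then show ?case by (intro impI approximable_borel[OF T])
next
  case (mult u c)
  show ?case
  proof
    assume *: "in_L2 (cylm T) (\<lambda>x. c * u x)"
    show "approximable T (\<lambda>x. c * u x)"
    proof (cases "c = 0")
      case True
      then show ?thesis using approximable_zero[OF T] by simp
    next
      case False
      then have "in_L2 (cylm T) u"
        using in_L2_cmult[OF *, of "inverse c"] by (simp add: mult.assoc[symmetric])
      then show ?thesis using mult by (simp add: approximable_cmult)
    qed
  qed
next
  case (add u v)
  show ?case
  proof
    assume *: "in_L2 (cylm T) (\<lambda>x. v x + u x)"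
    have "in_L2 (cylm T) u" "in_L2 (cylm T) v"
      by (rule in_L2_dominated[OF *];
          use add in \<open>auto intro!: borel_measurable_cylm simp: abs_of_nonneg\<close>)+
    then show "approximable T (\<lambda>x. v x + u x)" using add by (simp add: approximable_add)
  qed
next
  case (seq U)
  show ?case
  proof
    assume *: "in_L2 (cylm T) u"
    have le: "U i z \<le> u z" for i z
    proof (rule incseq_le)
      show "incseq (\<lambda>i. U i z)" using \<open>incseq U\<close> unfolding incseq_def by (meson le_funD)
      show "(\<lambda>i. U i z) \<longlonglongrightarrow> u z" using seq by simp
    qed
    have m: "U i \<in> borel_measurable (cylm T)" for i by (intro borel_measurable_cylm seq)
    have a: "approximable T (U i)" for i
    proof -
      have "in_L2 (cylm T) (U i)"
        by (rule in_L2_dominated[OF * m]) (use le seq u in \<open>auto intro!: AE_I2 simp: abs_of_nonneg\<close>)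
      then show ?thesis using seq by blast
    qed
    show "approximable T u"
    proof (rule approximable_tendsto[OF * a])
      show "(\<lambda>n. nsq (cylm T) (\<lambda>z. u z - U n z)) \<longlonglongrightarrow> 0"
        by (rule nsq_tendsto_dominated[OF in_L2_measurable[OF *] m *])
           (use le seq u in \<open>auto intro!: AE_I2 simp: abs_of_nonneg\<close>)
    qed
  qed
qed

text \<open>The induction over Borel functions applies after passing to a Borel representative of
  the Lebesgue measurable \<open>f\<close>, split into its positive and negative parts.\<close>

lemma trig_sum_dense:
  fixes f :: "real \<times> (real^'d) \<Rightarrow> real"
  assumes T: "T > 0" and f: "in_L2 (cylm T) f"
  shows "approximable T f"
proof -
  have "(\<lambda>z. indicator (cyl T) z * f z) \<in> borel_measurable lebesgue"
    using in_L2_measurable[OF f] by (subst (asm) borel_measurable_restrict_space_iff) auto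
  then obtain f' where f': "f' \<in> borel_measurable lborel" "AE z in lborel. indicator (cyl T) z * f z
      = f' z"
    using completion_ex_borel_measurable_real by blast
  have m: "f' \<in> borel_measurable borel" using f' by simp
  have ae: "AE z in cylm T. f z = f' z"
    unfolding AE_cylm using AE_completion[OF f'(2)] by eventually_elim auto
  have sf: "in_L2 (cylm T) f'"
    by (rule in_L2_cong_AE[OF f borel_measurable_cylm[OF m] ae])
  have "approximable T (\<lambda>z. max 0 (f' z))" "approximable T (\<lambda>z. max 0 (- f' z))"
  proof -
    have "(\<lambda>z. max 0 (f' z)) \<in> borel_measurable borel" "(\<lambda>z. max 0 (- f' z))
        \<in> borel_measurable borel"
      using m by measurable
    note m' = this
    have "in_L2 (cylm T) (\<lambda>z. max 0 (f' z))" "in_L2 (cylm T) (\<lambda>z. max 0 (- f' z))"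
      by (rule in_L2_dominated[OF sf borel_measurable_cylm[OF m'(1)]]
          in_L2_dominated[OF sf borel_measurable_cylm[OF m'(2)]]; auto)+
    with m' show "approximable T (\<lambda>z. max 0 (f' z))" "approximable T (\<lambda>z. max 0 (- f' z))"
      by (auto intro!: approximable_borel_nonneg[OF T, THEN mp])
  qed
  from approximable_add[OF this(1) approximable_cmult[OF this(2), of "-1"]]
  have "approximable T (\<lambda>z. max 0 (f' z) + - 1 * max 0 (- f' z))" .
  also have "(\<lambda>z. max 0 (f' z) + - 1 * max 0 (- f' z)) = f'" by (auto simp: max_def)
  finally show ?thesis
    by (rule approximable_cong_AE[OF _ in_L2_measurable[OF f]]) (use ae in auto)
qed

section \<open>Weak derivatives\<close>

definition l2_lim :: "'a measure \<Rightarrow> (nat \<Rightarrow> 'a \<Rightarrow> real) \<Rightarrow> ('a \<Rightarrow> real) \<Rightarrow> bool" where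
  "l2_lim M f F \<longleftrightarrow> (\<forall>n. in_L2 M (f n)) \<and> in_L2 M F \<and>
     (\<lambda>n. nsq M (\<lambda>z. f n z - F z)) \<longlonglongrightarrow> 0"

lemma l2_lim_in_L2:
  "l2_lim M f F \<Longrightarrow> in_L2 M (f n)" "l2_lim M f F \<Longrightarrow> in_L2 M F"
  by (auto simp: l2_lim_def)

lemma l2_lim_add:
  assumes "l2_lim M f F" "l2_lim M g G"
  shows "l2_lim M (\<lambda>n z. f n z + g n z) (\<lambda>z. F z + G z)"
  unfolding l2_lim_def
proof (intro conjI allI)
  note s = l2_lim_in_L2[OF assms(1)] l2_lim_in_L2[OF assms(2)]
  show "in_L2 M (\<lambda>z. f n z + g n z)" "in_L2 M (\<lambda>z. F z + G z)" for n
    by (intro in_L2_add s)+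
  have "(\<lambda>n. 2 * nsq M (\<lambda>z. f n z - F z) + 2 * nsq M (\<lambda>z. g n z - G z)) \<longlonglongrightarrow> 2 * 0 + 2 * 0"
    using assms by (intro tendsto_intros) (auto simp: l2_lim_def)
  then have lim: "(\<lambda>n. 2 * nsq M (\<lambda>z. f n z - F z) + 2 * nsq M (\<lambda>z. g n z - G z)) \<longlonglongrightarrow> 0" by simp
  have le: "nsq M (\<lambda>z. f n z + g n z - (F z + G z)) \<le> 2 * nsq M (\<lambda>z. f n z - F z)
      + 2 * nsq M (\<lambda>z. g n z - G z)" for n
    using nsq_add_le[OF in_L2_diff[OF s(1,2)] in_L2_diff[OF s(3,4)], of n n]
    by (simp add: algebra_simps)
  show "(\<lambda>n. nsq M (\<lambda>z. f n z + g n z - (F z + G z))) \<longlonglongrightarrow> 0"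
    by (rule tendsto_sandwich[OF _ _ tendsto_const lim]) (auto simp: le)
qed

lemma l2_lim_cmult:
  assumes "l2_lim M f F"
  shows "l2_lim M (\<lambda>n z. c * f n z) (\<lambda>z. c * F z)"
  unfolding l2_lim_def
proof (intro conjI allI)
  note s = l2_lim_in_L2[OF assms(1)]
  show "in_L2 M (\<lambda>z. c * f n z)" "in_L2 M (\<lambda>z. c * F z)" for n
    by (intro in_L2_cmult s)+
  have "(\<lambda>n. c^2 * nsq M (\<lambda>z. f n z - F z)) \<longlonglongrightarrow> c^2 * 0"
    using assms by (intro tendsto_intros) (auto simp: l2_lim_def)
  then show "(\<lambda>n. nsq M (\<lambda>z. c * f n z - c * F z)) \<longlonglongrightarrow> 0"
    unfolding right_diff_distrib[symmetric] nsq_cmult by simp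
qed

lemma l2_lim_diff:
  assumes "l2_lim M f F" "l2_lim M g G"
  shows "l2_lim M (\<lambda>n z. f n z - g n z) (\<lambda>z. F z - G z)"
  using l2_lim_add[OF assms(1) l2_lim_cmult[OF assms(2), of "-1"]] by simp

lemma l2_lim_zero: "l2_lim M (\<lambda>n z. 0) (\<lambda>z. 0)"
  by (simp add: l2_lim_def nsq_def)

lemma l2_lim_sum:
  "(\<And>i. i \<in> I \<Longrightarrow> l2_lim M (f i) (F i)) \<Longrightarrow> l2_lim M (\<lambda>n z. \<Sum>i\<in>I. f i n z) (\<lambda>z. \<Sum>i\<in>I. F i z)"
  by (induction I rule: infinite_finite_induct) (auto intro: l2_lim_zero l2_lim_add)

lemma l2_lim_abs:
  assumes "l2_lim M f F"
  shows "l2_lim M (\<lambda>n z. \<bar>f n z\<bar>) (\<lambda>z. \<bar>F z\<bar>)"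
  unfolding l2_lim_def
proof (intro conjI allI)
  note s = l2_lim_in_L2[OF assms(1)]
  have a: "in_L2 M (\<lambda>z. \<bar>h z\<bar>)" if "in_L2 M h" for h
    using that by (auto simp: in_L2_def)
  show "in_L2 M (\<lambda>z. \<bar>f n z\<bar>)" "in_L2 M (\<lambda>z. \<bar>F z\<bar>)" for n by (intro a s)+
  have le: "nsq M (\<lambda>z. \<bar>f n z\<bar> - \<bar>F z\<bar>) \<le> nsq M (\<lambda>z. f n z - F z)" for n
    by (rule nsq_mono[OF in_L2_diff[OF s]])
       (auto intro!: in_L2_measurable in_L2_diff a s)
  show "(\<lambda>n. nsq M (\<lambda>z. \<bar>f n z\<bar> - \<bar>F z\<bar>)) \<longlonglongrightarrow> 0"
    by (rule tendsto_sandwich[OF _ _ tendsto_const]) (use assms le in \<open>auto simp: l2_lim_def\<close>)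
qed

lemma l2_lim_integral_mult:
  "l2_lim M f F \<Longrightarrow> in_L2 M g \<Longrightarrow> (\<lambda>n. LINT z|M. f n z * g z) \<longlonglongrightarrow> (LINT z|M. F z * g z)"
  by (rule tendsto_integral_mult) (auto simp: l2_lim_def)

lemma l2_lim_zero_unique:
  assumes "l2_lim M (\<lambda>n z. 0) F"
  shows "AE z in M. F z = 0"
proof (rule nsq_eq_0)
  have "(\<lambda>n. nsq M (\<lambda>z. 0 - F z)) \<longlonglongrightarrow> 0" using assms by (simp add: l2_lim_def)
  then show "nsq M F = 0" by (simp add: nsq_def LIMSEQ_const_iff)
qed (use assms in \<open>simp add: l2_lim_def\<close>)

text \<open>The factor 4 is the price of using the triangle inequality with factor 2 twice, once to
  replace \<open>F\<close> by \<open>f n\<close> and once to replace \<open>g n\<close> by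
  \<open>G\<close>.\<close>

lemma l2_lim_nsq_le:
  assumes "l2_lim M f F" "l2_lim M g G" and "\<And>n. nsq M (f n) \<le> K * nsq M (g n)" "K \<ge> 0"
  shows "nsq M F \<le> 4 * K * nsq M G"
proof (rule LIMSEQ_le_const)
  have "(\<lambda>n. 2 * (K * (2 * nsq M G + 2 * nsq M (\<lambda>z. g n z - G z))) + 2 * nsq M (\<lambda>z. f n z - F z))
     \<longlonglongrightarrow> 2 * (K * (2 * nsq M G + 2 * 0)) + 2 * 0"
    using assms by (intro tendsto_intros) (auto simp: l2_lim_def)
  then show "(\<lambda>n. 2 * (K * (2 * nsq M G + 2 * nsq M (\<lambda>z. g n z - G z)))
      + 2 * nsq M (\<lambda>z. f n z - F z))
     \<longlonglongrightarrow> 4 * K * nsq M G" by (simp add: algebra_simps)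
  have "nsq M F \<le> 2 * (K * (2 * nsq M G + 2 * nsq M (\<lambda>z. g n z - G z)))
      + 2 * nsq M (\<lambda>z. f n z - F z)" for n
  proof -
    have "nsq M F \<le> 2 * nsq M (f n) + 2 * nsq M (\<lambda>z. f n z - F z)"
      using nsq_triangle[of M F "f n"] assms(1) by (simp add: l2_lim_def nsq_minus_commute)
    also have "nsq M (f n) \<le> K * nsq M (g n)" by (rule assms)
    also have "nsq M (g n) \<le> 2 * nsq M G + 2 * nsq M (\<lambda>z. g n z - G z)"
      using nsq_triangle[of M "g n" G] assms(2) by (simp add: l2_lim_def)
    finally show ?thesis using assms(4) by (simp add: mult_left_mono)
  qed
  then show "\<exists>N. \<forall>n\<ge>N. nsq M F \<le> 2 * (K * (2 * nsq M G + 2 * nsq M (\<lambda>z. g n z - G z)))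
      + 2 * nsq M (\<lambda>z. f n z - F z)"
    by blast
qed

lemma in_L2_mult_bounded:
  assumes "in_L2 M f" "c \<in> borel_measurable M" "AE z in M. \<bar>c z\<bar> \<le> B"
  shows "in_L2 M (\<lambda>z. c z * f z)" "nsq M (\<lambda>z. c z * f z) \<le> B^2 * nsq M f"
proof -
  have B: "AE z in M. \<bar>c z * f z\<bar> \<le> \<bar>B * f z\<bar>"
    using assms(3) by eventually_elim (auto simp: abs_mult intro!: mult_right_mono)
  have m: "(\<lambda>z. c z * f z) \<in> borel_measurable M"
    using assms by (auto simp: in_L2_def)
  show "in_L2 M (\<lambda>z. c z * f z)"
    by (rule in_L2_dominated[OF in_L2_cmult[OF assms(1)] m B])
  show "nsq M (\<lambda>z. c z * f z) \<le> B^2 * nsq M f"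
    using nsq_mono[OF in_L2_cmult[OF assms(1)] m B] by (simp add: nsq_cmult)
qed

lemma l2_lim_mult_bounded:
  assumes "l2_lim M f F" "c \<in> borel_measurable M" "AE z in M. \<bar>c z\<bar> \<le> B"
  shows "l2_lim M (\<lambda>n z. c z * f n z) (\<lambda>z. c z * F z)"
  unfolding l2_lim_def
proof (intro conjI allI)
  note s = l2_lim_in_L2[OF assms(1)]
  show "in_L2 M (\<lambda>z. c z * f n z)" "in_L2 M (\<lambda>z. c z * F z)" for n
    by (intro in_L2_mult_bounded(1)[OF _ assms(2,3)] s)+
  have le: "nsq M (\<lambda>z. c z * f n z - c z * F z) \<le> B^2 * nsq M (\<lambda>z. f n z - F z)" for n
    unfolding right_diff_distrib[symmetric]
    by (rule in_L2_mult_bounded(2)[OF in_L2_diff[OF s] assms(2,3)])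
  have "(\<lambda>n. B^2 * nsq M (\<lambda>z. f n z - F z)) \<longlonglongrightarrow> B^2 * 0"
    using assms by (intro tendsto_intros) (auto simp: l2_lim_def)
  then have l: "(\<lambda>n. B^2 * nsq M (\<lambda>z. f n z - F z)) \<longlonglongrightarrow> 0" by simp
  show "(\<lambda>n. nsq M (\<lambda>z. c z * f n z - c z * F z)) \<longlonglongrightarrow> 0"
    by (rule tendsto_sandwich[OF _ _ tendsto_const l]) (use le in auto)
qed

section \<open>Test functions, uniqueness and closedness of weak derivatives\<close>

lemma L2_on_cyl: "L2_on (cyl T) w \<longleftrightarrow> in_L2 (cylm T) w"
proof -
  have "w \<in> borel_measurable (cylm T) \<longleftrightarrow> (\<lambda>z. indicator (cyl T) z * w z) \<in> borel_measurable lebesgue"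
    by (subst borel_measurable_restrict_space_iff) auto
  moreover have "integrable (cylm T) (\<lambda>z. (w z)^2) \<longleftrightarrow> set_integrable lebesgue (cyl T) (\<lambda>z. (w z)^2)"
    unfolding set_integrable_def by (subst integrable_restrict_space) auto
  ultimately show ?thesis by (simp add: L2_on_def in_L2_def)
qed

lemma sq_int_cyl: "sq_int (cyl T) w = nsq (cylm T) w"
  by (simp add: sq_int_def nsq_def set_integral_cylm)

abbreviation wdc :: "real \<Rightarrow> (real \<times> (real^'d) \<Rightarrow> real) \<Rightarrow> real \<times> (real^'d) \<Rightarrow> (real \<times> (real^'d) \<Rightarrow> real)
    \<Rightarrow> bool" where
  "wdc T \<equiv> weak_deriv_on (cyl T) (st_test T)"

lemma wdc_iff: "wdc T w v g \<longleftrightarrow> in_L2 (cylm T) w \<and> in_L2 (cylm T) g \<and>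
   (\<forall>\<psi>. st_test T \<psi> \<longrightarrow> (LINT z|cylm T. w z * pd \<psi> v z) = - (LINT z|cylm T. g z * \<psi> z))"
  by (simp add: weak_deriv_on_def L2_on_cyl set_integral_cylm pd_def)

lemma smooth_in_L2: "smooth_fun \<psi> \<Longrightarrow> in_L2 (cylm T) \<psi>"
  by (intro continuous_in_L2_cylm smooth_fun_continuous)

lemma st_test_in_L2:
  "st_test T \<psi> \<Longrightarrow> in_L2 (cylm T) \<psi>" "st_test T \<psi> \<Longrightarrow> in_L2 (cylm T) (pd \<psi> v)"
  by (auto simp: st_test_def intro: smooth_in_L2 smooth_fun_pd)

lemma trig_sum_st_test:
  assumes "trig_sum (cpt_prof T) \<psi>"
  shows "st_test T \<psi>"
proof -
  obtain a where a: "a > 0" "\<And>z. fst z \<le> a \<Longrightarrow> \<psi> z = 0"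
    using trig_sum_left_vanish[OF trig_sum_mono[OF assms, of left_prof]]
      by (auto simp: cpt_prof_def)
  obtain b where b: "b < T" "\<And>z. fst z \<ge> b \<Longrightarrow> \<psi> z = 0"
    using trig_sum_right_vanish[OF trig_sum_mono[OF assms, of "right_prof T"]]
      by (auto simp: cpt_prof_def)
  have "\<exists>a b. 0 < a \<and> b < T \<and> (\<forall>t x. t < a \<or> b < t \<longrightarrow> \<psi> (t, x) = 0)"
    by (rule exI[of _ a], rule exI[of _ b]) (use a b in auto)
  then show ?thesis
    using cpt_prof.trig_sum_periodic_smooth[OF assms] by (simp add: st_test_def periodic_smooth_def)
qed

lemma trig_sum_l2_lim:
  assumes T: "T > 0" and h: "in_L2 (cylm T) h"
  obtains g where "\<And>n. trig_sum (cpt_prof T) (g n)" "l2_lim (cylm T) g h"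
proof -
  have "\<exists>g. trig_sum (cpt_prof T) g \<and> nsq (cylm T) (\<lambda>z. h z - g z) < 1 / real (Suc n)" for n
    using trig_sum_dense[OF T h] by (simp add: approximable_def)
  then obtain g where g: "\<And>n. trig_sum (cpt_prof T) (g n)" "\<And>n. nsq (cylm T) (\<lambda>z. h z - g n z)
      < 1 / real (Suc n)" by metis
  have "l2_lim (cylm T) g h"
    unfolding l2_lim_def
  proof (intro conjI allI h)
    show "in_L2 (cylm T) (g n)" for n by (rule trig_sum_in_L2[OF cpt_prof.trig_sum_Cinf[OF g(1)]])
    show "(\<lambda>n. nsq (cylm T) (\<lambda>z. g n z - h z)) \<longlonglongrightarrow> 0"
      by (rule tendsto_sandwich[OF _ _ tendsto_const LIMSEQ_inverse_real_of_nat])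
         (use g(2) in \<open>auto simp: nsq_minus_commute[of _ _ h] inverse_eq_divide intro!:
             less_imp_le always_eventually\<close>)
  qed
  with g(1) show ?thesis by (rule that)
qed

text \<open>Approximating \<open>h\<close> itself by test functions makes the vanishing pairings
  converge to \<open>nsq (cylm T) h\<close>.\<close>

lemma orthogonal_imp_zero:
  assumes T: "T > 0" and h: "in_L2 (cylm T) h"
    and o: "\<And>\<psi>. trig_sum (cpt_prof T) \<psi> \<Longrightarrow> (LINT z|cylm T. h z * \<psi> z) = 0"
  shows "AE z in cylm T. h z = 0"
proof (rule nsq_eq_0[OF h])
  obtain g where g: "\<And>n. trig_sum (cpt_prof T) (g n)" "l2_lim (cylm T) g h"
    by (rule trig_sum_l2_lim[OF T h]) blast
  from l2_lim_integral_mult[OF g(2) h] have "(\<lambda>n. 0) \<longlonglongrightarrow> (LINT z|cylm T. h z * h z)"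
    using o[OF g(1)] by (simp add: mult.commute)
  then show "nsq (cylm T) h = 0" by (simp add: LIMSEQ_const_iff nsq_def power2_eq_square)
qed

lemma wdc_unique:
  fixes w :: "real \<times> (real^'d) \<Rightarrow> real"
  assumes T: "T > 0" and "wdc T w v g" "wdc T w v g'"
  shows "AE z in cylm T. g z = g' z"
proof -
  have s: "in_L2 (cylm T) g" "in_L2 (cylm T) g'" using assms by (auto simp: wdc_iff)
  have "AE z in cylm T. g z - g' z = 0"
  proof (rule orthogonal_imp_zero[OF T in_L2_diff[OF s]])
    fix \<psi> :: "real \<times> (real^'d) \<Rightarrow> real" assume \<psi>: "trig_sum (cpt_prof T) \<psi>"
    note t = trig_sum_st_test[OF \<psi>]
    have "(LINT z|cylm T. (g z - g' z) * \<psi> z) = (LINT z|cylm T. g z * \<psi> z)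
        - (LINT z|cylm T. g' z * \<psi> z)"
      unfolding left_diff_distrib
      by (intro Bochner_Integration.integral_diff in_L2_mult s st_test_in_L2 t)
    moreover have "(LINT z|cylm T. w z * pd \<psi> v z) = - (LINT z|cylm T. g z * \<psi> z)"
      "(LINT z|cylm T. w z * pd \<psi> v z) = - (LINT z|cylm T. g' z * \<psi> z)"
      using assms(2,3) t by (simp_all add: wdc_iff)
    ultimately show "(LINT z|cylm T. (g z - g' z) * \<psi> z) = 0" by simp
  qed
  then show ?thesis by simp
qed

text \<open>\<open>dX\<close> is a Hilbert choice, determined almost everywhere since test functions are dense.\<close>
lemma wdc_dX:
  assumes T: "T > 0" and "wdc T w v g"
  shows "wdc T w v (dX T w v)" "AE z in cylm T. dX T w v z = g z"
proof -
  show *: "wdc T w v (dX T w v)" unfolding dX_def wd_on_def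
    by (rule someI[of "wdc T w v", OF assms(2)])
  show "AE z in cylm T. dX T w v z = g z" by (rule wdc_unique[OF T * assms(2)])
qed

lemma wdc_cong:
  fixes v :: "real \<times> (real^'d)"
  assumes "wdc T w v g" and w': "w' \<in> borel_measurable (cylm T)" "AE z in cylm T. w z = w' z"
    and g': "g' \<in> borel_measurable (cylm T)" "AE z in cylm T. g z = g' z"
  shows "wdc T w' v g'"
proof -
  have s: "in_L2 (cylm T) w" "in_L2 (cylm T) g" using assms by (auto simp: wdc_iff)
  show ?thesis
    unfolding wdc_iff
  proof (intro conjI allI impI)
    show "in_L2 (cylm T) w'" "in_L2 (cylm T) g'"
      by (rule in_L2_cong_AE[OF s(1) w'] in_L2_cong_AE[OF s(2) g'])+
    fix \<psi> :: "real \<times> (real^'d) \<Rightarrow> real" assume t: "st_test T \<psi>"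
    note t' = st_test_in_L2[OF t, THEN in_L2_measurable]
    note s' = s[THEN in_L2_measurable]
    have "(LINT z|cylm T. w' z * pd \<psi> v z) = (LINT z|cylm T. w z * pd \<psi> v z)"
      using w'(2) by (intro integral_cong_AE borel_measurable_times w' s' t') auto
    moreover have "(LINT z|cylm T. g' z * \<psi> z) = (LINT z|cylm T. g z * \<psi> z)"
      using g'(2) by (intro integral_cong_AE borel_measurable_times g' s' t') auto
    moreover have "(LINT z|cylm T. w z * pd \<psi> v z) = - (LINT z|cylm T. g z * \<psi> z)"
      using assms(1) t by (simp add: wdc_iff)
    ultimately show "(LINT z|cylm T. w' z * pd \<psi> v z) = - (LINT z|cylm T. g' z * \<psi> z)"
      by simp
  qed
qed

text \<open>Weak differentiation is a closed operator: both sides of the defining identity are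
  continuous in L2. This carries derivatives of smooth approximate solutions over to their
  limit.\<close>

lemma wdc_lim:
  fixes v :: "real \<times> (real^'d)"
  assumes "\<And>n. wdc T (w n) v (g n)" "l2_lim (cylm T) w W" "l2_lim (cylm T) g G"
  shows "wdc T W v G"
  unfolding wdc_iff
proof (intro conjI allI impI)
  show "in_L2 (cylm T) W" "in_L2 (cylm T) G" using assms by (auto simp: l2_lim_def)
  fix \<psi> :: "real \<times> (real^'d) \<Rightarrow> real" assume t: "st_test T \<psi>"
  have "(\<lambda>n. LINT z|cylm T. w n z * pd \<psi> v z) \<longlonglongrightarrow> (LINT z|cylm T. W z * pd \<psi> v z)"
    by (intro l2_lim_integral_mult assms st_test_in_L2 t)
  moreover have "(\<lambda>n. - (LINT z|cylm T. g n z * \<psi> z)) \<longlonglongrightarrow> - (LINT z|cylm T. G z * \<psi> z)"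
    by (intro tendsto_minus l2_lim_integral_mult assms st_test_in_L2 t)
  moreover have "(LINT z|cylm T. w n z * pd \<psi> v z) = - (LINT z|cylm T. g n z * \<psi> z)" for n
    using assms(1)[of n] t by (simp add: wdc_iff)
  ultimately show "(LINT z|cylm T. W z * pd \<psi> v z) = - (LINT z|cylm T. G z * \<psi> z)"
    by (simp add: LIMSEQ_unique)
qed

lemma integral_lin_mult:
  assumes "in_L2 M f" "in_L2 M g" "in_L2 M h"
  shows "(LINT z|M. (a * f z + b * g z) * h z) = a * (LINT z|M. f z * h z)
      + b * (LINT z|M. g z * h z)"
proof -
  have "(LINT z|M. (a * f z + b * g z) * h z) = (LINT z|M. a * (f z * h z) + b * (g z * h z))"
    by (simp add: algebra_simps)
  also have "\<dots> = (LINT z|M. a * (f z * h z)) + (LINT z|M. b * (g z * h z))"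
    by (intro Bochner_Integration.integral_add integrable_mult_right in_L2_mult assms)
  finally show ?thesis by simp
qed

lemma in_L2_lin:
  "in_L2 M f \<Longrightarrow> in_L2 M g \<Longrightarrow> in_L2 M (\<lambda>z. a * f z + b * g z)"
  by (intro in_L2_add in_L2_cmult)

lemma wdc_lin:
  assumes "wdc T w v g" "wdc T w' v g'"
  shows "wdc T (\<lambda>z. a * w z + b * w' z) v (\<lambda>z. a * g z + b * g' z)"
  using assms unfolding wdc_iff
  by (auto simp: integral_lin_mult st_test_in_L2 in_L2_lin)

lemma wdc_smooth:
  fixes w :: "real \<times> (real^'d) \<Rightarrow> real"
  assumes w: "trig_sum Cinf w" and v: "v = e_t \<or> v = e_x i"
  shows "wdc T w v (pd w v)"
  unfolding wdc_iff
proof (intro conjI allI impI)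
  note sw = Cinf.trig_sum_smooth[OF w]
  show "in_L2 (cylm T) w" "in_L2 (cylm T) (pd w v)"
    by (intro trig_sum_in_L2 Cinf.trig_sum_pd w)+
  fix \<psi> :: "real \<times> (real^'d) \<Rightarrow> real" assume t: "st_test T \<psi>"
  then have s: "smooth_fun \<psi>" and ps: "periodic_smooth \<psi>"
    by (auto simp: st_test_def periodic_smooth_def)
  obtain a b where ab: "0 < a" "b < T" "\<And>t x. t < a \<or> b < t \<Longrightarrow> \<psi> (t, x) = 0" using t
    unfolding st_test_def by blast
  have "(LINT z|cylm T. pd w v z * \<psi> z) = - (LINT z|cylm T. w z * pd \<psi> v z)"
    using v
  proof
    assume v: "v = e_t"
    have 0: "\<psi> z = 0" if "fst z \<le> a/2 \<or> b < fst z" for z using ab(1) ab(3)[of "fst z" "snd z"] that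
      by auto
    show ?thesis
      unfolding v by (rule integral_by_parts_time[OF sw s, of "a/2" b]) (use ab 0 in auto)
  next
    assume v: "v = e_x i"
    show ?thesis unfolding v by (rule integral_by_parts_space[OF Cinf.trig_sum_periodic_smooth[OF w]
        ps])
  qed
  then show "(LINT z|cylm T. w z * pd \<psi> v z) = - (LINT z|cylm T. pd w v z * \<psi> z)" by simp
qed

text \<open>Explicit witnesses for all derivatives that enter the norm. Computing with witnesses
  avoids the chosen derivatives \<open>dX\<close>, which need not respect sums or limits pointwise;
  the norm and the Laplacian are recovered from any witnesses by almost everywhere
  uniqueness.\<close>

definition xdata :: "real \<Rightarrow> (real \<times> (real^'d) \<Rightarrow> real) \<Rightarrow> (real \<times> (real^'d) \<Rightarrow> real) \<Rightarrow>
    ('d \<Rightarrow> real \<times> (real^'d) \<Rightarrow> real) \<Rightarrow> ('d \<Rightarrow> 'd \<Rightarrow> real \<times> (real^'d) \<Rightarrow> real) \<Rightarrow> bool" where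
  "xdata T w wt wx wxx \<longleftrightarrow> wdc T w e_t wt \<and> (\<forall>i. wdc T w (e_x i) (wx i))
      \<and> (\<forall>i j. wdc T (wx i) (e_x j) (wxx i j))"

lemma xdata_in_L2:
  assumes "xdata T w wt wx wxx"
  shows "in_L2 (cylm T) w" "in_L2 (cylm T) wt"
    "in_L2 (cylm T) (wx i)" "in_L2 (cylm T) (wxx i j)"
  using assms by (auto simp: xdata_def wdc_iff)

lemma xdata_in_X:
  assumes T: "T > 0" and x: "xdata T w wt wx wxx"
  shows "in_X T w"
  using x xdata_in_L2(1)[OF x] unfolding xdata_def in_X_def L2_on_cyl by blast

lemma xdata_dX:
  assumes T: "T > 0" and x: "xdata T w wt wx wxx"
  shows "AE z in cylm T. dX T w e_t z = wt z" "AE z in cylm T. dX T w (e_x i) z = wx i z"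
    "AE z in cylm T. dX T (dX T w (e_x i)) (e_x j) z = wxx i j z"
proof -
  have "wdc T w e_t wt" using x by (simp add: xdata_def)
  then show "AE z in cylm T. dX T w e_t z = wt z" by (rule wdc_dX(2)[OF T])
  have i: "wdc T w (e_x i) (wx i)" and ij: "wdc T (wx i) (e_x j) (wxx i j)" using x
    by (auto simp: xdata_def)
  show *: "AE z in cylm T. dX T w (e_x i) z = wx i z" by (rule wdc_dX(2)[OF T i])
  have "in_L2 (cylm T) (dX T w (e_x i))" using wdc_dX(1)[OF T i] by (simp add: wdc_iff)
  \<comment> \<open>The outer \<open>dX\<close> differentiates the chosen first derivative, not the
    witness \<open>wx i\<close>. The two agree almost everywhere, so they share their weak
    derivatives.\<close>
  then have "wdc T (dX T w (e_x i)) (e_x j) (wxx i j)"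
    using * in_L2_measurable xdata_in_L2(4)[OF x]
    by (intro wdc_cong[OF ij]) auto
  then show "AE z in cylm T. dX T (dX T w (e_x i)) (e_x j) z = wxx i j z" by (rule wdc_dX(2)[OF T])
qed

lemma in_X_xdata:
  assumes T: "T > 0" and u: "in_X T u"
  shows "xdata T u (dX T u e_t) (\<lambda>i. dX T u (e_x i)) (\<lambda>i j. dX T (dX T u (e_x i)) (e_x j))"
proof -
  have "\<forall>i. \<exists>g. wdc T u (e_x i) g \<and> (\<forall>j. \<exists>h. wdc T g (e_x j) h)" "\<exists>wt. wdc T u e_t wt" using u
    unfolding in_X_def by auto
  then obtain wt wx where "wdc T u e_t wt" "\<And>i. wdc T u (e_x i) (wx i)
      \<and> (\<forall>j. \<exists>h. wdc T (wx i) (e_x j) h)" by metis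
  then obtain wxx where "xdata T u wt wx wxx" unfolding xdata_def by metis
  note x = this
  have i: "wdc T u (e_x i) (wx i)" and ij: "wdc T (wx i) (e_x j) (wxx i j)" for i j using x
    by (auto simp: xdata_def)
  have "wdc T u e_t wt" using x by (simp add: xdata_def)
  then have "wdc T u e_t (dX T u e_t)" by (rule wdc_dX(1)[OF T])
  moreover have dx: "wdc T u (e_x i) (dX T u (e_x i))" for i by (rule wdc_dX(1)[OF T i])
  moreover have "wdc T (dX T u (e_x i)) (e_x j) (dX T (dX T u (e_x i)) (e_x j))" for i j
  proof (rule wdc_dX(1)[OF T])
    have "AE z in cylm T. wx i z = dX T u (e_x i) z"
      using xdata_dX(2)[OF T x, of i] by eventually_elim simp
    then show "wdc T (dX T u (e_x i)) (e_x j) (wxx i j)"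
      using dx[of i] xdata_in_L2(4)[OF x] in_L2_measurable
      by (intro wdc_cong[OF ij]) (auto simp: wdc_iff)
  qed
  ultimately show ?thesis by (simp add: xdata_def)
qed

lemma xdata_Xnorm:
  assumes T: "T > 0" and x: "xdata T w wt wx wxx"
  shows "Xnorm T w = sqrt (nsq (cylm T) w + nsq (cylm T) wt + (\<Sum>i\<in>UNIV. nsq (cylm T) (wx i))
     + (\<Sum>i\<in>UNIV. \<Sum>j\<in>UNIV. nsq (cylm T) (wxx i j)))"
proof -
  note y = in_X_xdata[OF T xdata_in_X[OF T x]]
  have "nsq (cylm T) (dX T w e_t) = nsq (cylm T) wt"
    "nsq (cylm T) (dX T w (e_x i)) = nsq (cylm T) (wx i)"
    "nsq (cylm T) (dX T (dX T w (e_x i)) (e_x j)) = nsq (cylm T) (wxx i j)" for i j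
    by (intro nsq_cong_AE xdata_dX[OF T x] in_L2_measurable xdata_in_L2[OF x] xdata_in_L2[OF y])+
  then show ?thesis by (simp add: Xnorm_def sq_int_cyl)
qed

lemma xdata_lap:
  assumes T: "T > 0" and x: "xdata T w wt wx wxx"
  shows "AE z in cylm T. lap T w z = (\<Sum>i\<in>UNIV. wxx i i z)"
proof -
  have "AE z in cylm T. \<forall>i\<in>UNIV. dX T (dX T w (e_x i)) (e_x i) z = wxx i i z"
    using xdata_dX(3)[OF T x] by (subst AE_finite_all) auto
  then show ?thesis by eventually_elim (simp add: lap_def)
qed

lemma xdata_lin:
  assumes "xdata T w wt wx wxx" "xdata T v vt vx vxx"
  shows "xdata T (\<lambda>z. a * w z + b * v z) (\<lambda>z. a * wt z + b * vt z) (\<lambda>i z. a * wx i z + b * vx i z)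
    (\<lambda>i j z. a * wxx i j z + b * vxx i j z)"
  using assms by (auto simp: xdata_def wdc_lin)

lemma xdata_cong:
  assumes "xdata T w wt wx wxx" "w' \<in> borel_measurable (cylm T)" "AE z in cylm T. w z = w' z"
  shows "xdata T w' wt wx wxx"
  using assms xdata_in_L2[OF assms(1)] unfolding xdata_def
  by (auto intro!: wdc_cong[OF _ assms(2,3)] in_L2_measurable)

section \<open>The linear heat problem\<close>

text \<open>Strong solvability with zero initial value for a source that is a fixed function of the
  space-time point. Even when the source is built from \<open>w\<close>, it is treated as given;
  this makes the notion linear in the pair of source and solution.\<close>

definition heat_data :: "real \<Rightarrow> (real \<times> (real^'d) \<Rightarrow> real) \<Rightarrow> (real \<times> (real^'d) \<Rightarrow> real) \<Rightarrow> bool" where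
  "heat_data T f w \<longleftrightarrow> (\<exists>wt wx wxx. xdata T w wt wx wxx \<and> (AE z in cylm T. wt z - (\<Sum>i\<in>UNIV. wxx i i z)
      = f z)
     \<and> (\<forall>\<psi>. init_test T \<psi> \<longrightarrow> (LINT z|cylm T. w z * pd \<psi> e_t z + wt z * \<psi> z) = 0))"

lemma init_test_in_L2:
  "init_test T \<psi> \<Longrightarrow> in_L2 (cylm T) \<psi>" "init_test T \<psi> \<Longrightarrow> in_L2 (cylm T) (pd \<psi> v)"
  by (auto simp: init_test_def intro: smooth_in_L2 smooth_fun_pd)

lemma initial_value_iff:
  "initial_value T u \<phi> \<longleftrightarrow> (\<forall>\<psi>. init_test T \<psi> \<longrightarrow>
     (LINT z|cylm T. u z * pd \<psi> e_t z + dX T u e_t z * \<psi> z) = - (LINT x:unit_cube|lebesgue. \<phi> x * \<psi>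
         (0, x)))"
  by (simp add: initial_value_def set_integral_cylm pd_def)

lemma init_lin:
  assumes "in_L2 (cylm T) w" "in_L2 (cylm T) wt" "in_L2 (cylm T) v"
    "in_L2 (cylm T) vt" "init_test T \<psi>"
  shows "(LINT z|cylm T. (a * w z + b * v z) * pd \<psi> e_t z + (a * wt z + b * vt z) * \<psi> z)
    = a * (LINT z|cylm T. w z * pd \<psi> e_t z + wt z * \<psi> z) + b * (LINT z|cylm T. v z * pd \<psi> e_t z + vt
        z * \<psi> z)"
proof -
  note t = init_test_in_L2[OF assms(5)]
  have split: "(LINT z|cylm T. p z * pd \<psi> e_t z + q z * \<psi> z) = (LINT z|cylm T. p z * pd \<psi> e_t z)
      + (LINT z|cylm T. q z * \<psi> z)"
    if "in_L2 (cylm T) p" "in_L2 (cylm T) q" for p q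
    by (intro Bochner_Integration.integral_add in_L2_mult that t)
  show ?thesis
    unfolding split[OF in_L2_lin[OF assms(1,3)] in_L2_lin[OF assms(2,4)]]
      integral_lin_mult[OF assms(1,3) t(2)] integral_lin_mult[OF assms(2,4) t(1)]
          split[OF assms(1,2)] split[OF assms(3,4)]
    by (simp only: distrib_left add_ac)
qed

lemma heat_dataI_in_X:
  assumes T: "T > 0" and "in_X T w" "AE z in cylm T. dX T w e_t z - lap T w z = f z"
    "\<And>\<psi>. init_test T \<psi> \<Longrightarrow> (LINT z|cylm T. w z * pd \<psi> e_t z + dX T w e_t z * \<psi> z) = 0"
  shows "heat_data T f w"
  using in_X_xdata[OF assms(1,2)] assms(3,4) unfolding heat_data_def lap_def by blast

lemma heat_data_strong_sol:
  assumes T: "T > 0"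
  shows "strong_sol T (\<lambda>x. 0) F u \<longleftrightarrow> heat_data T (\<lambda>z. F z (u z)) u"
proof
  assume "strong_sol T (\<lambda>x. 0) F u"
  then show "heat_data T (\<lambda>z. F z (u z)) u"
    by (intro heat_dataI_in_X[OF T]) (auto simp: strong_sol_def AE_cylm initial_value_iff
        set_lebesgue_integral_def)
next
  assume "heat_data T (\<lambda>z. F z (u z)) u"
  then obtain wt wx wxx where x: "xdata T u wt wx wxx"
      and e: "AE z in cylm T. wt z - (\<Sum>i\<in>UNIV. wxx i i z) = F z (u z)"
    and i: "\<And>\<psi>. init_test T \<psi> \<Longrightarrow> (LINT z|cylm T. u z * pd \<psi> e_t z + wt z * \<psi> z) = 0"
      unfolding heat_data_def by blast
  note y = in_X_xdata[OF T xdata_in_X[OF T x]]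
  have "AE z in cylm T. dX T u e_t z - lap T u z = F z (u z)"
    using xdata_dX(1)[OF T x] xdata_lap[OF T x] e by eventually_elim simp
  moreover have "initial_value T u (\<lambda>x. 0)"
    unfolding initial_value_iff
  proof (intro allI impI)
    fix \<psi> :: "real \<times> (real^'a) \<Rightarrow> real" assume t: "init_test T \<psi>"
    have "(LINT z|cylm T. u z * pd \<psi> e_t z + dX T u e_t z * \<psi> z)
        = (LINT z|cylm T. u z * pd \<psi> e_t z + wt z * \<psi> z)"
      using xdata_dX(1)[OF T x]
      by (intro integral_cong_AE borel_measurable_add borel_measurable_times in_L2_measurable
          xdata_in_L2[OF x] xdata_in_L2[OF y] init_test_in_L2[OF t])
         (auto elim!: eventually_mono)
    then show "(LINT z|cylm T. u z * pd \<psi> e_t z + dX T u e_t z * \<psi> z)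
        = - (LINT x:unit_cube|lebesgue. 0 * \<psi> (0, x))"
      using i[OF t] by (simp add: set_lebesgue_integral_def)
  qed
  ultimately show "strong_sol T (\<lambda>x. 0) F u"
    using xdata_in_X[OF T x] by (simp add: strong_sol_def AE_cylm)
qed

lemma heat_data_lin:
  assumes "heat_data T f w" "heat_data T g v"
  shows "heat_data T (\<lambda>z. a * f z + b * g z) (\<lambda>z. a * w z + b * v z)"
proof -
  obtain wt wx wxx where w: "xdata T w wt wx wxx" "AE z in cylm T. wt z - (\<Sum>i\<in>UNIV. wxx i i z)
      = f z"
    "\<And>\<psi>. init_test T \<psi> \<Longrightarrow> (LINT z|cylm T. w z * pd \<psi> e_t z + wt z * \<psi> z) = 0" using assms(1)
      unfolding heat_data_def by blast
  obtain vt vx vxx where v: "xdata T v vt vx vxx" "AE z in cylm T. vt z - (\<Sum>i\<in>UNIV. vxx i i z)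
      = g z"
    "\<And>\<psi>. init_test T \<psi> \<Longrightarrow> (LINT z|cylm T. v z * pd \<psi> e_t z + vt z * \<psi> z) = 0" using assms(2)
      unfolding heat_data_def by blast
  have "AE z in cylm T. (a * wt z + b * vt z) - (\<Sum>i\<in>UNIV. a * wxx i i z + b * vxx i i z) = a * f z
      + b * g z"
    using w(2) v(2)
  proof eventually_elim
    case (elim z)
    then show ?case unfolding sum.distrib sum_distrib_left[symmetric] elim[symmetric]
      by (simp add: algebra_simps)
  qed
  moreover have "(LINT z|cylm T. (a * w z + b * v z) * pd \<psi> e_t z + (a * wt z + b * vt z) * \<psi> z)
      = 0" if "init_test T \<psi>" for \<psi>
    using init_lin[OF xdata_in_L2(1,2)[OF w(1)] xdata_in_L2(1,2)[OF v(1)] that] w(3)[OF that]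
        v(3)[OF that]
    by simp
  ultimately show ?thesis
    using xdata_lin[OF w(1) v(1), of a b] unfolding heat_data_def by blast
qed

lemma heat_data_diff:
  "heat_data T f w \<Longrightarrow> heat_data T g v \<Longrightarrow> heat_data T (\<lambda>z. f z - g z) (\<lambda>z. w z - v z)"
  using heat_data_lin[of T f w g v 1 "-1"] by simp

text \<open>The common initial value \<phi> cancels, so differences of nonlinear solutions fall
  under the linear theory with zero initial value.\<close>

lemma strong_sol_diff:
  assumes T: "T > 0" and u: "strong_sol T \<phi> F u" and v: "strong_sol T \<phi> F' v"
  shows "heat_data T (\<lambda>z. F z (u z) - F' z (v z)) (\<lambda>z. u z - v z)"
proof -
  have xu: "in_X T u" and xv: "in_X T v" using u v by (auto simp: strong_sol_def)
  note yu = in_X_xdata[OF T xu] and yv = in_X_xdata[OF T xv]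
  have x: "xdata T (\<lambda>z. u z - v z) (\<lambda>z. dX T u e_t z - dX T v e_t z) (\<lambda>i z. dX T u (e_x i) z
      - dX T v (e_x i) z)
     (\<lambda>i j z. dX T (dX T u (e_x i)) (e_x j) z - dX T (dX T v (e_x i)) (e_x j) z)"
    using xdata_lin[OF yu yv, of 1 "-1"] by simp
  have "AE z in cylm T. (dX T u e_t z - dX T v e_t z) - (\<Sum>i\<in>UNIV. dX T (dX T u (e_x i)) (e_x i) z
      - dX T (dX T v (e_x i)) (e_x i) z)
     = F z (u z) - F' z (v z)"
  proof -
    have "AE z in cylm T. dX T u e_t z - lap T u z = F z (u z)" "AE z in cylm T. dX T v e_t z
        - lap T v z = F' z (v z)"
      using u v by (auto simp: strong_sol_def AE_cylm)
    then show ?thesis by eventually_elim (simp add: lap_def sum_subtractf)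
  qed
  moreover have "(LINT z|cylm T. (u z - v z) * pd \<psi> e_t z + (dX T u e_t z - dX T v e_t z) * \<psi> z)
      = 0" if "init_test T \<psi>" for \<psi>
  proof -
    have "(LINT z|cylm T. u z * pd \<psi> e_t z + dX T u e_t z * \<psi> z)
        = (LINT z|cylm T. v z * pd \<psi> e_t z + dX T v e_t z * \<psi> z)"
      using u v that by (simp add: strong_sol_def initial_value_iff)
    then show ?thesis
      using init_lin[OF xdata_in_L2(1,2)[OF yu] xdata_in_L2(1,2)[OF yv] that, of 1 "-1"] by simp
  qed
  ultimately show ?thesis unfolding heat_data_def using x by blast
qed

lemma heat_data_cong:
  assumes "heat_data T f w" "AE z in cylm T. f z = g z"
    and "v \<in> borel_measurable (cylm T)" "AE z in cylm T. w z = v z"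
  shows "heat_data T g v"
proof -
  obtain wt wx wxx where w: "xdata T w wt wx wxx" "AE z in cylm T. wt z - (\<Sum>i\<in>UNIV. wxx i i z)
      = f z"
    "\<And>\<psi>. init_test T \<psi> \<Longrightarrow> (LINT z|cylm T. w z * pd \<psi> e_t z + wt z * \<psi> z) = 0" using assms(1)
      unfolding heat_data_def by blast
  have "AE z in cylm T. wt z - (\<Sum>i\<in>UNIV. wxx i i z) = g z" using w(2) assms(2) by eventually_elim
      simp
  moreover have "(LINT z|cylm T. v z * pd \<psi> e_t z + wt z * \<psi> z) = 0" if t: "init_test T \<psi>" for \<psi>
  proof -
    have "(LINT z|cylm T. v z * pd \<psi> e_t z + wt z * \<psi> z)
        = (LINT z|cylm T. w z * pd \<psi> e_t z + wt z * \<psi> z)"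
      using assms(4)
      by (intro integral_cong_AE borel_measurable_add borel_measurable_times assms(3)
          in_L2_measurable
          xdata_in_L2[OF w(1)] init_test_in_L2[OF t]) (auto elim!: eventually_mono)
    then show ?thesis using w(3)[OF t] by simp
  qed
  ultimately show ?thesis unfolding heat_data_def using xdata_cong[OF w(1) assms(3,4)] by blast
qed

lemma heat_data_in_L2:
  assumes "heat_data T f w"
  shows "in_L2 (cylm T) w" "f \<in> borel_measurable (cylm T) \<Longrightarrow> in_L2 (cylm T) f"
proof -
  obtain wt wx wxx where w: "xdata T w wt wx wxx" "AE z in cylm T. wt z - (\<Sum>i\<in>UNIV. wxx i i z)
      = f z"
    using assms(1) unfolding heat_data_def by blast
  note s = xdata_in_L2[OF w(1)]
  show "in_L2 (cylm T) w" by (rule s)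
  assume "f \<in> borel_measurable (cylm T)"
  then show "in_L2 (cylm T) f"
    by (rule in_L2_cong_AE[OF in_L2_diff[OF s(2) in_L2_sum[OF s(4)]] _ w(2)])
qed

section \<open>Exponential time weights and a priori bounds\<close>

lemma pd_time_mult:
  assumes f: "f differentiable (at z)" and c: "\<And>t. (c has_real_derivative c' t) (at t)"
  shows "pd (\<lambda>z. c (fst z) * f z) v z = c (fst z) * pd f v z + fst v * c' (fst z) * f z"
proof (rule pd_eqI)
  have 1: "((\<lambda>z. c (fst z)) has_derivative (\<lambda>v. c' (fst z) * fst v)) (at z)"
    by (rule has_derivative_compose[where f=fst and g=c])
       (use c[unfolded has_field_derivative_def] in \<open>auto intro!: derivative_eq_intros\<close>)
  show "((\<lambda>z. c (fst z) * f z) has_derivative (\<lambda>v. c (fst z) * pd f v z + fst v * c' (fst z) * f z))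
      (at z)"
    by (rule has_derivative_eq_rhs[OF has_derivative_mult[OF 1 has_derivative_pd[OF f]]])
        (auto simp: algebra_simps)
qed

lemma pd_exp_mult:
  assumes "trig_sum Cinf w"
  shows "pd (\<lambda>z. exp (\<mu> * fst z) * w z) v = (\<lambda>z. exp (\<mu> * fst z) * (pd w v z + \<mu> * fst v * w z))"
proof
  fix z
  have "((\<lambda>t. exp (\<mu> * t)) has_real_derivative \<mu> * exp (\<mu> * t)) (at t)" for t
    by (auto intro!: derivative_eq_intros)
  from pd_time_mult[OF Cinf.trig_sum_differentiable[OF assms] this, of v z]
  show "pd (\<lambda>z. exp (\<mu> * fst z) * w z) v z = exp (\<mu> * fst z) * (pd w v z + \<mu> * fst v * w z)"
    by (simp add: algebra_simps)
qed

lemma laplacian_exp_mult: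
  assumes "trig_sum Cinf w"
  shows "laplacian (\<lambda>z. exp (\<mu> * fst z) * w z) = (\<lambda>z. exp (\<mu> * fst z) * laplacian w z)"
  using assms
  by (simp add: laplacian_def fun_eq_iff pd_exp_mult e_x_def Cinf.trig_sum_pd sum_distrib_left)

context profiles begin
lemma trig_sum_exp_mult: "trig_sum P w \<Longrightarrow> trig_sum P (\<lambda>z. exp (\<mu> * fst z) * w z)"
  by (rule trig_sum_mult_time[of P w P "\<lambda>t. exp (\<mu> * t)"]) (auto intro: P_mult Cinf_exp)
end

lemma exp_weight_cylm:
  "(\<lambda>z :: real \<times> (real^'d). exp (\<mu> * fst z)) \<in> borel_measurable (cylm T)"
  "AE z :: real \<times> (real^'d) in cylm T. \<bar>exp (\<mu> * fst z)\<bar> \<le> exp (\<bar>\<mu>\<bar> * T)"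
proof -
  show "(\<lambda>z :: real \<times> (real^'d). exp (\<mu> * fst z)) \<in> borel_measurable (cylm T)"
    by (intro continuous_measurable_cylm continuous_intros)
  show "AE z :: real \<times> (real^'d) in cylm T. \<bar>exp (\<mu> * fst z)\<bar> \<le> exp (\<bar>\<mu>\<bar> * T)"
  proof (rule AE_I2)
    fix z :: "real \<times> (real^'d)" assume "z \<in> space (cylm T)"
    then have "0 < fst z" "fst z < T" by (auto simp: space_restrict_space mem_cyl)
    then have "\<mu> * fst z \<le> \<bar>\<mu>\<bar> * T" by (intro mult_mono) auto
    then show "\<bar>exp (\<mu> * fst z)\<bar> \<le> exp (\<bar>\<mu>\<bar> * T)" by simp
  qed
qed

text \<open>Multiplying \<open>w\<close> by exp(-\<mu> t) adds the zero order term with coefficient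
  \<mu> to the operator, so the energy inequality gains the factor \<open>\<mu>^2\<close> in front
  of the weighted norm of \<open>w\<close>. A large \<mu> later absorbs terms of the source that are
  proportional to \<open>w\<close>.\<close>

lemma heat_energy_weighted:
  fixes w :: "real \<times> (real^'d) \<Rightarrow> real"
  assumes w: "trig_sum left_prof w" and \<mu>: "\<mu> \<ge> 0" and f: "\<And>z. pd w e_t z - laplacian w z = f z"
  shows "\<mu>^2 * nsq (cylm T) (\<lambda>z. exp (- \<mu> * fst z) * w z)
    + 2 * \<mu> * (\<Sum>i\<in>UNIV. nsq (cylm T) (\<lambda>z. exp (- \<mu> * fst z) * pd w (e_x i) z)) \<le> nsq (cylm T)
        (\<lambda>z. exp (- \<mu> * fst z) * f z)"
proof -
  note wC = left_prof.trig_sum_Cinf[OF w]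
  let ?v = "\<lambda>z. exp (- \<mu> * fst z) * w z"
  have v: "trig_sum left_prof ?v" by (rule left_prof.trig_sum_exp_mult[OF w])
  have "pd ?v e_t z - laplacian ?v z + \<mu> * ?v z = exp (- \<mu> * fst z) * f z" for z
    unfolding pd_exp_mult[OF wC] laplacian_exp_mult[OF wC] f[symmetric]
      by (simp add: e_t_def algebra_simps)
  moreover have "pd ?v (e_x i) = (\<lambda>z. exp (- \<mu> * fst z) * pd w (e_x i) z)" for i
    unfolding pd_exp_mult[OF wC] by (simp add: e_x_def)
  ultimately have "nsq (cylm T) (pd ?v e_t) + nsq (cylm T) (laplacian ?v) + \<mu>^2 * nsq (cylm T) ?v
    + 2 * \<mu> * (\<Sum>i\<in>UNIV. nsq (cylm T) (\<lambda>z. exp (- \<mu> * fst z) * pd w (e_x i) z)) \<le> nsq (cylm T)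
        (\<lambda>z. exp (- \<mu> * fst z) * f z)"
    using heat_energy[OF v \<mu>, of T] by simp
  then show ?thesis using nsq_nonneg[of "cylm T" "pd ?v e_t"] nsq_nonneg[of "cylm T" "laplacian ?v"]
    by linarith
qed

lemma nsq_exp_le:
  fixes f :: "real \<times> (real^'d) \<Rightarrow> real"
  assumes "in_L2 (cylm T) f"
  shows "nsq (cylm T) (\<lambda>z. exp (\<mu> * fst z) * f z) \<le> exp (2 * \<bar>\<mu>\<bar> * T) * nsq (cylm T) f"
  using in_L2_mult_bounded(2)[OF assms exp_weight_cylm]
    by (simp add: exp_double[symmetric] mult.assoc)

lemma nsq_exp_neg_le:
  fixes f :: "real \<times> (real^'d) \<Rightarrow> real"
  assumes "in_L2 (cylm T) f" "\<mu> \<ge> 0"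
  shows "nsq (cylm T) (\<lambda>z. exp (- \<mu> * fst z) * f z) \<le> nsq (cylm T) f"
proof -
  have "AE z in cylm T. \<bar>exp (- \<mu> * fst z)\<bar> \<le> 1"
    using assms(2) by (intro AE_I2) (auto simp: space_restrict_space mem_cyl)
  from in_L2_mult_bounded(2)[OF assms(1) exp_weight_cylm(1) this] show ?thesis by simp
qed

lemma nsq_unweight:
  fixes f :: "real \<times> (real^'d) \<Rightarrow> real"
  assumes "in_L2 (cylm T) f" "\<mu> \<ge> 0"
  shows "nsq (cylm T) f \<le> exp (2 * \<mu> * T) * nsq (cylm T) (\<lambda>z. exp (- \<mu> * fst z) * f z)"
proof -
  have "in_L2 (cylm T) (\<lambda>z. exp (- \<mu> * fst z) * f z)"
    by (rule in_L2_mult_bounded(1)[OF assms(1) exp_weight_cylm])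
  from nsq_exp_le[OF this, of \<mu>] show ?thesis
    using assms(2) by (simp add: mult.assoc[symmetric] exp_add[symmetric])
qed

text \<open>The time derivative and the Hessian are bounded by the unweighted energy inequality,
  \<mu> = 0. That inequality says nothing about \<open>w\<close> and its gradient, which are bounded
  with \<mu> = 1; removing the weight costs the factor \<open>exp (2 * T)\<close>.\<close>

lemma heat_smooth_bounds:
  fixes w :: "real \<times> (real^'d) \<Rightarrow> real"
  assumes T: "T > 0" and w: "trig_sum left_prof w" and f: "\<And>z. pd w e_t z - laplacian w z = f z"
  shows "nsq (cylm T) w \<le> exp (2 * T) * nsq (cylm T) f" "nsq (cylm T) (pd w e_t)
      \<le> exp (2 * T) * nsq (cylm T) f"
    "nsq (cylm T) (pd w (e_x i)) \<le> exp (2 * T) * nsq (cylm T) f"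
    "nsq (cylm T) (pd (pd w (e_x i)) (e_x j)) \<le> exp (2 * T) * nsq (cylm T) f"
proof -
  note wC = left_prof.trig_sum_Cinf[OF w]
  note s = trig_sum_in_L2[OF wC] trig_sum_in_L2[OF Cinf.trig_sum_pd[OF wC]]
  have "in_L2 (cylm T) (\<lambda>z. pd w e_t z - laplacian w z)"
    by (intro in_L2_diff s smooth_in_L2 trig_sum_laplacian wC)
  then have sf: "in_L2 (cylm T) f" unfolding f .
  have 1: "nsq (cylm T) (\<lambda>z. exp (- 1 * fst z) * w z)
    + 2 * (\<Sum>i\<in>UNIV. nsq (cylm T) (\<lambda>z. exp (- 1 * fst z) * pd w (e_x i) z)) \<le> nsq (cylm T) f"
    using heat_energy_weighted[OF w _ f, of 1 T] nsq_exp_neg_le[OF sf, of 1] by simp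
  have pos: "0 \<le> (\<Sum>i\<in>UNIV. nsq (cylm T) (\<lambda>z. exp (- 1 * fst z) * pd w (e_x i) z))"
    by (intro sum_nonneg) simp
  have A: "nsq (cylm T) (\<lambda>z. exp (- 1 * fst z) * w z) \<le> nsq (cylm T) f" using 1 pos by linarith
  show "nsq (cylm T) w \<le> exp (2 * T) * nsq (cylm T) f"
    using order_trans[OF nsq_unweight[OF s(1), where \<mu>=1]
        mult_left_mono[OF A, of "exp (2 * 1 * T)"]] by simp
  have "nsq (cylm T) (\<lambda>z. exp (- 1 * fst z) * pd w (e_x i) z)
      \<le> (\<Sum>i\<in>UNIV. nsq (cylm T) (\<lambda>z. exp (- 1 * fst z) * pd w (e_x i) z))"
    by (rule member_le_sum) auto
  then have B: "nsq (cylm T) (\<lambda>z. exp (- 1 * fst z) * pd w (e_x i) z) \<le> nsq (cylm T) f"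
    using 1 pos nsq_nonneg[of "cylm T" "\<lambda>z. exp (- 1 * fst z) * w z"] by linarith
  show "nsq (cylm T) (pd w (e_x i)) \<le> exp (2 * T) * nsq (cylm T) f"
    using order_trans[OF nsq_unweight[OF s(2), where \<mu>=1]
        mult_left_mono[OF B, of "exp (2 * 1 * T)"]] by simp
  have 0: "nsq (cylm T) (pd w e_t) + nsq (cylm T) (laplacian w) \<le> nsq (cylm T) f"
    using heat_energy[OF w, of 0 T] by (simp add: f)
  have K: "nsq (cylm T) f \<le> exp (2 * T) * nsq (cylm T) f"
    using T mult_right_mono[of 1 "exp (2 * T)" "nsq (cylm T) f"] by simp
  show "nsq (cylm T) (pd w e_t) \<le> exp (2 * T) * nsq (cylm T) f"
    using 0 K nsq_nonneg[of "cylm T" "laplacian w"] by linarith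
  have "nsq (cylm T) (pd (pd w (e_x i)) (e_x j))
      \<le> (\<Sum>j\<in>UNIV. nsq (cylm T) (pd (pd w (e_x i)) (e_x j)))"
    by (rule member_le_sum) auto
  also have "\<dots> \<le> (\<Sum>i\<in>UNIV. \<Sum>j\<in>UNIV. nsq (cylm T) (pd (pd w (e_x i)) (e_x j)))"
    by (rule member_le_sum[of i UNIV "\<lambda>i. \<Sum>j\<in>UNIV. nsq (cylm T) (pd (pd w (e_x i)) (e_x j))"])
        (auto intro: sum_nonneg)
  also have "\<dots> = nsq (cylm T) (laplacian w)" by (rule nsq_laplacian[OF wC, symmetric])
  finally show "nsq (cylm T) (pd (pd w (e_x i)) (e_x j)) \<le> exp (2 * T) * nsq (cylm T) f"
    using 0 K nsq_nonneg[of "cylm T" "pd w e_t"] by linarith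
qed

lemma pd_diff_trig_sum:
  assumes "trig_sum Cinf f" "trig_sum Cinf g"
  shows "pd (\<lambda>z. f z - g z) v = (\<lambda>z. pd f v z - pd g v z)"
proof
  fix z
  have "pd (\<lambda>z. f z + - 1 * g z) v z = pd f v z + pd (\<lambda>z. - 1 * g z) v z"
    by (intro pd_add Cinf.trig_sum_differentiable Cinf.trig_sum_cmult assms)
  then show "pd (\<lambda>z. f z - g z) v z = pd f v z - pd g v z"
    using pd_cmult[OF Cinf.trig_sum_differentiable[OF assms(2)], where c="-1" and v=v and z=z] by
        simp
qed

lemma laplacian_diff_trig_sum:
  assumes "trig_sum Cinf f" "trig_sum Cinf g"
  shows "laplacian (\<lambda>z. f z - g z) = (\<lambda>z. laplacian f z - laplacian g z)"
  using assms by (simp add: laplacian_def fun_eq_iff pd_diff_trig_sum Cinf.trig_sum_pd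
      sum_subtractf)

lemma l2_lim_complete:
  assumes "\<And>n. in_L2 M (a n)" "\<And>n. nsq M (\<lambda>z. a (Suc n) z - a n z) \<le> K * (1/8)^n"
  shows "\<exists>A. l2_lim M a A"
proof -
  obtain A where "in_L2 M A" "(\<lambda>n. nsq M (\<lambda>z. a n z - A z)) \<longlonglongrightarrow> 0"
    using in_L2_complete[OF assms] by blast
  then show ?thesis using assms(1) by (auto simp: l2_lim_def)
qed

text \<open>The sources are approximated at the geometric rate demanded by
  \<open>in_L2_complete\<close>. By linearity the a priori bounds apply to differences of
  consecutive smooth solutions, so these and all their derivatives in the norm converge. In the
  constant, 4 comes from passing bounds to the limit, and the bracket counts the terms of the norm.
  The weighted estimate is part of the conclusion because it has to be inherited from the same
  approximation.\<close>

lemma heat_exists: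
  fixes f :: "real \<times> (real^'d) \<Rightarrow> real"
  assumes T: "T > 0" and f: "in_L2 (cylm T) f"
  shows "\<exists>w. heat_data T f w \<and> (Xnorm T w)^2
      \<le> (4 * exp (2 * T) * (2 + real CARD('d) + real CARD('d)^2)) * nsq (cylm T) f
    \<and> (\<forall>\<mu>>0. \<mu>^2 * nsq (cylm T) (\<lambda>z. exp (- \<mu> * fst z) * w z) \<le> 4 * nsq (cylm T)
        (\<lambda>z. exp (- \<mu> * fst z) * f z))"
proof -
  have "\<exists>g. trig_sum (cpt_prof T) g \<and> nsq (cylm T) (\<lambda>z. f z - g z) < (1/8)^n" for n :: nat
    using trig_sum_dense[OF T f] by (simp add: approximable_def)
  then obtain g where g: "\<And>n. trig_sum (cpt_prof T) (g n)" "\<And>n::nat. nsq (cylm T) (\<lambda>z. f z - g n z)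
      < (1/8)^n" by metis
  have "\<exists>w. trig_sum left_prof w \<and> (\<forall>z. pd w e_t z - laplacian w z = g n z)" for n
    by (rule heat_forward[OF trig_sum_mono[OF g(1)]]) (simp add: cpt_prof_def)
  then obtain w where w: "\<And>n. trig_sum left_prof (w n)" "\<And>n z. pd (w n) e_t z - laplacian (w n) z
      = g n z" by metis
  note wC = left_prof.trig_sum_Cinf[OF w(1)]
  note sg = trig_sum_in_L2[OF cpt_prof.trig_sum_Cinf[OF g(1)]]
  note s = trig_sum_in_L2[OF wC] trig_sum_in_L2[OF Cinf.trig_sum_pd[OF wC]]
    trig_sum_in_L2[OF Cinf.trig_sum_pd[OF Cinf.trig_sum_pd[OF wC]]]
  have limg: "l2_lim (cylm T) g f"
    unfolding l2_lim_def
  proof (intro conjI allI f sg)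
    have l: "(\<lambda>n. (1/8::real)^n) \<longlonglongrightarrow> 0" by (rule LIMSEQ_realpow_zero) auto
    show "(\<lambda>n. nsq (cylm T) (\<lambda>z. g n z - f z)) \<longlonglongrightarrow> 0"
      by (rule tendsto_sandwich[OF _ _ tendsto_const l])
         (use g(2) in \<open>auto simp: nsq_minus_commute[of _ _ f] intro!:
             less_imp_le always_eventually\<close>)
  qed
  define K where "K = exp (2 * T)"
  have K: "K \<ge> 0" by (simp add: K_def)
  have gd: "nsq (cylm T) (\<lambda>z. g (Suc n) z - g n z) \<le> 4 * (1/8)^n" for n
  proof -
    have "nsq (cylm T) (\<lambda>z. (f z - g n z) - (f z - g (Suc n) z))
        \<le> 2 * nsq (cylm T) (\<lambda>z. f z - g n z) + 2 * nsq (cylm T) (\<lambda>z. f z - g (Suc n) z)"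
      by (intro nsq_diff_le in_L2_diff f sg)
    also have "\<dots> \<le> 2 * (1/8)^n + 2 * (1/8)^Suc n"
      using g(2)[of n] g(2)[of "Suc n"] by linarith
    also have "\<dots> \<le> 4 * (1/8)^n" by simp
    finally show ?thesis by simp
  qed
  have wd: "trig_sum left_prof (\<lambda>z. w (Suc n) z - w n z)" for n by (intro left_prof.trig_sum_diff w)
  have "pd (\<lambda>z. w (Suc n) z - w n z) e_t z - laplacian (\<lambda>z. w (Suc n) z - w n z) z = g (Suc n) z
      - g n z" for n z
    unfolding pd_diff_trig_sum[OF wC wC] laplacian_diff_trig_sum[OF wC wC] w(2)[symmetric] by simp
  note bd = heat_smooth_bounds[OF T wd this, folded K_def]
  have KK: "x \<le> K * nsq (cylm T) (\<lambda>z. g (Suc n) z - g n z) \<Longrightarrow> x \<le> (K * 4) * (1/8)^n" for x n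
    using mult_left_mono[OF gd[of n] K] by (simp add: mult.assoc)
  have "\<exists>W. l2_lim (cylm T) w W"
    by (rule l2_lim_complete[OF s(1)]) (rule KK, rule bd)
  then obtain W where W: "l2_lim (cylm T) w W" ..
  have "\<exists>Wt. l2_lim (cylm T) (\<lambda>n. pd (w n) e_t) Wt"
    by (rule l2_lim_complete[OF s(2)]) (rule KK, use bd(2) in \<open>simp add: pd_diff_trig_sum wC\<close>)
  then obtain Wt where Wt: "l2_lim (cylm T) (\<lambda>n. pd (w n) e_t) Wt" ..
  have "\<exists>Wx. l2_lim (cylm T) (\<lambda>n. pd (w n) (e_x i)) Wx" for i
    by (rule l2_lim_complete[OF s(2)])
        (rule KK, use bd(3)[of _ i] in \<open>simp add: pd_diff_trig_sum wC\<close>)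
  then obtain Wx where Wx: "\<And>i. l2_lim (cylm T) (\<lambda>n. pd (w n) (e_x i)) (Wx i)" by metis
  have "\<exists>Wxx. l2_lim (cylm T) (\<lambda>n. pd (pd (w n) (e_x i)) (e_x j)) Wxx" for i j
    by (rule l2_lim_complete[OF s(3)])
       (rule KK, use bd(4)[of _ i j] in \<open>simp add: pd_diff_trig_sum wC Cinf.trig_sum_pd\<close>)
  then obtain Wxx where Wxx: "\<And>i j. l2_lim (cylm T) (\<lambda>n. pd (pd (w n) (e_x i)) (e_x j)) (Wxx i j)"
    by metis
  have x: "xdata T W Wt Wx Wxx"
    unfolding xdata_def
  proof (intro conjI allI)
    show "wdc T W e_t Wt" by (rule wdc_lim[OF _ W Wt]) (rule wdc_smooth[OF wC], simp)
    show "wdc T W (e_x i) (Wx i)" for i by (rule wdc_lim[OF _ W Wx]) (rule wdc_smooth[OF wC], blast)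
    show "wdc T (Wx i) (e_x j) (Wxx i j)" for i j
      by (rule wdc_lim[OF _ Wx Wxx]) (rule wdc_smooth[OF Cinf.trig_sum_pd[OF wC]], blast)
  qed
  have eq: "AE z in cylm T. Wt z - (\<Sum>i\<in>UNIV. Wxx i i z) = f z"
  proof -
    have "l2_lim (cylm T) (\<lambda>n z. (pd (w n) e_t z - (\<Sum>i\<in>UNIV. pd (pd (w n) (e_x i)) (e_x i) z))
        - g n z)
       (\<lambda>z. (Wt z - (\<Sum>i\<in>UNIV. Wxx i i z)) - f z)"
      by (intro l2_lim_diff l2_lim_sum Wt Wxx limg)
    moreover have "(pd (w n) e_t z - (\<Sum>i\<in>UNIV. pd (pd (w n) (e_x i)) (e_x i) z)) - g n z = 0"
        for n z
      using w(2)[of n z] by (simp add: laplacian_def)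
    ultimately have "l2_lim (cylm T) (\<lambda>n z. 0) (\<lambda>z. (Wt z - (\<Sum>i\<in>UNIV. Wxx i i z)) - f z)" by simp
    from l2_lim_zero_unique[OF this] show ?thesis by eventually_elim simp
  qed
  have ini: "(LINT z|cylm T. W z * pd \<psi> e_t z + Wt z * \<psi> z) = 0" if t: "init_test T \<psi>" for \<psi>
  proof -
    note st = init_test_in_L2[OF t]
    have sm: "smooth_fun \<psi>" using t by (simp add: init_test_def)
    obtain b where b: "b < T" "\<And>t x. b < t \<Longrightarrow> \<psi> (t, x) = 0" using t unfolding init_test_def by blast
    have 0: "(LINT z|cylm T. w n z * pd \<psi> e_t z) + (LINT z|cylm T. pd (w n) e_t z * \<psi> z) = 0" for n
    proof -
      obtain a where a: "a > 0" "\<And>z. fst z \<le> a \<Longrightarrow> w n z = 0" using trig_sum_left_vanish[OF w(1)]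
        by blast
      have "(LINT z|cylm T. pd (w n) e_t z * \<psi> z) = - (LINT z|cylm T. w n z * pd \<psi> e_t z)"
        by (rule integral_by_parts_time[OF Cinf.trig_sum_smooth[OF wC] sm a(1) b(1)])
            (use a b in auto)
      then show ?thesis by simp
    qed
    have "(\<lambda>n. (LINT z|cylm T. w n z * pd \<psi> e_t z) + (LINT z|cylm T. pd (w n) e_t z * \<psi> z))
       \<longlonglongrightarrow> (LINT z|cylm T. W z * pd \<psi> e_t z) + (LINT z|cylm T. Wt z * \<psi> z)"
      by (intro tendsto_add l2_lim_integral_mult W Wt st)
    then have "(LINT z|cylm T. W z * pd \<psi> e_t z) + (LINT z|cylm T. Wt z * \<psi> z) = 0"
      unfolding 0 by (simp add: LIMSEQ_const_iff)
    moreover have "(LINT z|cylm T. W z * pd \<psi> e_t z + Wt z * \<psi> z)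
        = (LINT z|cylm T. W z * pd \<psi> e_t z) + (LINT z|cylm T. Wt z * \<psi> z)"
      by (intro Bochner_Integration.integral_add in_L2_mult st l2_lim_in_L2(2)[OF W]
          l2_lim_in_L2(2)[OF Wt])
    ultimately show ?thesis by simp
  qed
  have hd: "heat_data T f W" unfolding heat_data_def using x eq ini by blast
  have b: "nsq (cylm T) W \<le> 4 * K * nsq (cylm T) f" "nsq (cylm T) Wt \<le> 4 * K * nsq (cylm T) f"
    "nsq (cylm T) (Wx i) \<le> 4 * K * nsq (cylm T) f" "nsq (cylm T) (Wxx i j) \<le> 4 * K * nsq (cylm T) f"
        for i j
    using heat_smooth_bounds[OF T w, folded K_def]
    by (auto intro!: l2_lim_nsq_le[OF W limg _ K] l2_lim_nsq_le[OF Wt limg _ K]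
        l2_lim_nsq_le[OF Wx limg _ K] l2_lim_nsq_le[OF Wxx limg _ K])
  have "(Xnorm T W)^2 = nsq (cylm T) W + nsq (cylm T) Wt + (\<Sum>i\<in>UNIV. nsq (cylm T) (Wx i))
      + (\<Sum>i\<in>UNIV. \<Sum>j\<in>UNIV. nsq (cylm T) (Wxx i j))"
    unfolding xdata_Xnorm[OF T x] by (intro real_sqrt_pow2 add_nonneg_nonneg sum_nonneg nsq_nonneg)
  also have "\<dots> \<le> 4 * K * nsq (cylm T) f + 4 * K * nsq (cylm T) f
      + (\<Sum>i\<in>(UNIV::'d set). 4 * K * nsq (cylm T) f)
     + (\<Sum>i\<in>(UNIV::'d set). \<Sum>j\<in>(UNIV::'d set). 4 * K * nsq (cylm T) f)"
    by (intro add_mono sum_mono b)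
  also have "\<dots> = (4 * K * (2 + real CARD('d) + real CARD('d)^2)) * nsq (cylm T) f"
    by (simp add: algebra_simps power2_eq_square)
  finally have X: "(Xnorm T W)^2 \<le> (4 * K * (2 + real CARD('d) + real CARD('d)^2)) * nsq (cylm T) f"
      .
  have wt: "\<mu>^2 * nsq (cylm T) (\<lambda>z. exp (- \<mu> * fst z) * W z)
      \<le> 4 * nsq (cylm T) (\<lambda>z. exp (- \<mu> * fst z) * f z)" if "\<mu> > 0" for \<mu>
  proof -
    have "nsq (cylm T) (\<lambda>z. \<mu> * (exp (- \<mu> * fst z) * W z))
        \<le> 4 * 1 * nsq (cylm T) (\<lambda>z. exp (- \<mu> * fst z) * f z)"
    proof (rule l2_lim_nsq_le)
      show "l2_lim (cylm T) (\<lambda>n z. \<mu> * (exp (- \<mu> * fst z) * w n z))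
          (\<lambda>z. \<mu> * (exp (- \<mu> * fst z) * W z))"
        by (intro l2_lim_cmult l2_lim_mult_bounded[OF W exp_weight_cylm])
      show "l2_lim (cylm T) (\<lambda>n z. exp (- \<mu> * fst z) * g n z) (\<lambda>z. exp (- \<mu> * fst z) * f z)"
        by (rule l2_lim_mult_bounded[OF limg exp_weight_cylm])
      show "nsq (cylm T) (\<lambda>z. \<mu> * (exp (- \<mu> * fst z) * w n z))
          \<le> 1 * nsq (cylm T) (\<lambda>z. exp (- \<mu> * fst z) * g n z)" for n
      proof -
        have "0 \<le> 2 * \<mu> * (\<Sum>i\<in>UNIV. nsq (cylm T) (\<lambda>z. exp (- \<mu> * fst z) * pd (w n) (e_x i) z))"
          using that by (intro mult_nonneg_nonneg sum_nonneg) auto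
        then show ?thesis
          using heat_energy_weighted[OF w(1)[of n] less_imp_le[OF that] w(2)[of n], where T=T]
            unfolding nsq_cmult by linarith
      qed
    qed simp
    then show ?thesis by (simp add: nsq_cmult)
  qed
  show ?thesis using hd X wt unfolding K_def by blast
qed

section \<open>Duality, uniqueness and pointwise bounds\<close>

text \<open>Vanishes for times up to \<open>1 / (n + 1)\<close> and tends to 1 at every positive
  time.\<close>

definition cutoff :: "nat \<Rightarrow> real \<Rightarrow> real" where
  "cutoff n t = flat_step (real (Suc n) * t - 1)"

lemma Cinf_cutoff: "Cinf (cutoff n)"
  using Cinf_affine[OF Cinf_flat_step, of "real (Suc n)" "- 1"] unfolding cutoff_def by simp

lemma cutoff_cpt_prof: "right_prof T \<eta> \<Longrightarrow> cpt_prof T (\<lambda>t. cutoff n t * \<eta> t)"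
proof -
  assume \<eta>: "right_prof T \<eta>"
  have "Cinf (\<lambda>t. cutoff n t * \<eta> t)" using \<eta> by (intro Cinf_mult Cinf_cutoff)
      (simp add: right_prof_def)
  moreover have "\<forall>t\<le>1 / real (Suc n). cutoff n t * \<eta> t = 0"
    by (auto simp: cutoff_def field_simps intro!: flat_step_bounds)
  moreover have "0 < 1 / real (Suc n)" by simp
  ultimately have "left_prof (\<lambda>t. cutoff n t * \<eta> t)" unfolding left_prof_def by blast
  then show ?thesis using right_prof.P_mult[OF \<eta> Cinf_cutoff] by (simp add: cpt_prof_def)
qed

lemma trig_sum_cutoff: "trig_sum (right_prof T) \<psi> \<Longrightarrow>
    trig_sum (cpt_prof T) (\<lambda>z. cutoff n (fst z) * \<psi> z)"
  by (rule trig_sum_mult_time[where P="right_prof T"]) (auto intro: cutoff_cpt_prof)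

lemma pd_cutoff:
  assumes "trig_sum Cinf \<psi>"
  shows "pd (\<lambda>z. cutoff n (fst z) * \<psi> z) (e_x i) = (\<lambda>z. cutoff n (fst z) * pd \<psi> (e_x i) z)"
proof
  fix z
  obtain c' where c': "\<And>t. (cutoff n has_real_derivative c' t) (at t)"
    using Cinf_obtain_deriv[OF Cinf_cutoff] by blast
  show "pd (\<lambda>z. cutoff n (fst z) * \<psi> z) (e_x i) z = cutoff n (fst z) * pd \<psi> (e_x i) z"
    using pd_time_mult[OF Cinf.trig_sum_differentiable[OF assms] c', of "e_x i" z]
      by (simp add: e_x_def)
qed

lemma cutoff_tendsto_integral:
  fixes h :: "real \<times> (real^'d) \<Rightarrow> real"
  assumes h: "integrable (cylm T) h"
  shows "(\<lambda>n. LINT z|cylm T. cutoff n (fst z) * h z) \<longlonglongrightarrow> (LINT z|cylm T. h z)"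
proof (rule integral_dominated_convergence)
  show "h \<in> borel_measurable (cylm T)" using h by auto
  show "integrable (cylm T) (\<lambda>z. \<bar>h z\<bar>)" using h by simp
  have "(\<lambda>z::real \<times> (real^'d). cutoff n (fst z)) \<in> borel_measurable (cylm T)" for n
    by (intro continuous_measurable_cylm continuous_on_compose2[OF Cinf_continuous[OF Cinf_cutoff]]
        continuous_intros) auto
  then show "(\<lambda>z. cutoff n (fst z) * h z) \<in> borel_measurable (cylm T)" for n
    using h by (intro borel_measurable_times) auto
  show "AE z in cylm T. norm (cutoff n (fst z) * h z) \<le> \<bar>h z\<bar>" for n
    using flat_step_bounds by (intro AE_I2) (auto simp: cutoff_def abs_mult intro!:
        mult_left_le_one_le)
  show "AE z in cylm T. (\<lambda>n. cutoff n (fst z) * h z) \<longlonglongrightarrow> h z"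
  proof (rule AE_I2)
    fix z :: "real \<times> (real^'d)" assume "z \<in> space (cylm T)"
    then have z: "0 < fst z" by (simp add: space_restrict_space mem_cyl)
    have "filterlim (\<lambda>n. - 1 + real (Suc n) * fst z) at_top sequentially"
      by (intro filterlim_tendsto_add_at_top[OF tendsto_const]
          filterlim_at_top_mult_tendsto_pos[OF tendsto_const z]
          filterlim_compose[OF filterlim_real_sequentially filterlim_Suc])
    then have "(\<lambda>n. cutoff n (fst z)) \<longlonglongrightarrow> 1" using flat_step_tendsto by (simp add: cutoff_def)
    from tendsto_mult[OF this tendsto_const[of "h z"]] show "(\<lambda>n. cutoff n (fst z) * h z) \<longlonglongrightarrow> h z" by
        simp
  qed
qed

lemma trig_sum_init_test:
  assumes "trig_sum (right_prof T) \<psi>"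
  shows "init_test T \<psi>"
proof -
  obtain b where "b < T" "\<And>z. fst z \<ge> b \<Longrightarrow> \<psi> z = 0" using trig_sum_right_vanish[OF assms] by blast
  then have "\<exists>b<T. \<forall>t x. b < t \<longrightarrow> \<psi> (t, x) = 0" by (intro exI[of _ b]) auto
  then show ?thesis
    using right_prof.trig_sum_periodic_smooth[OF assms]
      by (simp add: init_test_def periodic_smooth_def)
qed

text \<open>The test function \<open>\<psi>\<close> need not vanish near \<open>t = 0\<close>, while weak derivatives are tested in
  the open time interval; the cutoffs bridge the gap, since spatial derivatives do not see them.\<close>
lemma heat_duality:
  fixes w f :: "real \<times> (real^'d) \<Rightarrow> real"
  assumes hd: "heat_data T f w" and f: "f \<in> borel_measurable (cylm T)"
      and \<psi>: "trig_sum (right_prof T) \<psi>"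
  shows "(LINT z|cylm T. w z * (- pd \<psi> e_t z - laplacian \<psi> z)) = (LINT z|cylm T. f z * \<psi> z)"
proof -
  obtain wt wx wxx where x: "xdata T w wt wx wxx"
      and eq: "AE z in cylm T. wt z - (\<Sum>i\<in>UNIV. wxx i i z) = f z"
    and ini: "\<And>\<psi>. init_test T \<psi> \<Longrightarrow> (LINT z|cylm T. w z * pd \<psi> e_t z + wt z * \<psi> z) = 0" using hd
      unfolding heat_data_def by blast
  note s = xdata_in_L2[OF x]
  note \<psi>C = right_prof.trig_sum_Cinf[OF \<psi>] and p\<psi> = right_prof.trig_sum_pd[OF \<psi>]
  note s\<psi> = trig_sum_in_L2[OF \<psi>C] trig_sum_in_L2[OF Cinf.trig_sum_pd[OF \<psi>C]]
    trig_sum_in_L2[OF Cinf.trig_sum_pd[OF Cinf.trig_sum_pd[OF \<psi>C]]]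
  let ?I = "integral\<^sup>L (cylm T)"
  have t: "?I (\<lambda>z. w z * pd \<psi> e_t z) + ?I (\<lambda>z. wt z * \<psi> z) = 0"
    using ini[OF trig_sum_init_test[OF \<psi>]]
    by (subst (asm) Bochner_Integration.integral_add) (auto intro!: in_L2_mult s s\<psi>)
  have xx: "?I (\<lambda>z. wxx i i z * \<psi> z) = ?I (\<lambda>z. w z * pd (pd \<psi> (e_x i)) (e_x i) z)" for i
  proof -
    have wx: "wdc T w (e_x i) (wx i)" "wdc T (wx i) (e_x i) (wxx i i)" using x
      by (auto simp: xdata_def)
    have "?I (\<lambda>z. cutoff n (fst z) * (wxx i i z * \<psi> z))
        = ?I (\<lambda>z. cutoff n (fst z) * (w z * pd (pd \<psi> (e_x i)) (e_x i) z))" for n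
    proof -
      have "?I (\<lambda>z. wx i z * pd (\<lambda>z. cutoff n (fst z) * \<psi> z) (e_x i) z)
          = - ?I (\<lambda>z. wxx i i z * (cutoff n (fst z) * \<psi> z))"
        using wx(2) trig_sum_st_test[OF trig_sum_cutoff[OF \<psi>]] by (simp add: wdc_iff)
      moreover have "?I (\<lambda>z. w z * pd (\<lambda>z. cutoff n (fst z) * pd \<psi> (e_x i) z) (e_x i) z)
          = - ?I (\<lambda>z. wx i z * (cutoff n (fst z) * pd \<psi> (e_x i) z))"
        using wx(1) trig_sum_st_test[OF trig_sum_cutoff[OF p\<psi>]] by (simp add: wdc_iff)
      ultimately show ?thesis
        unfolding pd_cutoff[OF \<psi>C] pd_cutoff[OF Cinf.trig_sum_pd[OF \<psi>C]] by (simp add: mult_ac)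
    qed
    moreover have "(\<lambda>n. ?I (\<lambda>z. cutoff n (fst z) * (wxx i i z * \<psi> z))) \<longlonglongrightarrow> ?I (\<lambda>z. wxx i i z * \<psi> z)"
      by (intro cutoff_tendsto_integral in_L2_mult s s\<psi>)
    moreover have "(\<lambda>n. ?I (\<lambda>z. cutoff n (fst z) * (w z * pd (pd \<psi> (e_x i)) (e_x i) z)))
        \<longlonglongrightarrow> ?I (\<lambda>z. w z * pd (pd \<psi> (e_x i)) (e_x i) z)"
      by (intro cutoff_tendsto_integral in_L2_mult s s\<psi>)
    ultimately show ?thesis by (simp add: LIMSEQ_unique)
  qed
  have "?I (\<lambda>z. f z * \<psi> z) = ?I (\<lambda>z. wt z * \<psi> z - (\<Sum>i\<in>UNIV. wxx i i z * \<psi> z))"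
  proof (rule integral_cong_AE)
    show "AE z in cylm T. f z * \<psi> z = wt z * \<psi> z - (\<Sum>i\<in>UNIV. wxx i i z * \<psi> z)"
      using eq by eventually_elim (simp add: sum_distrib_right[symmetric]
          left_diff_distrib[symmetric])
  qed (intro borel_measurable_times borel_measurable_diff borel_measurable_sum f in_L2_measurable s
      s\<psi>)+
  also have "\<dots> = ?I (\<lambda>z. wt z * \<psi> z) - (\<Sum>i\<in>UNIV. ?I (\<lambda>z. wxx i i z * \<psi> z))"
    by (subst Bochner_Integration.integral_diff) (auto intro!: in_L2_mult s s\<psi>
        Bochner_Integration.integrable_sum simp: Bochner_Integration.integral_sum in_L2_mult s s\<psi>)
  also have "\<dots> = - ?I (\<lambda>z. w z * pd \<psi> e_t z)
      - (\<Sum>i\<in>UNIV. ?I (\<lambda>z. w z * pd (pd \<psi> (e_x i)) (e_x i) z))"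
    using t unfolding xx by simp
  also have "\<dots> = ?I (\<lambda>z. - (w z * pd \<psi> e_t z) - (\<Sum>i\<in>UNIV. w z * pd (pd \<psi> (e_x i)) (e_x i) z))"
    by (subst Bochner_Integration.integral_diff) (auto intro!: in_L2_mult s s\<psi>
        Bochner_Integration.integrable_sum simp: Bochner_Integration.integral_sum in_L2_mult s s\<psi>)
  finally show ?thesis
    by (simp add: laplacian_def right_diff_distrib sum_distrib_left)
qed

text \<open>The difference solves the problem with zero source. Every compactly supported
  trigonometric sum is the right-hand side of a solvable backward problem, so by duality the
  difference is orthogonal to a dense set.\<close>

lemma heat_unique:
  fixes w v :: "real \<times> (real^'d) \<Rightarrow> real"
  assumes T: "T > 0" and w: "heat_data T f w" and v: "heat_data T g v"
      and fg: "AE z in cylm T. f z = g z"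
  shows "AE z in cylm T. w z = v z"
proof -
  note s = in_L2_diff[OF heat_data_in_L2(1)[OF w] heat_data_in_L2(1)[OF v]]
  have "heat_data T (\<lambda>z. 0) (\<lambda>z. w z - v z)"
    by (rule heat_data_cong[OF heat_data_diff[OF w v] _ in_L2_measurable[OF s]]) (use fg in auto)
  note hd = this
  have "AE z in cylm T. w z - v z = 0"
  proof (rule orthogonal_imp_zero[OF T s])
    fix g :: "real \<times> (real^'d) \<Rightarrow> real" assume "trig_sum (cpt_prof T) g"
    then have "trig_sum (right_prof T) g" by (rule trig_sum_mono) (simp add: cpt_prof_def)
    from heat_backward[OF this] obtain \<psi> where \<psi>: "trig_sum (right_prof T) \<psi>" "\<And>z. - pd \<psi> e_t z
        - laplacian \<psi> z = g z" by blast
    show "(LINT z|cylm T. (w z - v z) * g z) = 0"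
      using heat_duality[OF hd _ \<psi>(1)] by (simp add: \<psi>(2))
  qed
  then show ?thesis by simp
qed

text \<open>The dual of the L1 estimate. If \<psi> solves the backward problem with source
  \<open>g\<close>, then multiplying \<psi> by exp(\<mu> t) adds the term with coefficient \<mu>
  that \<open>heat_L1\<close> needs. The pairing of \<open>w\<close> with \<open>g\<close>, which
  equals the pairing of \<open>f\<close> with \<psi>, is thus at most \<open>B / \<mu>\<close> times
  the weighted L1 norm of \<open>g\<close>.\<close>

lemma heat_sup_bound:
  fixes w f :: "real \<times> (real^'d) \<Rightarrow> real"
  assumes T: "T > 0" and hd: "heat_data T f w" and f: "f \<in> borel_measurable (cylm T)"
    and \<mu>: "\<mu> > 0" and B: "B \<ge> 0" and le: "AE z in cylm T. \<bar>f z\<bar> \<le> B * exp (\<mu> * fst z)"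
  shows "AE z in cylm T. \<bar>w z\<bar> \<le> B / \<mu> * exp (\<mu> * fst z)"
proof -
  let ?I = "integral\<^sup>L (cylm T)"
  define e where "e z = exp (\<mu> * fst z)" for z :: "real \<times> (real^'d)"
  have ce: "continuous_on UNIV e" unfolding e_def by (intro continuous_intros)
  note se = continuous_in_L2_cylm[OF ce]
  note sw = heat_data_in_L2(1)[OF hd] and sf = heat_data_in_L2(2)[OF hd f]
  have abs_s: "in_L2 (cylm T) (\<lambda>z. \<bar>h z\<bar>)" if "in_L2 (cylm T) h" for h
    using that by (auto simp: in_L2_def)
  have trig: "\<bar>?I (\<lambda>z. g z * w z)\<bar> \<le> B / \<mu> * ?I (\<lambda>z. \<bar>g z\<bar> * e z)" if g: "trig_sum (cpt_prof T) g"
      for g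
  proof -
    have "trig_sum (right_prof T) g" by (rule trig_sum_mono[OF g]) (simp add: cpt_prof_def)
    from heat_backward[OF this] obtain \<psi> where \<psi>: "trig_sum (right_prof T) \<psi>" "\<And>z. - pd \<psi> e_t z
        - laplacian \<psi> z = g z" by blast
    note \<psi>C = right_prof.trig_sum_Cinf[OF \<psi>(1)]
    note s\<psi> = trig_sum_in_L2[OF \<psi>C]
    have "?I (\<lambda>z. w z * g z) = ?I (\<lambda>z. f z * \<psi> z)"
      using heat_duality[OF hd f \<psi>(1)] by (simp add: \<psi>(2))
    then have "\<bar>?I (\<lambda>z. g z * w z)\<bar> \<le> ?I (\<lambda>z. \<bar>f z * \<psi> z\<bar>)"
      using integral_abs_bound[of "cylm T" "\<lambda>z. f z * \<psi> z"] by (simp add: mult.commute)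
    also have "\<dots> \<le> ?I (\<lambda>z. B * \<bar>e z * \<psi> z\<bar>)"
    proof (rule integral_mono_AE)
      show "integrable (cylm T) (\<lambda>z. \<bar>f z * \<psi> z\<bar>)" "integrable (cylm T) (\<lambda>z. B * \<bar>e z * \<psi> z\<bar>)"
        by (intro integrable_mult_right integrable_abs in_L2_mult sf s\<psi> se)+
      show "AE z in cylm T. \<bar>f z * \<psi> z\<bar> \<le> B * \<bar>e z * \<psi> z\<bar>"
        using le
      proof eventually_elim
        case (elim z)
        from mult_right_mono[OF this, of "\<bar>\<psi> z\<bar>"] show ?case
          by (simp add: abs_mult e_def mult.assoc)
      qed
    qed
    also have "\<dots> = B * ?I (\<lambda>z. \<bar>e z * \<psi> z\<bar>)" by simp
    also have "\<dots> \<le> B * (?I (\<lambda>z. \<bar>g z\<bar> * e z) / \<mu>)"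
    proof (rule mult_left_mono[OF _ B])
      let ?\<chi> = "\<lambda>z. exp (\<mu> * fst z) * \<psi> z"
      have "- pd ?\<chi> e_t z - laplacian ?\<chi> z + \<mu> * ?\<chi> z = g z * e z" for z
        unfolding pd_exp_mult[OF \<psi>C] laplacian_exp_mult[OF \<psi>C] \<psi>(2)[symmetric]
          by (simp add: e_t_def e_def algebra_simps)
      then have "\<mu> * ?I (\<lambda>z. \<bar>?\<chi> z\<bar>) \<le> ?I (\<lambda>z. \<bar>g z * e z\<bar>)"
        using heat_L1[OF right_prof.trig_sum_exp_mult[OF \<psi>(1)], of \<mu> \<mu>] \<mu> by simp
      then show "?I (\<lambda>z. \<bar>e z * \<psi> z\<bar>) \<le> ?I (\<lambda>z. \<bar>g z\<bar> * e z) / \<mu>"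
        using \<mu> by (simp add: field_simps e_def abs_mult)
    qed
    finally show ?thesis by simp
  qed
  \<comment> \<open>The decisive test function below is a sign times an indicator, so the inequality
    is first extended from trigonometric sums to all of L2.\<close>
  have gen: "\<bar>?I (\<lambda>z. h z * w z)\<bar> \<le> B / \<mu> * ?I (\<lambda>z. \<bar>h z\<bar> * e z)" if h: "in_L2 (cylm T) h" for h
  proof -
    obtain g where g: "\<And>n. trig_sum (cpt_prof T) (g n)" and l: "l2_lim (cylm T) g h"
      by (rule trig_sum_l2_lim[OF T h]) blast
    show ?thesis
    proof (rule LIMSEQ_le)
      show "(\<lambda>n. \<bar>?I (\<lambda>z. g n z * w z)\<bar>) \<longlonglongrightarrow> \<bar>?I (\<lambda>z. h z * w z)\<bar>"
        by (intro tendsto_rabs l2_lim_integral_mult l sw)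
      show "(\<lambda>n. B / \<mu> * ?I (\<lambda>z. \<bar>g n z\<bar> * e z)) \<longlonglongrightarrow> B / \<mu> * ?I (\<lambda>z. \<bar>h z\<bar> * e z)"
        by (intro tendsto_mult tendsto_const l2_lim_integral_mult l2_lim_abs l se)
    qed (use trig[OF g] in auto)
  qed
  define C where "C = B / \<mu>"
  have C: "C \<ge> 0" using B \<mu> by (simp add: C_def)
  have [measurable]: "w \<in> borel_measurable (cylm T)" "e \<in> borel_measurable (cylm T)" using sw se
    by auto
  \<comment> \<open>The sign of \<open>w\<close> on the set where the claimed bound fails. Tested
    with \<open>h\<close>, the inequality says that the excess \<open>k\<close>, a nonnegative
    function, has integral at most 0.\<close>
  define h where "h z = (if C * e z < \<bar>w z\<bar> then sgn (w z) else 0)" for z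
  define k where "k z = (if C * e z < \<bar>w z\<bar> then \<bar>w z\<bar> - C * e z else 0)" for z
  have mh: "h \<in> borel_measurable (cylm T)" unfolding h_def by measurable
  have sh: "in_L2 (cylm T) h"
    by (rule bounded_in_L2_cylm[OF mh, of 1]) (auto simp: h_def sgn_if)
  have e0: "0 < e z" for z by (simp add: e_def)
  have k: "k z = h z * w z - C * (\<bar>h z\<bar> * e z)" for z
    using C mult_nonneg_nonneg[OF C less_imp_le[OF e0[of z]]] unfolding k_def h_def
      by (auto simp: sgn_if)
  have Ik: "integrable (cylm T) k" unfolding k[abs_def]
    by (intro Bochner_Integration.integrable_diff integrable_mult_right in_L2_mult sh sw se abs_s)
  have "?I k = ?I (\<lambda>z. h z * w z) - C * ?I (\<lambda>z. \<bar>h z\<bar> * e z)"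
    unfolding k[abs_def]
    by (subst Bochner_Integration.integral_diff) (auto intro!: integrable_mult_right in_L2_mult sh
        sw se abs_s)
  also have "\<dots> \<le> 0" using gen[OF sh] unfolding C_def by linarith
  finally have "?I k \<le> 0" .
  moreover have "0 \<le> ?I k" by (intro integral_nonneg_AE AE_I2) (simp add: k_def)
  ultimately have "?I k = 0" by linarith
  then have "AE z in cylm T. k z = 0"
    by (subst (asm) integral_nonneg_eq_0_iff_AE[OF Ik]) (auto simp: k_def)
  then show ?thesis
    unfolding C_def[symmetric]
  proof eventually_elim
    case (elim z)
    then show ?case by (cases "C * e z < \<bar>w z\<bar>") (auto simp: k_def e_def)
  qed
qed

section \<open>Estimates of Gronwall type\<close>

lemma Xnorm_cong:
  assumes T: "T > 0" and w: "in_X T w" and v: "v \<in> borel_measurable (cylm T)" "AE z in cylm T. w z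
      = v z"
  shows "Xnorm T v = Xnorm T w"
proof -
  note x = in_X_xdata[OF T w]
  have "nsq (cylm T) w = nsq (cylm T) v"
    by (rule nsq_cong_AE[OF in_L2_measurable[OF xdata_in_L2(1)[OF x]] v])
  then show ?thesis by (simp add: xdata_Xnorm[OF T x] xdata_Xnorm[OF T xdata_cong[OF x v]])
qed

lemma heat_data_in_X: "T > 0 \<Longrightarrow> heat_data T f w \<Longrightarrow> in_X T w"
  unfolding heat_data_def by (blast intro: xdata_in_X)

lemma nsq_le_Xnorm:
  assumes T: "T > 0" and w: "in_X T w"
  shows "nsq (cylm T) w \<le> (Xnorm T w)^2"
proof -
  have "(Xnorm T w)^2 = nsq (cylm T) w + nsq (cylm T) (dX T w e_t)
      + (\<Sum>i\<in>UNIV. nsq (cylm T) (dX T w (e_x i)))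
     + (\<Sum>i\<in>UNIV. \<Sum>j\<in>UNIV. nsq (cylm T) (dX T (dX T w (e_x i)) (e_x j)))"
    unfolding Xnorm_def sq_int_cyl by (intro real_sqrt_pow2 add_nonneg_nonneg sum_nonneg nsq_nonneg)
  moreover have "0 \<le> (\<Sum>i\<in>UNIV. nsq (cylm T) (dX T w (e_x i)))"
      "0 \<le> (\<Sum>i\<in>UNIV. \<Sum>j\<in>UNIV. nsq (cylm T) (dX T (dX T w (e_x i)) (e_x j)))"
    by (intro sum_nonneg nsq_nonneg)+
  ultimately show ?thesis using nsq_nonneg[of "cylm T" "dX T w e_t"] by linarith
qed

lemma Xnorm_nonneg: "0 \<le> Xnorm T w"
  unfolding Xnorm_def sq_int_cyl
    by (intro real_sqrt_ge_zero add_nonneg_nonneg sum_nonneg nsq_nonneg)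

text \<open>In the weighted norm the part of the source proportional to \<open>w\<close> contributes
  at most \<open>8 * M^2\<close> times the squared norm of \<open>w\<close>, against
  \<open>\<mu>^2\<close> on the left. The choice of \<mu> gives
  \<open>\<mu>^2 \<ge> 16 * M^2 + 16\<close>, which absorbs it. This bounds \<open>w\<close>, hence
  the source, hence the full norm.\<close>

lemma heat_gronwall:
  assumes T: "T > 0" and M: "M \<ge> 0"
  shows "\<exists>C\<ge>0. \<forall>(f :: real \<times> (real^'d) \<Rightarrow> real) w h. heat_data T f w \<longrightarrow> f \<in> borel_measurable (cylm T)
      \<longrightarrow> 0 \<le> h \<longrightarrow>
     (AE z in cylm T. \<bar>f z\<bar> \<le> M * \<bar>w z\<bar> + h) \<longrightarrow> Xnorm T w \<le> C * h"
proof -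
  define \<mu> where "\<mu> = 4 * (M + 1)"
  have \<mu>: "\<mu> > 0" using M by (simp add: \<mu>_def)
  have \<mu>2: "\<mu>^2 \<ge> 16 * M^2 + 16" using M by (simp add: \<mu>_def power2_eq_square algebra_simps)
  define V where "V = nsq (cylm T) (\<lambda>z :: real \<times> (real^'d). 1)"
  have V: "V \<ge> 0" by (simp add: V_def)
  define c0 where "c0 = 4 * exp (2 * T) * (2 + real CARD('d) + real CARD('d)^2)"
  have c0: "c0 \<ge> 0" by (simp add: c0_def)
  define C where "C = sqrt (c0 * (2 * M^2 * exp (2 * \<mu> * T) + 2) * V)"
  have C2: "C^2 = c0 * (2 * M^2 * exp (2 * \<mu> * T) + 2) * V"
    unfolding C_def using c0 V by (intro real_sqrt_pow2) simp
  show ?thesis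
  proof (intro exI[of _ C] conjI allI impI)
    show C0: "0 \<le> C" unfolding C_def using c0 V by simp
    fix f w :: "real \<times> (real^'d) \<Rightarrow> real" and h :: real
    assume hd: "heat_data T f w" and f: "f \<in> borel_measurable (cylm T)" and h: "0 \<le> h"
      and le: "AE z in cylm T. \<bar>f z\<bar> \<le> M * \<bar>w z\<bar> + h"
    note sw = heat_data_in_L2(1)[OF hd] and sf = heat_data_in_L2(2)[OF hd f]
    obtain v where v: "heat_data T f v" "(Xnorm T v)^2 \<le> c0 * nsq (cylm T) f"
      "\<And>\<mu>. \<mu>>0 \<Longrightarrow> \<mu>^2 * nsq (cylm T) (\<lambda>z. exp (- \<mu> * fst z) * v z)
          \<le> 4 * nsq (cylm T) (\<lambda>z. exp (- \<mu> * fst z) * f z)"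
      using heat_exists[OF T sf] unfolding c0_def by blast
    \<comment> \<open>The estimates are known for the solution constructed as a limit; uniqueness
      transfers them to the given one.\<close>
    have wv: "AE z in cylm T. v z = w z" by (rule heat_unique[OF T v(1) hd]) simp
    have Xw: "(Xnorm T w)^2 \<le> c0 * nsq (cylm T) f"
      using v(2) Xnorm_cong[OF T heat_data_in_X[OF T v(1)] in_L2_measurable[OF sw] wv] by simp
    let ?e = "\<lambda>z :: real \<times> (real^'d). exp (- \<mu> * fst z)"
    note me = in_L2_mult_bounded(1)[OF _ exp_weight_cylm]
    have habs: "in_L2 (cylm T) (\<lambda>z. \<bar>w z\<bar>)" using sw by (auto simp: in_L2_def)
    have sh: "in_L2 (cylm T) (\<lambda>z :: real \<times> (real^'d). h)" by (rule in_L2_one_cylm)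
    have nh: "nsq (cylm T) (\<lambda>z :: real \<times> (real^'d). h) = h^2 * V"
      using nsq_cmult[of "cylm T" h "\<lambda>z :: real \<times> (real^'d). 1"] by (simp add: V_def)
    have f_le: "nsq (cylm T) (\<lambda>z. c z * f z) \<le> 2 * (M^2 * nsq (cylm T) (\<lambda>z. c z * w z))
        + 2 * nsq (cylm T) (\<lambda>z. c z * h)"
      if c: "c \<in> borel_measurable (cylm T)" "AE z in cylm T. \<bar>c z\<bar> \<le> B" "\<And>z. 0 \<le> c z" for c B
    proof -
      note mc = in_L2_mult_bounded(1)[OF _ c(1,2)]
      have "nsq (cylm T) (\<lambda>z. c z * f z) \<le> nsq (cylm T) (\<lambda>z. M * (c z * \<bar>w z\<bar>) + c z * h)"
      proof (rule nsq_mono)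
        show "in_L2 (cylm T) (\<lambda>z. M * (c z * \<bar>w z\<bar>) + c z * h)"
          by (intro in_L2_add in_L2_cmult mc habs sh)
        show "(\<lambda>z. c z * f z) \<in> borel_measurable (cylm T)" by (intro borel_measurable_times c f)
        show "AE z in cylm T. \<bar>c z * f z\<bar> \<le> \<bar>M * (c z * \<bar>w z\<bar>) + c z * h\<bar>"
          using le
        proof eventually_elim
          case (elim z)
          have "\<bar>c z * f z\<bar> \<le> c z * (M * \<bar>w z\<bar> + h)"
            unfolding abs_mult using mult_left_mono[OF elim c(3)[of z]] c(3)[of z] by simp
          then show ?case by (simp add: algebra_simps)
        qed
      qed
      also have "\<dots> \<le> 2 * nsq (cylm T) (\<lambda>z. M * (c z * \<bar>w z\<bar>)) + 2 * nsq (cylm T) (\<lambda>z. c z * h)"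
        by (intro nsq_add_le in_L2_cmult mc habs sh)
      also have "nsq (cylm T) (\<lambda>z. M * (c z * \<bar>w z\<bar>)) = M^2 * nsq (cylm T) (\<lambda>z. c z * w z)"
        unfolding nsq_cmult by (simp add: nsq_def power_mult_distrib)
      finally show ?thesis .
    qed
    let ?N = "nsq (cylm T) (\<lambda>z. ?e z * w z)"
    have Nv: "nsq (cylm T) (\<lambda>z. ?e z * v z) = ?N"
      using wv by (intro nsq_cong_AE in_L2_measurable me heat_data_in_L2(1)[OF v(1)] sw) auto
    have "\<mu>^2 * ?N \<le> 4 * nsq (cylm T) (\<lambda>z. ?e z * f z)" using v(3)[OF \<mu>] Nv by simp
    also have "\<dots> \<le> 4 * (2 * (M^2 * ?N) + 2 * nsq (cylm T) (\<lambda>z. ?e z * h))"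
      using f_le[OF exp_weight_cylm, of "- \<mu>"] by simp
    also have "\<dots> \<le> 4 * (2 * (M^2 * ?N) + 2 * (h^2 * V))"
      using nsq_exp_neg_le[OF sh less_imp_le[OF \<mu>]] nh by simp
    finally have 1: "\<mu>^2 * ?N \<le> 8 * (M^2 * ?N) + 8 * (h^2 * V)" by simp
    have "(16 * M^2 + 16) * ?N \<le> \<mu>^2 * ?N" by (intro mult_right_mono \<mu>2) simp
    with 1 have "16 * ?N \<le> 8 * (h^2 * V) - 8 * (M^2 * ?N)" by (simp add: algebra_simps)
    moreover have "0 \<le> M^2 * ?N" "0 \<le> h^2 * V" using V by simp_all
    ultimately have N: "?N \<le> h^2 * V" by linarith
    have nw: "nsq (cylm T) w \<le> exp (2 * \<mu> * T) * (h^2 * V)"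
      by (rule order_trans[OF nsq_unweight[OF sw less_imp_le[OF \<mu>]] mult_left_mono[OF N]]) simp
    have "nsq (cylm T) f \<le> 2 * (M^2 * nsq (cylm T) w) + 2 * (h^2 * V)"
      using f_le[of "\<lambda>z. 1" 1] nh by simp
    also have "\<dots> \<le> 2 * (M^2 * (exp (2 * \<mu> * T) * (h^2 * V))) + 2 * (h^2 * V)"
      using mult_left_mono[OF nw, of "M^2"] by simp
    finally have "c0 * nsq (cylm T) f \<le> c0 * (2 * (M^2 * (exp (2 * \<mu> * T) * (h^2 * V)))
        + 2 * (h^2 * V))"
      by (rule mult_left_mono[OF _ c0])
    also have "\<dots> = (C * h)^2" unfolding power_mult_distrib C2 by (simp add: algebra_simps)
    finally have "(Xnorm T w)^2 \<le> (C * h)^2" using Xw by linarith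
    then show "Xnorm T w \<le> C * h" by (rule power2_le_imp_le) (use C0 h in simp)
  qed
qed

text \<open>Every application of \<open>heat_sup_bound\<close> halves the excess over the claimed bound.\<close>
lemma heat_sup_gronwall:
  fixes w f :: "real \<times> (real^'d) \<Rightarrow> real"
  assumes T: "T > 0" and M: "M \<ge> 0" and hd: "heat_data T f w" and f: "f \<in> borel_measurable (cylm T)"
      and h: "0 \<le> h"
    and le: "AE z in cylm T. \<bar>f z\<bar> \<le> M * \<bar>w z\<bar> + h" and bd: "AE z in cylm T. \<bar>f z\<bar> \<le> A"
  shows "AE z in cylm T. \<bar>w z\<bar> \<le> h * exp (2 * (M + 1) * fst z)"
proof -
  define \<mu> where "\<mu> = 2 * (M + 1)"
  have \<mu>: "\<mu> > 0" "\<mu> \<ge> 2" using M by (auto simp: \<mu>_def)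
  have pos: "AE z in cylm T. 1 \<le> exp (\<mu> * fst z)"
    using \<mu> by (intro AE_I2) (auto simp: space_restrict_space mem_cyl)
  \<comment> \<open>The bound \<open>A\<close> on the source only starts the iteration, since
    nothing is assumed about boundedness of \<open>w\<close>; its contribution
    \<open>|A| / 2^n\<close> disappears in the limit.\<close>
  have *: "AE z in cylm T. \<bar>w z\<bar> \<le> (h + \<bar>A\<bar> / 2^n) * exp (\<mu> * fst z)" for n
  proof (induction n)
    case 0
    have "AE z in cylm T. \<bar>f z\<bar> \<le> \<bar>A\<bar> * exp (\<mu> * fst z)"
      using bd pos
    proof eventually_elim
      case (elim z)
      have "\<bar>A\<bar> * 1 \<le> \<bar>A\<bar> * exp (\<mu> * fst z)" using elim by (intro mult_left_mono) auto
      then show ?case using elim by linarith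
    qed
    from heat_sup_bound[OF T hd f \<mu>(1) _ this]
    have "AE z in cylm T. \<bar>w z\<bar> \<le> \<bar>A\<bar> / \<mu> * exp (\<mu> * fst z)" by simp
    then show ?case
    proof eventually_elim
      case (elim z)
      have "\<bar>A\<bar> / \<mu> \<le> \<bar>A\<bar> / 1" using \<mu> by (intro divide_left_mono) auto
      then have "\<bar>A\<bar> / \<mu> \<le> h + \<bar>A\<bar> / 2^0" using h by simp
      from mult_right_mono[OF this, of "exp (\<mu> * fst z)"] show ?case using elim by simp
    qed
  next
    case (Suc n)
    let ?a = "\<bar>A\<bar> / 2^n"
    have "AE z in cylm T. \<bar>f z\<bar> \<le> (M * (h + ?a) + h) * exp (\<mu> * fst z)"
      using Suc le pos
    proof eventually_elim
      case (elim z)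
      have "h * 1 \<le> h * exp (\<mu> * fst z)" using elim h by (intro mult_left_mono) auto
      moreover have "M * \<bar>w z\<bar> \<le> M * ((h + ?a) * exp (\<mu> * fst z))" using elim M
        by (intro mult_left_mono) auto
      ultimately show ?case using elim by (simp add: algebra_simps)
    qed
    from heat_sup_bound[OF T hd f \<mu>(1) _ this]
    have "AE z in cylm T. \<bar>w z\<bar> \<le> (M * (h + ?a) + h) / \<mu> * exp (\<mu> * fst z)" using M h by simp
    then show ?case
    proof eventually_elim
      case (elim z)
      \<comment> \<open>The source is now at most \<open>(M * (h + a) + h) * exp (\<mu> * t)\<close>
        for the old excess \<open>a\<close>, and dividing by \<mu> = 2 (M + 1) leaves at most
        \<open>h + a / 2\<close>.\<close>
      have "M * (h + ?a) + h \<le> (h + \<bar>A\<bar> / 2^Suc n) * \<mu>"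
      proof -
        have key: "M * (h + a) + h \<le> (h + a / 2) * (2 * (M + 1))" if "a \<ge> 0" for a
          using mult_nonneg_nonneg[OF M h] h that by (simp add: algebra_simps)
        have "M * (h + ?a) + h \<le> (h + ?a / 2) * (2 * (M + 1))" by (rule key) simp
        moreover have "\<bar>A\<bar> / 2^Suc n = ?a / 2" by simp
        ultimately show ?thesis unfolding \<mu>_def by (simp only:)
      qed
      then have "(M * (h + ?a) + h) / \<mu> \<le> h + \<bar>A\<bar> / 2^Suc n" using \<mu> by (simp add: pos_divide_le_eq)
      from mult_right_mono[OF this, of "exp (\<mu> * fst z)"] show ?case using elim by simp
    qed
  qed
  have "AE z in cylm T. \<forall>n. \<bar>w z\<bar> \<le> (h + \<bar>A\<bar> / 2^n) * exp (\<mu> * fst z)"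
    using * by (simp add: AE_all_countable)
  then show ?thesis
    unfolding \<mu>_def[symmetric]
  proof eventually_elim
    case (elim z)
    have "(\<lambda>n. (h + \<bar>A\<bar> * (1/2)^n) * exp (\<mu> * fst z)) \<longlonglongrightarrow> (h + \<bar>A\<bar> * 0) * exp (\<mu> * fst z)"
      by (intro tendsto_intros LIMSEQ_realpow_zero) auto
    then show ?case
      by (intro LIMSEQ_le_const[where X="\<lambda>n. (h + \<bar>A\<bar> * (1/2)^n) * exp (\<mu> * fst z)"])
          (use elim in \<open>auto simp: power_one_over\<close>)
  qed
qed

section \<open>Bounded solutions of the linearised problem\<close>

lemma geometric_limit:
  fixes a :: "nat \<Rightarrow> real"
  assumes d: "\<And>n. \<bar>a (Suc n) - a n\<bar> \<le> c / 2^n"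
  shows "a \<longlonglongrightarrow> lim a" "\<bar>lim a - a n\<bar> \<le> 2 * c / 2^n"
proof -
  have d': "\<bar>a (Suc n) - a n\<bar> \<le> c * (1/2)^n" for n using d[of n] by (simp add: power_one_over)
  \<comment> \<open>The subtracted term is the tail still to come; keeping it makes the induction on
    \<open>k\<close> close exactly.\<close>
  have near: "\<bar>a (n + k) - a n\<bar> \<le> 2 * c / 2^n - 2 * c / 2^(n + k)" for n k
  proof (induction k)
    case (Suc k)
    have "\<bar>a (n + Suc k) - a n\<bar> \<le> \<bar>a (Suc (n + k)) - a (n + k)\<bar> + \<bar>a (n + k) - a n\<bar>" by simp
    also have "\<dots> \<le> c / 2^(n + k) + (2 * c / 2^n - 2 * c / 2^(n + k))" by (intro add_mono d Suc)
    finally show ?case by (simp add: field_simps)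
  qed simp
  have c: "c \<ge> 0" using d[of 0] by simp
  have "summable (\<lambda>n. a (Suc n) - a n)"
    by (rule summable_comparison_test'[where g="\<lambda>n. c * (1/2)^n" and N=0])
        (use d' in \<open>auto intro!: summable_mult\<close>)
  then have "convergent a" by (simp add: summable_iff_convergent sum_lessThan_telescope
      convergent_diff_const_right_iff)
  then show *: "a \<longlonglongrightarrow> lim a" by (simp add: convergent_LIMSEQ_iff)
  have "(\<lambda>k. \<bar>a (n + k) - a n\<bar>) \<longlonglongrightarrow> \<bar>lim a - a n\<bar>"
    using LIMSEQ_ignore_initial_segment[OF *, of n]
      by (intro tendsto_intros) (simp add: add.commute)
  then show "\<bar>lim a - a n\<bar> \<le> 2 * c / 2^n"
  proof (rule LIMSEQ_le_const2, intro exI allI impI)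
    fix k
    have "0 \<le> 2 * c / 2^(n + k)" using c by simp
    then show "\<bar>a (n + k) - a n\<bar> \<le> 2 * c / 2^n" using near[of n k] by linarith
  qed
qed

text \<open>Picard iteration in the sup norm with weight exp(-\<mu> t). By
  \<open>heat_sup_bound\<close> one step contracts by \<open>M / \<mu>\<close>, which is at most 1/2
  for \<mu> = 2 (M + 1), without any smallness of \<open>T\<close> or \<open>M\<close>.\<close>

lemma heat_linear_exists:
  fixes V b :: "real \<times> (real^'d) \<Rightarrow> real"
  assumes T: "T > 0" and V: "V \<in> borel_measurable (cylm T)" "\<And>z. \<bar>V z\<bar> \<le> M"
    and b: "b \<in> borel_measurable (cylm T)" "\<And>z. \<bar>b z\<bar> \<le> B"
  shows "\<exists>i. heat_data T (\<lambda>z. V z * i z + b z) i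
      \<and> (AE z in cylm T. \<bar>i z\<bar> \<le> B * exp (2 * (M + 1) * fst z))"
proof -
  have M: "M \<ge> 0" and B: "B \<ge> 0" using V(2) b(2) abs_ge_zero order_trans by blast+
  define \<mu> where "\<mu> = 2 * (M + 1)"
  have \<mu>: "\<mu> > 0" "\<mu> \<ge> 2" using M by (auto simp: \<mu>_def)
  let ?e = "\<lambda>z :: real \<times> (real^'d). exp (\<mu> * fst z)"
  have pos: "AE z in cylm T. 1 \<le> ?e z"
    using \<mu> by (intro AE_I2) (auto simp: space_restrict_space mem_cyl)
  have sb: "in_L2 (cylm T) b" by (rule bounded_in_L2_cylm[OF b(1), of B]) (use b(2) in auto)
  have src: "in_L2 (cylm T) (\<lambda>z. V z * i z + b z)" if "in_L2 (cylm T) i" for i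
    by (intro in_L2_add sb in_L2_mult_bounded(1)[OF that V(1), of M] AE_I2 V(2))
  have mV: "(\<lambda>z. V z * i z + b z) \<in> borel_measurable (cylm T)" "(\<lambda>z. V z * i z)
      \<in> borel_measurable (cylm T)"
    if "i \<in> borel_measurable (cylm T)" for i
    using that V(1) b(1) by auto
  define S where "S f = (SOME w. heat_data T f w)" for f :: "real \<times> (real^'d) \<Rightarrow> real"
  have S: "heat_data T f (S f)" if "in_L2 (cylm T) f" for f
    unfolding S_def using someI_ex heat_exists[OF T that] by metis
  define i where "i n = ((\<lambda>i. S (\<lambda>z. V z * i z + b z)) ^^ n) (\<lambda>z. 0)" for n
  have i0: "i 0 = (\<lambda>z. 0)" and iS: "i (Suc n) = S (\<lambda>z. V z * i n z + b z)" for n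
    by (auto simp: i_def)
  have si: "in_L2 (cylm T) (i n)" for n
  proof (induction n)
    case (Suc n)
    show ?case unfolding iS by (rule heat_data_in_L2(1)[OF S[OF src[OF Suc]]])
  qed (simp add: i0)
  note mi = in_L2_measurable[OF si]
  have hd: "heat_data T (\<lambda>z. V z * i n z + b z) (i (Suc n))" for n unfolding iS
    by (rule S[OF src[OF si]])
  have contr: "AE z in cylm T. \<bar>w z\<bar> \<le> c / 2 * ?e z"
    if "heat_data T f w" "f \<in> borel_measurable (cylm T)" "AE z in cylm T. \<bar>f z\<bar> \<le> M * c * ?e z"
        "c \<ge> 0" for f w c
  proof -
    have "AE z in cylm T. \<bar>w z\<bar> \<le> M * c / \<mu> * ?e z"
      by (rule heat_sup_bound[OF T that(1,2) \<mu>(1) _ that(3)]) (use M that(4) in simp)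
    then show ?thesis
    proof eventually_elim
      case (elim z)
      have "M * c / \<mu> \<le> c / 2" using M that(4) by (simp add: \<mu>_def field_simps)
      then have "M * c / \<mu> * ?e z \<le> c / 2 * ?e z" by (intro mult_right_mono) simp_all
      with elim show ?case by (rule order_trans)
    qed
  qed
  have dif: "AE z in cylm T. \<bar>i (Suc n) z - i n z\<bar> \<le> B * ?e z / 2^n" for n
  proof (induction n)
    case 0
    have "AE z in cylm T. \<bar>V z * i 0 z + b z\<bar> \<le> B * ?e z"
      using pos
    proof eventually_elim
      case (elim z)
      have "B * 1 \<le> B * ?e z" using elim B by (intro mult_left_mono) auto
      then show ?case using b(2)[of z] by (simp add: i0)
    qed
    from heat_sup_bound[OF T hd mV(1)[OF mi] \<mu>(1) B this]
    have "AE z in cylm T. \<bar>i (Suc 0) z\<bar> \<le> B / \<mu> * ?e z" .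
    moreover have "B / \<mu> \<le> B" using \<mu> B by (simp add: pos_divide_le_eq mult_le_cancel_left1)
    ultimately have "B / \<mu> \<le> B" "AE z in cylm T. \<bar>i (Suc 0) z\<bar> \<le> B / \<mu> * ?e z" by blast+
    from this(2) show ?case
    proof eventually_elim
      case (elim z)
      also have "B / \<mu> * ?e z \<le> B * ?e z" by (intro mult_right_mono \<open>B / \<mu> \<le> B\<close>) simp
      finally show ?case by (simp add: i0)
    qed
  next
    case (Suc n)
    have "AE z in cylm T. \<bar>(V z * i (Suc n) z + b z) - (V z * i n z + b z)\<bar> \<le> M * (B / 2^n) * ?e z"
      using Suc
    proof eventually_elim
      case (elim z)
      have "\<bar>V z * (i (Suc n) z - i n z)\<bar> \<le> M * (B * ?e z / 2^n)"
        unfolding abs_mult using V(2) elim M by (intro mult_mono) auto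
      then show ?case by (simp add: algebra_simps)
    qed
    from contr[OF heat_data_diff[OF hd[of "Suc n"] hd[of n]]
        borel_measurable_diff[OF mV(1)[OF mi[of "Suc n"]] mV(1)[OF mi[of n]]] this]
    have "AE z in cylm T. \<bar>i (Suc (Suc n)) z - i (Suc n) z\<bar> \<le> B / 2^n / 2 * ?e z"
      using B by simp
    then show ?case by (simp add: mult_ac)
  qed
  define I where "I z = lim (\<lambda>n. i n z)" for z
  have mI: "I \<in> borel_measurable (cylm T)" unfolding I_def by (intro borel_measurable_lim_metric mi)
  have "AE z in cylm T. \<forall>n. \<bar>i (Suc n) z - i n z\<bar> \<le> B * ?e z / 2^n" using dif
    by (simp add: AE_all_countable)
  then have near: "AE z in cylm T. \<forall>n. \<bar>I z - i n z\<bar> \<le> 2 * (B * ?e z) / 2^n"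
  proof eventually_elim
    case (elim z)
    show ?case unfolding I_def using geometric_limit(2)[of "\<lambda>n. i n z" "B * ?e z"] elim by blast
  qed
  have "AE z in cylm T. \<bar>I z\<bar> \<le> \<bar>2 * B * exp (\<bar>\<mu>\<bar> * T)\<bar>"
    using near exp_weight_cylm(2)[of \<mu> T]
  proof eventually_elim
    case (elim z)
    have "\<bar>I z\<bar> \<le> 2 * B * ?e z" using elim(1)[rule_format, of 0] by (simp add: i0)
    also have "\<dots> \<le> 2 * B * exp (\<bar>\<mu>\<bar> * T)" using elim(2) B by (intro mult_left_mono) auto
    finally show ?case by simp
  qed
  then have sI: "in_L2 (cylm T) I" by (rule bounded_in_L2_cylm[OF mI])
  \<comment> \<open>The pointwise limit \<open>I\<close> comes without weak derivatives. Solving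
    once more with \<open>I\<close> in the source gives a genuine solution \<open>j\<close>, and one
    further contraction estimate shows that \<open>j\<close> and \<open>I\<close> agree almost
    everywhere.\<close>
  define j where "j = S (\<lambda>z. V z * I z + b z)"
  have hj: "heat_data T (\<lambda>z. V z * I z + b z) j" unfolding j_def by (rule S[OF src[OF sI]])
  note sj = heat_data_in_L2(1)[OF hj]
  have "AE z in cylm T. \<bar>i (Suc n) z - j z\<bar> \<le> 2 * B / 2^n / 2 * ?e z" for n
  proof (rule contr[OF heat_data_diff[OF hd[of n] hj] borel_measurable_diff[OF mV(1)[OF mi[of n]]
      mV(1)[OF mI]]])
    show "AE z in cylm T. \<bar>(V z * i n z + b z) - (V z * I z + b z)\<bar> \<le> M * (2 * B / 2^n) * ?e z"
      using near
    proof eventually_elim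
      case (elim z)
      have "\<bar>V z * (i n z - I z)\<bar> \<le> M * (2 * (B * ?e z) / 2^n)"
        unfolding abs_mult abs_minus_commute[of "i n z"] using V(2) elim M by (intro mult_mono) auto
      then show ?case by (simp add: algebra_simps)
    qed
  qed (use B in simp)
  then have "AE z in cylm T. \<forall>n. \<bar>i (Suc n) z - j z\<bar> \<le> 2 * B / 2^n / 2 * ?e z"
    by (simp add: AE_all_countable)
  with near have jI: "AE z in cylm T. I z = j z"
  proof eventually_elim
    case (elim z)
    have le: "\<bar>I z - j z\<bar> \<le> 2 * B * ?e z * (1/2)^n" for n
    proof -
      have "\<bar>I z - j z\<bar> \<le> \<bar>I z - i (Suc n) z\<bar> + \<bar>i (Suc n) z - j z\<bar>" by simp
      also have "\<dots> \<le> 2 * (B * ?e z) / 2^Suc n + 2 * B / 2^n / 2 * ?e z"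
        using elim(1)[rule_format, of "Suc n"] elim(2)[rule_format, of n] by (rule add_mono)
      also have "\<dots> = 2 * B * ?e z * (1/2)^n" by (simp add: power_one_over field_simps)
      finally show ?thesis .
    qed
    have "(\<lambda>n. 2 * B * ?e z * (1/2)^n) \<longlonglongrightarrow> 2 * B * ?e z * 0"
      by (intro tendsto_intros LIMSEQ_realpow_zero) auto
    then have "\<bar>I z - j z\<bar> \<le> 2 * B * ?e z * 0" by (rule LIMSEQ_le_const) (use le in blast)
    then show ?case by simp
  qed
  have hj': "heat_data T (\<lambda>z. V z * j z + b z) j"
    by (rule heat_data_cong[OF hj _ in_L2_measurable[OF sj]]) (use jI in auto)
  have mj: "j \<in> borel_measurable (cylm T)" by (rule in_L2_measurable[OF sj])
  have "AE z in cylm T. \<bar>j z\<bar> \<le> 2 * B * exp (\<bar>\<mu>\<bar> * T)"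
    using jI near exp_weight_cylm(2)[of \<mu> T]
  proof eventually_elim
    case (elim z)
    have "\<bar>j z\<bar> \<le> 2 * B * ?e z" using elim(2)[rule_format, of 0] elim(1) by (simp add: i0)
    also have "\<dots> \<le> 2 * B * exp (\<bar>\<mu>\<bar> * T)" using elim(3) B by (intro mult_left_mono) auto
    finally show ?case .
  qed
  note jb = this
  \<comment> \<open>The iteration yields the bound only up to a factor 2. It suffices to make the
    source bounded, after which \<open>heat_sup_gronwall\<close> gives the stated constant.\<close>
  have "AE z in cylm T. \<bar>j z\<bar> \<le> B * exp (2 * (M + 1) * fst z)"
  proof (rule heat_sup_gronwall[OF T M hj' mV(1)[OF mj] B])
    show "AE z in cylm T. \<bar>V z * j z + b z\<bar> \<le> M * \<bar>j z\<bar> + B"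
    proof (rule AE_I2)
      fix z
      have "\<bar>V z * j z + b z\<bar> \<le> \<bar>V z\<bar> * \<bar>j z\<bar> + \<bar>b z\<bar>" using abs_triangle_ineq[of "V z * j z" "b z"]
        by (simp add: abs_mult)
      also have "\<dots> \<le> M * \<bar>j z\<bar> + B" using V(2) b(2) by (intro add_mono mult_right_mono) auto
      finally show "\<bar>V z * j z + b z\<bar> \<le> M * \<bar>j z\<bar> + B" .
    qed
    then show "AE z in cylm T. \<bar>V z * j z + b z\<bar> \<le> M * (2 * B * exp (\<bar>\<mu>\<bar> * T)) + B"
      using jb by eventually_elim (use M in \<open>meson add_mono mult_left_mono order_refl order_trans\<close>)
  qed
  with hj' show ?thesis by blast
qed

section \<open>The nonlinear problem\<close>

lemma C2b_DERIV:
  assumes "C2b R"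
  shows "(R has_real_derivative deriv R x) (at x)" "(deriv R has_real_derivative deriv (deriv R) x)
      (at x)"
  using assms by (auto simp: C2b_def DERIV_deriv_iff_real_differentiable)

lemma C2b_c2norm:
  assumes "C2b R"
  shows "\<bar>R x\<bar> \<le> c2norm R" "\<bar>deriv R x\<bar> \<le> c2norm R" "\<bar>deriv (deriv R) x\<bar> \<le> c2norm R"
proof -
  obtain a b c where abc: "\<And>x. \<bar>R x\<bar> \<le> a" "\<And>x. \<bar>deriv R x\<bar> \<le> b" "\<And>x. \<bar>deriv (deriv R) x\<bar> \<le> c"
    using assms unfolding C2b_def bounded_iff by auto
  have "bdd_above (range (\<lambda>x. \<bar>R x\<bar> + \<bar>deriv R x\<bar> + \<bar>deriv (deriv R) x\<bar>))"
    by (rule bdd_aboveI[of _ "a + b + c"]) (use abc in \<open>auto intro!: add_mono\<close>)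
  then have "\<bar>R x\<bar> + \<bar>deriv R x\<bar> + \<bar>deriv (deriv R) x\<bar> \<le> c2norm R"
    unfolding c2norm_def by (rule cSUP_upper[OF UNIV_I])
  then show "\<bar>R x\<bar> \<le> c2norm R" "\<bar>deriv R x\<bar> \<le> c2norm R" "\<bar>deriv (deriv R) x\<bar> \<le> c2norm R"
    by linarith+
qed

lemma c2norm_nonneg: "C2b R \<Longrightarrow> 0 \<le> c2norm R"
  using C2b_c2norm(1)[of R 0] by linarith

lemma C2b_lin:
  assumes "C2b R" "C2b H"
  shows "C2b (\<lambda>x. a * R x + b * H x)" "deriv (\<lambda>x. a * R x + b * H x)
      = (\<lambda>x. a * deriv R x + b * deriv H x)"
proof -
  let ?F = "\<lambda>x. a * R x + b * H x"
  have 1: "(?F has_real_derivative a * deriv R x + b * deriv H x) (at x)" for x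
    by (intro DERIV_add DERIV_cmult C2b_DERIV assms)
  show e1: "deriv ?F = (\<lambda>x. a * deriv R x + b * deriv H x)"
    using DERIV_imp_deriv[OF 1] by auto
  have 2: "(deriv ?F has_real_derivative a * deriv (deriv R) x + b * deriv (deriv H) x) (at x)"
      for x
    unfolding e1 by (intro DERIV_add DERIV_cmult C2b_DERIV assms)
  have e2: "deriv (deriv ?F) = (\<lambda>x. a * deriv (deriv R) x + b * deriv (deriv H) x)"
    using DERIV_imp_deriv[OF 2] by auto
  have bd: "bounded (range (\<lambda>x. a * p x + b * q x))" if "\<And>x. \<bar>p x\<bar> \<le> A" "\<And>x. \<bar>q x\<bar> \<le> B"
      for p q :: "real \<Rightarrow> real" and A B
  proof (rule boundedI)
    fix y assume "y \<in> range (\<lambda>x. a * p x + b * q x)"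
    then obtain x where y: "y = a * p x + b * q x" by auto
    have "\<bar>a * p x\<bar> \<le> \<bar>a\<bar> * A" "\<bar>b * q x\<bar> \<le> \<bar>b\<bar> * B" unfolding abs_mult using that
      by (auto intro: mult_left_mono)
    then show "norm y \<le> \<bar>a\<bar> * A + \<bar>b\<bar> * B" unfolding y real_norm_def by linarith
  qed
  show "C2b ?F"
    unfolding C2b_def e2
  proof (intro conjI allI)
    show "?F differentiable (at x)" "deriv ?F differentiable (at x)" for x
      using 1 2 real_differentiable_def by blast+
    show "continuous_on UNIV (\<lambda>x. a * deriv (deriv R) x + b * deriv (deriv H) x)"
      using assms unfolding C2b_def by (intro continuous_intros) auto
    show "bounded (range ?F)" by (rule bd[OF C2b_c2norm(1)[OF assms(1)] C2b_c2norm(1)[OF assms(2)]])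
    show "bounded (range (deriv ?F))" unfolding e1
      by (rule bd[OF C2b_c2norm(2)[OF assms(1)] C2b_c2norm(2)[OF assms(2)]])
    show "bounded (range (\<lambda>x. a * deriv (deriv R) x + b * deriv (deriv H) x))"
      by (rule bd[OF C2b_c2norm(3)[OF assms(1)] C2b_c2norm(3)[OF assms(2)]])
  qed
qed

lemma C2b_add: "C2b R \<Longrightarrow> C2b H \<Longrightarrow> C2b (\<lambda>x. R x + H x)"
  and C2b_diff: "C2b R \<Longrightarrow> C2b H \<Longrightarrow> C2b (\<lambda>x. R x - H x)"
  and deriv_C2b_diff: "C2b R \<Longrightarrow> C2b H \<Longrightarrow> deriv (\<lambda>x. R x - H x) = (\<lambda>x. deriv R x - deriv H x)"
  using C2b_lin[of R H 1 1] C2b_lin[of R H 1 "-1"] by simp_all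

lemma lipschitz_of_deriv_bound:
  fixes f :: "real \<Rightarrow> real"
  assumes "\<And>x. (f has_real_derivative f' x) (at x)" "\<And>x. \<bar>f' x\<bar> \<le> K"
  shows "\<bar>f y - f x\<bar> \<le> K * \<bar>y - x\<bar>"
proof -
  have *: "\<bar>f y - f x\<bar> \<le> K * \<bar>y - x\<bar>" if xy: "x < y" for x y
  proof -
    obtain z where "f y - f x = (y - x) * f' z" using MVT2[OF xy, of f f'] assms(1) by blast
    then show ?thesis using assms(2)[of z] xy
      by (simp add: abs_mult mult.commute[of K] mult_left_mono)
  qed
  show ?thesis
    using *[of x y] *[of y x] by (cases x y rule: linorder_cases) (auto simp: abs_minus_commute)
qed

lemma C2b_lipschitz:
  assumes "C2b R"
  shows "\<bar>R y - R x\<bar> \<le> c2norm R * \<bar>y - x\<bar>" "\<bar>deriv R y - deriv R x\<bar> \<le> c2norm R * \<bar>y - x\<bar>"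
  by (rule lipschitz_of_deriv_bound[OF C2b_DERIV(1)[OF assms] C2b_c2norm(2)[OF assms]]
      lipschitz_of_deriv_bound[OF C2b_DERIV(2)[OF assms] C2b_c2norm(3)[OF assms]])+

lemma C2b_taylor:
  assumes "C2b R"
  shows "\<bar>R y - R x - deriv R x * (y - x)\<bar> \<le> c2norm R * (y - x)^2"
proof (cases "x = y")
  case False
  have "\<exists>z. \<bar>z - x\<bar> \<le> \<bar>y - x\<bar> \<and> R y - R x = (y - x) * deriv R z"
  proof (cases "x < y")
    case True
    obtain z where "x < z" "z < y" "R y - R x = (y - x) * deriv R z"
      using MVT2[OF True, of R "deriv R"] C2b_DERIV(1)[OF assms] by blast
    then show ?thesis by (intro exI[of _ z]) auto
  next
    case F: False
    then have "y < x" using False by simp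
    obtain z where "y < z" "z < x" "R x - R y = (x - y) * deriv R z"
      using MVT2[OF \<open>y < x\<close>, of R "deriv R"] C2b_DERIV(1)[OF assms] by blast
    then show ?thesis by (intro exI[of _ z]) (auto simp: algebra_simps)
  qed
  then obtain z where z: "\<bar>z - x\<bar> \<le> \<bar>y - x\<bar>" "R y - R x = (y - x) * deriv R z" by blast
  have "R y - R x - deriv R x * (y - x) = (deriv R z - deriv R x) * (y - x)"
    unfolding z(2) by (simp add: algebra_simps)
  then have "\<bar>R y - R x - deriv R x * (y - x)\<bar> = \<bar>deriv R z - deriv R x\<bar> * \<bar>y - x\<bar>"
    by (simp add: abs_mult)
  also have "\<dots> \<le> (c2norm R * \<bar>z - x\<bar>) * \<bar>y - x\<bar>"
    by (intro mult_right_mono C2b_lipschitz assms) simp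
  also have "\<dots> \<le> (c2norm R * \<bar>y - x\<bar>) * \<bar>y - x\<bar>"
    by (intro mult_right_mono mult_left_mono z c2norm_nonneg assms) simp
  also have "\<dots> = c2norm R * (y - x)^2" by (simp add: power2_eq_square[symmetric] mult.assoc)
  finally show ?thesis .
qed (simp add: c2norm_nonneg[OF assms])

lemma C2b_measurable_comp:
  assumes "C2b R" "u \<in> borel_measurable M"
  shows "(\<lambda>z. R (u z)) \<in> borel_measurable M" "(\<lambda>z. deriv R (u z)) \<in> borel_measurable M"
proof -
  have "continuous_on UNIV R" "continuous_on UNIV (deriv R)"
    using C2b_DERIV[OF assms(1)] by (meson DERIV_isCont continuous_at_imp_continuous_on)+
  then show "(\<lambda>z. R (u z)) \<in> borel_measurable M" "(\<lambda>z. deriv R (u z)) \<in> borel_measurable M"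
    using assms(2) by (auto intro: measurable_compose borel_measurable_continuous_onI)
qed

lemma strong_sol_measurable: "strong_sol T \<phi> F u \<Longrightarrow> u \<in> borel_measurable (cylm T)"
  by (auto simp: strong_sol_def in_X_def L2_on_cyl in_L2_def)

lemma exp_weight_le:
  assumes "\<mu> \<ge> 0" "z \<in> cyl T"
  shows "exp (\<mu> * fst z) \<le> exp (\<mu> * T)"
  using assms by (auto simp: mem_cyl intro!: mult_left_mono)

text \<open>The source of the difference splits as \<open>(R1 - R)(v)\<close>, at most the distance
  of \<open>R1\<close> and \<open>R\<close>, plus \<open>R(v) - R(u)\<close>, which is Lipschitz in
  \<open>v - u\<close>. It is bounded because \<open>R\<close> and \<open>R1\<close> are, although
  \<open>u\<close> and \<open>v\<close> themselves need not be.\<close>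

lemma nonlinear_sup_diff:
  fixes u v :: "real \<times> (real^'d) \<Rightarrow> real"
  assumes T: "T > 0" and R: "C2b R" and R1: "C2b R1"
    and u: "strong_sol T \<phi> (\<lambda>z s. R s) u" and v: "strong_sol T \<phi> (\<lambda>z s. R1 s) v"
  shows "AE z in cylm T. \<bar>v z - u z\<bar> \<le> c2norm (\<lambda>x. R1 x - R x) * exp (2 * (c2norm R + 1) * T)"
proof -
  let ?h = "c2norm (\<lambda>x. R1 x - R x)"
  note D = C2b_diff[OF R1 R]
  note mu = strong_sol_measurable[OF u] and mv = strong_sol_measurable[OF v]
  note hd = strong_sol_diff[OF T v u]
  have "AE z in cylm T. \<bar>v z - u z\<bar> \<le> ?h * exp (2 * (c2norm R + 1) * fst z)"
  proof (rule heat_sup_gronwall[OF T c2norm_nonneg[OF R] hd _ c2norm_nonneg[OF D]])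
    show "(\<lambda>z. R1 (v z) - R (u z)) \<in> borel_measurable (cylm T)"
      by (intro borel_measurable_diff C2b_measurable_comp(1)[OF R1 mv]
          C2b_measurable_comp(1)[OF R mu])
    show "AE z in cylm T. \<bar>R1 (v z) - R (u z)\<bar> \<le> c2norm R * \<bar>v z - u z\<bar> + ?h"
    proof (rule AE_I2)
      fix z
      show "\<bar>R1 (v z) - R (u z)\<bar> \<le> c2norm R * \<bar>v z - u z\<bar> + ?h"
        using C2b_c2norm(1)[OF D, of "v z"] C2b_lipschitz(1)[OF R, of "v z" "u z"] by linarith
    qed
    show "AE z in cylm T. \<bar>R1 (v z) - R (u z)\<bar> \<le> c2norm R1 + c2norm R"
    proof (rule AE_I2)
      fix z
      show "\<bar>R1 (v z) - R (u z)\<bar> \<le> c2norm R1 + c2norm R"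
        using C2b_c2norm(1)[OF R1, of "v z"] C2b_c2norm(1)[OF R, of "u z"] by linarith
    qed
  qed
  moreover have "AE z in cylm T. exp (2 * (c2norm R + 1) * fst z) \<le> exp (2 * (c2norm R + 1) * T)"
    using c2norm_nonneg[OF R] by (intro AE_I2 exp_weight_le) (auto simp: space_restrict_space)
  ultimately show ?thesis
  proof eventually_elim
    case (elim z)
    show ?case by (rule order_trans[OF elim(1) mult_left_mono[OF elim(2) c2norm_nonneg[OF D]]])
  qed
qed

theorem theorem2p1:
  fixes T :: real and \<phi> :: "real^'d \<Rightarrow> real"
    and G :: "(real \<Rightarrow> real) \<Rightarrow> (real \<times> (real^'d) \<Rightarrow> real)"
  assumes "CARD('d) \<le> 3" and "T > 0" and "H1_torus \<phi>"
    and "\<forall>R. C2b R \<longrightarrow> strong_sol T \<phi> (\<lambda>z s. R s) (G R)"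
  shows "\<exists>DG. C1_frechet T G DG \<and>
     (\<forall>R H. C2b R \<and> C2b H \<longrightarrow>
        strong_sol T (\<lambda>x. 0) (\<lambda>z s. deriv R (G R z) * s + H (G R z)) (DG R H) \<and>
        (\<forall>i. strong_sol T (\<lambda>x. 0) (\<lambda>z s. deriv R (G R z) * s + H (G R z)) i
               \<longrightarrow> Xnorm T (\<lambda>z. i z - DG R H z) = 0))"
proof -
  note T = \<open>T > 0\<close>
  have G: "strong_sol T \<phi> (\<lambda>z s. R s) (G R)" if "C2b R" for R using assms(4) that by blast
  have mG: "G R \<in> borel_measurable (cylm T)" if "C2b R" for R
    by (rule strong_sol_measurable[OF G[OF that]])
  define lin where "lin R H i \<longleftrightarrow> heat_data T (\<lambda>z. deriv R (G R z) * i z + H (G R z)) i" for R H i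
  have lin_iff: "strong_sol T (\<lambda>x. 0) (\<lambda>z s. deriv R (G R z) * s + H (G R z)) i \<longleftrightarrow> lin R H i"
      for R H i
    unfolding lin_def by (rule heat_data_strong_sol[OF T])
  have mlin: "(\<lambda>z. deriv R (G R z) * i z + H (G R z)) \<in> borel_measurable (cylm T)"
    if "C2b R" "C2b H" "i \<in> borel_measurable (cylm T)" for R H i
    by (intro borel_measurable_add borel_measurable_times that(3)
        C2b_measurable_comp(2)[OF that(1) mG[OF that(1)]] C2b_measurable_comp(1)[OF that(2)
            mG[OF that(1)]])
  have mi: "i \<in> borel_measurable (cylm T)" if "lin R H i" for R H i
    using that heat_data_in_L2(1) unfolding lin_def by (auto simp: in_L2_def)
  \<comment> \<open>Names the constant for one fixed \<open>R\<close>, so that in the continuity of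
    the derivative it stays fixed while the nearby reaction function varies.\<close>
  define gronwall_const where "gronwall_const R C \<longleftrightarrow> 0 \<le> C \<and>
     (\<forall>(f :: real \<times> (real^'d) \<Rightarrow> real) w h. heat_data T f w \<longrightarrow> f \<in> borel_measurable (cylm T) \<longrightarrow>
       0 \<le> h \<longrightarrow> (AE z in cylm T. \<bar>f z\<bar> \<le> c2norm R * \<bar>w z\<bar> + h) \<longrightarrow> Xnorm T w \<le> C * h)" for R C
  have gron: "\<exists>C. gronwall_const R C" if "C2b R" for R
    unfolding gronwall_const_def by (rule heat_gronwall[OF T c2norm_nonneg[OF that]])
  have uniq: "Xnorm T (\<lambda>z. i z - j z) = 0" "AE z in cylm T. i z = j z"
    if R: "C2b R" and H: "C2b H" and i: "lin R H i" and j: "lin R H j" for R H i j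
  proof -
    note hd = heat_data_diff[OF i[unfolded lin_def] j[unfolded lin_def]]
    obtain C where gC: "gronwall_const R C" using gron[OF R] ..
    note C = gC[unfolded gronwall_const_def, THEN conjunct2]
    have "Xnorm T (\<lambda>z. i z - j z) \<le> C * 0"
    proof (rule C[rule_format, OF hd])
      show "(\<lambda>z. (deriv R (G R z) * i z + H (G R z)) - (deriv R (G R z) * j z + H (G R z)))
          \<in> borel_measurable (cylm T)"
        by (intro borel_measurable_diff mlin R H mi[OF i] mi[OF j])
      show "AE z in cylm T. \<bar>(deriv R (G R z) * i z + H (G R z))
          - (deriv R (G R z) * j z + H (G R z))\<bar> \<le> c2norm R * \<bar>i z - j z\<bar> + 0"
      proof (rule AE_I2)
        fix z
        have "(deriv R (G R z) * i z + H (G R z)) - (deriv R (G R z) * j z + H (G R z))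
            = deriv R (G R z) * (i z - j z)"
          by (simp add: algebra_simps)
        then show "\<bar>(deriv R (G R z) * i z + H (G R z)) - (deriv R (G R z) * j z + H (G R z))\<bar>
            \<le> c2norm R * \<bar>i z - j z\<bar> + 0"
          using C2b_c2norm(2)[OF R] by (simp add: abs_mult mult_right_mono)
      qed
    qed simp
    then show X: "Xnorm T (\<lambda>z. i z - j z) = 0" using Xnorm_nonneg[of T "\<lambda>z. i z - j z"] by simp
    have "nsq (cylm T) (\<lambda>z. i z - j z) = 0"
      using nsq_le_Xnorm[OF T heat_data_in_X[OF T hd]] nsq_nonneg[of "cylm T" "\<lambda>z. i z - j z"]
        unfolding X by simp
    from nsq_eq_0[OF heat_data_in_L2(1)[OF hd] this]
    show "AE z in cylm T. i z = j z" by simp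
  qed
  define DG where "DG R H = (SOME i. lin R H i)" for R H
  have lin_exists: "\<exists>i. lin R H i \<and> (AE z in cylm T. \<bar>i z\<bar> \<le> c2norm H * exp (2 * (M + 1) * fst z))"
    if R: "C2b R" and H: "C2b H" and M: "\<And>x. \<bar>deriv R x\<bar> \<le> M" for R H M
    unfolding lin_def
    by (rule heat_linear_exists[OF T C2b_measurable_comp(2)[OF R mG[OF R]] M
        C2b_measurable_comp(1)[OF H mG[OF R]] C2b_c2norm(1)[OF H]])
  have DG: "lin R H (DG R H)" if "C2b R" "C2b H" for R H
  proof -
    have "\<exists>i. lin R H i" using lin_exists[OF that C2b_c2norm(2)[OF that(1)]] by blast
    then show ?thesis unfolding DG_def by (rule someI_ex)
  qed
  \<comment> \<open>Stated for an arbitrary bound \<open>M\<close> of the derivative of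
    \<open>R\<close>, so that one exponential factor can serve all reaction functions in a
    neighbourhood. \<open>DG R H\<close> is merely some solution; the bound reaches it from the
    constructed one by uniqueness.\<close>
  have DG_sup: "AE z in cylm T. \<bar>DG R H z\<bar> \<le> c2norm H * exp (2 * (M + 1) * T)"
    if R: "C2b R" and H: "C2b H" and M: "\<And>x. \<bar>deriv R x\<bar> \<le> M" for R H M
  proof -
    have M0: "M \<ge> 0" using M[of 0] by linarith
    obtain i where i: "lin R H i" "AE z in cylm T. \<bar>i z\<bar> \<le> c2norm H * exp (2 * (M + 1) * fst z)"
      using lin_exists[OF R H M] by blast
    have "AE z in cylm T. exp (2 * (M + 1) * fst z) \<le> exp (2 * (M + 1) * T)"
      using M0 by (intro AE_I2 exp_weight_le) (auto simp: space_restrict_space)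
    with i(2) uniq(2)[OF R H i(1) DG[OF R H]] show ?thesis
    proof eventually_elim
      case (elim z)
      show ?case
        unfolding elim(2)[symmetric]
          by (rule order_trans[OF elim(1) mult_left_mono[OF elim(3) c2norm_nonneg[OF H]]])
    qed
  qed
  note hDG = DG[unfolded lin_def]
  have mDG: "DG R H \<in> borel_measurable (cylm T)" if "C2b R" "C2b H" for R H
    by (rule mi[OF DG[OF that]])
  have bdd: "bdd_lin_op T (DG R)" if R: "C2b R" for R
    unfolding bdd_lin_op_def
  proof (intro conjI allI impI)
    show "in_X T (DG R H)" if "C2b H" for H by (rule heat_data_in_X[OF T hDG[OF R that]])
  next
    fix H1 H2 a b assume H: "C2b H1 \<and> C2b H2"
    \<comment> \<open>Linearity up to norm zero: the combination of the two derivatives solves the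
      problem that defines \<open>DG\<close> at the combined direction, and solutions are
      unique.\<close>
    have "lin R (\<lambda>x. a * H1 x + b * H2 x) (\<lambda>z. a * DG R H1 z + b * DG R H2 z)"
      unfolding lin_def
    proof (rule heat_data_cong[OF heat_data_lin[OF hDG hDG, of R H1 R H2 a b]])
      show "AE z in cylm T. a * (deriv R (G R z) * DG R H1 z + H1 (G R z))
          + b * (deriv R (G R z) * DG R H2 z + H2 (G R z))
          = deriv R (G R z) * (a * DG R H1 z + b * DG R H2 z) + (a * H1 (G R z) + b * H2 (G R z))"
        by (rule AE_I2) (simp add: algebra_simps)
      show "(\<lambda>z. a * DG R H1 z + b * DG R H2 z) \<in> borel_measurable (cylm T)"
        using mDG[OF R] H by (intro borel_measurable_add borel_measurable_times) auto
    qed (use R H in auto)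
    then show "Xnorm T (\<lambda>z. DG R (\<lambda>x. a * H1 x + b * H2 x) z - (a * DG R H1 z + b * DG R H2 z)) = 0"
      using H by (intro uniq(1)[OF R C2b_lin(1) DG[OF R C2b_lin(1)]]) auto
  next
    obtain C where gC: "gronwall_const R C" using gron[OF R] ..
    note C = gC[unfolded gronwall_const_def, THEN conjunct2]
    have "Xnorm T (DG R H) \<le> C * c2norm H" if H: "C2b H" for H
    proof (rule C[rule_format, OF hDG[OF R H] mlin[OF R H mDG[OF R H]] c2norm_nonneg[OF H]],
        rule AE_I2)
      fix z
      have "\<bar>deriv R (G R z)\<bar> * \<bar>DG R H z\<bar> \<le> c2norm R * \<bar>DG R H z\<bar>"
        by (intro mult_right_mono C2b_c2norm R) simp
      then show "\<bar>deriv R (G R z) * DG R H z + H (G R z)\<bar> \<le> c2norm R * \<bar>DG R H z\<bar> + c2norm H"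
        using C2b_c2norm(1)[OF H, of "G R z"] abs_triangle_ineq[of "deriv R (G R z) * DG R H z"
            "H (G R z)"]
        unfolding abs_mult by linarith
    qed
    then show "\<exists>K. \<forall>H. C2b H \<longrightarrow> Xnorm T (DG R H) \<le> K * c2norm H" by blast
  qed
  have small: "\<exists>\<delta>>0. \<delta> \<le> 1 \<and> K * \<delta> \<le> \<epsilon>" if "\<epsilon> > 0" "K \<ge> 0" for \<epsilon> K :: real
  proof (intro exI[of _ "min 1 (\<epsilon> / (K + 1))"] conjI)
    have "K * min 1 (\<epsilon> / (K + 1)) \<le> (K + 1) * (\<epsilon> / (K + 1))" using that by (intro mult_mono) auto
    also have "\<dots> = \<epsilon>" using that by simp
    finally show "K * min 1 (\<epsilon> / (K + 1)) \<le> \<epsilon>" .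
  qed (use that in auto)
  have frechet: "frechet_at T G R (DG R)" if R: "C2b R" for R
    unfolding frechet_at_def
  proof (intro conjI allI impI bdd R)
    fix \<epsilon> :: real assume "\<epsilon> > 0"
    obtain C where gC: "gronwall_const R C" using gron[OF R] ..
    note C0 = gC[unfolded gronwall_const_def, THEN conjunct1]
      and C = gC[unfolded gronwall_const_def, THEN conjunct2]
    define M where "M = c2norm R"
    have M: "M \<ge> 0" unfolding M_def by (rule c2norm_nonneg[OF R])
    define E where "E = exp (2 * (M + 1) * T)"
    have E: "E \<ge> 0" by (simp add: E_def)
    \<comment> \<open>The remainder source is at most \<open>M * (h * E)^2 + h * (h * E)\<close>,
      from Taylor's formula for \<open>R\<close> and the Lipschitz bound for \<open>H\<close>, so
      the remainder has norm at most \<open>K * h^2\<close>.\<close>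
    define K where "K = C * (M * E^2 + E)"
    have K: "K \<ge> 0" unfolding K_def using C0 M E by simp
    obtain \<delta> where \<delta>: "\<delta> > 0" "K * \<delta> \<le> \<epsilon>" using small[OF \<open>\<epsilon> > 0\<close> K] by blast
    show "\<exists>\<delta>>0. \<forall>H. C2b H \<and> c2norm H < \<delta> \<longrightarrow> Xnorm T (\<lambda>z. G (\<lambda>x. R x + H x) z - G R z - DG R H z)
        \<le> \<epsilon> * c2norm H"
    proof (intro exI[of _ \<delta>] conjI \<delta>(1) allI impI)
      fix H assume "C2b H \<and> c2norm H < \<delta>"
      then have H: "C2b H" and hd: "c2norm H < \<delta>" by auto
      define h where "h = c2norm H"
      have h: "h \<ge> 0" unfolding h_def by (rule c2norm_nonneg[OF H])
      note RH = C2b_add[OF R H]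
      define v u i where "v = G (\<lambda>x. R x + H x)" and "u = G R" and "i = DG R H"
      have mv: "v \<in> borel_measurable (cylm T)" and mu: "u \<in> borel_measurable (cylm T)"
          and mi: "i \<in> borel_measurable (cylm T)"
        unfolding v_def u_def i_def by (intro mG mDG RH R H)+
      have w: "AE z in cylm T. \<bar>v z - u z\<bar> \<le> h * E"
        using nonlinear_sup_diff[OF T R RH G[OF R] G[OF RH]]
          by (simp add: h_def E_def M_def v_def u_def)
      have "heat_data T (\<lambda>z. (R (v z) + H (v z)) - R (u z) - (deriv R (u z) * i z + H (u z)))
          (\<lambda>z. v z - u z - i z)"
        unfolding v_def u_def i_def
          by (rule heat_data_diff[OF strong_sol_diff[OF T G[OF RH] G[OF R]] hDG[OF R H]])
      then have "Xnorm T (\<lambda>z. v z - u z - i z) \<le> C * ((M * E^2 + E) * h^2)"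
      proof (rule C[rule_format])
        show "(\<lambda>z. (R (v z) + H (v z)) - R (u z) - (deriv R (u z) * i z + H (u z)))
            \<in> borel_measurable (cylm T)"
          by (intro borel_measurable_diff borel_measurable_add borel_measurable_times mi
              C2b_measurable_comp(1)[OF R mv] C2b_measurable_comp(1)[OF H mv]
              C2b_measurable_comp[OF R mu] C2b_measurable_comp(1)[OF H mu])
        show "0 \<le> (M * E^2 + E) * h^2" using M E by simp
        show "AE z in cylm T. \<bar>(R (v z) + H (v z)) - R (u z) - (deriv R (u z) * i z + H (u z))\<bar>
           \<le> c2norm R * \<bar>v z - u z - i z\<bar> + (M * E^2 + E) * h^2"
          using w
        proof eventually_elim
          case (elim z)
          have 1: "\<bar>R (v z) - R (u z) - deriv R (u z) * (v z - u z)\<bar> \<le> M * (h * E)^2"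
          proof -
            have "(v z - u z)^2 \<le> (h * E)^2" using power_mono[OF elim abs_ge_zero, of 2]
              by (simp only: power2_abs)
            from mult_left_mono[OF this M] show ?thesis using C2b_taylor[OF R, of "v z" "u z"]
              unfolding M_def by linarith
          qed
          have 2: "\<bar>H (v z) - H (u z)\<bar> \<le> h * (h * E)"
            using C2b_lipschitz(1)[OF H, of "v z" "u z"] mult_left_mono[OF elim h] unfolding h_def
              by linarith
          have 3: "\<bar>deriv R (u z) * (v z - u z - i z)\<bar> \<le> M * \<bar>v z - u z - i z\<bar>"
            unfolding abs_mult M_def by (intro mult_right_mono C2b_c2norm R) simp
          \<comment> \<open>Taylor remainder of \<open>R\<close>, variation of \<open>H\<close>
            between the two solutions, and a multiple of the remainder itself, which the Gronwall
            estimate absorbs.\<close>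
          have "(R (v z) + H (v z)) - R (u z) - (deriv R (u z) * i z + H (u z))
             = (R (v z) - R (u z) - deriv R (u z) * (v z - u z)) + (H (v z) - H (u z)) + deriv R
                 (u z) * (v z - u z - i z)"
            by (simp add: algebra_simps)
          then have "\<bar>(R (v z) + H (v z)) - R (u z) - (deriv R (u z) * i z + H (u z))\<bar>
             \<le> M * (h * E)^2 + h * (h * E) + M * \<bar>v z - u z - i z\<bar>" using 1 2 3 by linarith
          also have "\<dots> = c2norm R * \<bar>v z - u z - i z\<bar> + (M * E^2 + E) * h^2"
            unfolding M_def by (simp add: power2_eq_square algebra_simps)
          finally show ?case .
        qed
      qed
      also have "\<dots> = (K * h) * h" by (simp add: K_def power2_eq_square)
      also have "\<dots> \<le> \<epsilon> * h"
      proof (rule mult_right_mono[OF _ h])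
        have "K * h \<le> K * \<delta>" using hd by (intro mult_left_mono K) (simp add: h_def)
        then show "K * h \<le> \<epsilon>" using \<delta>(2) by linarith
      qed
      finally show "Xnorm T (\<lambda>z. G (\<lambda>x. R x + H x) z - G R z - DG R H z) \<le> \<epsilon> * c2norm H"
        by (simp add: v_def u_def i_def h_def)
    qed
  qed
  have cont: "\<exists>\<delta>>0. \<forall>R'. C2b R' \<and> c2norm (\<lambda>x. R' x - R x) < \<delta> \<longrightarrow>
      (\<forall>H. C2b H \<longrightarrow> Xnorm T (\<lambda>z. DG R' H z - DG R H z) \<le> \<epsilon> * c2norm H)" if R: "C2b R" and \<epsilon>: "\<epsilon> >
          0" for R and \<epsilon> :: real
  proof -
    obtain C where gC: "gronwall_const R C" using gron[OF R] ..
    note C0 = gC[unfolded gronwall_const_def, THEN conjunct1]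
      and C = gC[unfolded gronwall_const_def, THEN conjunct2]
    define M where "M = c2norm R"
    have M: "M \<ge> 0" unfolding M_def by (rule c2norm_nonneg[OF R])
    \<comment> \<open>\<open>E\<close> bounds the difference of the two nonlinear solutions.
      \<open>E'\<close> bounds the derivative at the perturbed reaction function, whose slope is at
      most \<open>M + 1\<close> once \<delta> is at most 1.\<close>
    define E E' where "E = exp (2 * (M + 1) * T)" and "E' = exp (2 * (M + 1 + 1) * T)"
    have E: "E \<ge> 0" "E' \<ge> 0" by (simp_all add: E_def E'_def)
    define D where "D = (1 + M * E) * E' + E"
    have D: "D \<ge> 0" unfolding D_def using M E by simp
    obtain \<delta> where \<delta>: "\<delta> > 0" "\<delta> \<le> 1" "(C * D) * \<delta> \<le> \<epsilon>"
      using small[OF \<epsilon> mult_nonneg_nonneg[OF C0 D]] by blast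
    show ?thesis
    proof (intro exI[of _ \<delta>] conjI \<delta>(1) allI impI)
      fix R1 H assume "C2b R1 \<and> c2norm (\<lambda>x. R1 x - R x) < \<delta>" and H: "C2b H"
      then have R1: "C2b R1" and rd: "c2norm (\<lambda>x. R1 x - R x) < \<delta>" by auto
      define r h where "r = c2norm (\<lambda>x. R1 x - R x)" and "h = c2norm H"
      note RD = C2b_diff[OF R1 R]
      have r: "r \<ge> 0" and h: "h \<ge> 0" unfolding r_def h_def by (intro c2norm_nonneg RD H)+
      define v u i j where "v = G R1" and "u = G R" and "i = DG R1 H" and "j = DG R H"
      have mv: "v \<in> borel_measurable (cylm T)" and mu: "u \<in> borel_measurable (cylm T)"
        and mi: "i \<in> borel_measurable (cylm T)" and mj: "j \<in> borel_measurable (cylm T)"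
        unfolding v_def u_def i_def j_def by (intro mG mDG R1 R H)+
      have dR: "\<bar>deriv R1 x - deriv R x\<bar> \<le> r" for x
        using C2b_c2norm(2)[OF RD, of x] unfolding deriv_C2b_diff[OF R1 R] r_def .
      have w: "AE z in cylm T. \<bar>v z - u z\<bar> \<le> r * E"
        using nonlinear_sup_diff[OF T R R1 G[OF R] G[OF R1]]
          by (simp add: r_def E_def M_def v_def u_def)
      have "\<bar>deriv R1 x\<bar> \<le> M + 1" for x
        using dR[of x] C2b_c2norm(2)[OF R, of x] rd \<delta>(2) unfolding M_def r_def by linarith
      from DG_sup[OF R1 H this] have ib: "AE z in cylm T. \<bar>i z\<bar> \<le> h * E'"
        by (simp add: i_def h_def E'_def)
      have "heat_data T (\<lambda>z. (deriv R1 (v z) * i z + H (v z)) - (deriv R (u z) * j z + H (u z)))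
          (\<lambda>z. i z - j z)"
        unfolding v_def u_def i_def j_def by (rule heat_data_diff[OF hDG[OF R1 H] hDG[OF R H]])
      then have "Xnorm T (\<lambda>z. i z - j z) \<le> C * (D * r * h)"
      proof (rule C[rule_format])
        show "(\<lambda>z. (deriv R1 (v z) * i z + H (v z)) - (deriv R (u z) * j z + H (u z)))
            \<in> borel_measurable (cylm T)"
          by (intro borel_measurable_diff borel_measurable_add borel_measurable_times mi mj
              C2b_measurable_comp(2)[OF R1 mv] C2b_measurable_comp(1)[OF H mv]
              C2b_measurable_comp(2)[OF R mu] C2b_measurable_comp(1)[OF H mu])
        show "0 \<le> D * r * h" using D r h by simp
        show "AE z in cylm T. \<bar>(deriv R1 (v z) * i z + H (v z)) - (deriv R (u z) * j z + H (u z))\<bar>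
           \<le> c2norm R * \<bar>i z - j z\<bar> + D * r * h"
          using w ib
        proof eventually_elim
          case (elim z)
          have "\<bar>deriv R1 (v z) - deriv R (u z)\<bar> \<le> r + M * (r * E)"
            using dR[of "v z"] C2b_lipschitz(2)[OF R, of "v z" "u z"] mult_left_mono[OF elim(1) M]
              unfolding M_def by linarith
          then have 1: "\<bar>(deriv R1 (v z) - deriv R (u z)) * i z\<bar> \<le> (r + M * (r * E)) * (h * E')"
            unfolding abs_mult using elim(2) M r E by (intro mult_mono) auto
          have 2: "\<bar>H (v z) - H (u z)\<bar> \<le> h * (r * E)"
            using C2b_lipschitz(1)[OF H, of "v z" "u z"] mult_left_mono[OF elim(1) h]
              unfolding h_def by linarith
          have 3: "\<bar>deriv R (u z) * (i z - j z)\<bar> \<le> M * \<bar>i z - j z\<bar>"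
            unfolding abs_mult M_def by (intro mult_right_mono C2b_c2norm R) simp
          \<comment> \<open>The perturbation of the potential acts on the bounded function
            \<open>i\<close>, the variation of \<open>H\<close> is controlled by the sup bound on
            \<open>v - u\<close>, and the last term is left to the Gronwall estimate with the
            constant of \<open>R\<close>. The first two are at most
            \<open>D * r * h\<close>.\<close>
          have "(deriv R1 (v z) * i z + H (v z)) - (deriv R (u z) * j z + H (u z))
             = (deriv R1 (v z) - deriv R (u z)) * i z + (H (v z) - H (u z)) + deriv R (u z)
                 * (i z - j z)"
            by (simp add: algebra_simps)
          then have "\<bar>(deriv R1 (v z) * i z + H (v z)) - (deriv R (u z) * j z + H (u z))\<bar>
             \<le> (r + M * (r * E)) * (h * E') + h * (r * E) + M * \<bar>i z - j z\<bar>" using 1 2 3 by linarith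
          also have "\<dots> = c2norm R * \<bar>i z - j z\<bar> + D * r * h"
            unfolding M_def D_def by (simp add: algebra_simps)
          finally show ?case .
        qed
      qed
      also have "\<dots> = (C * D * r) * h" by simp
      also have "\<dots> \<le> \<epsilon> * h"
      proof (rule mult_right_mono[OF _ h])
        have "C * D * r \<le> C * D * \<delta>" using rd by (intro mult_left_mono mult_nonneg_nonneg C0 D)
            (simp add: r_def)
        then show "C * D * r \<le> \<epsilon>" using \<delta>(3) by linarith
      qed
      finally show "Xnorm T (\<lambda>z. DG R1 H z - DG R H z) \<le> \<epsilon> * c2norm H"
        by (simp add: i_def j_def h_def)
    qed
  qed
  show ?thesis
  proof (intro exI[of _ DG] conjI allI impI)
    show "C1_frechet T G DG" unfolding C1_frechet_def using frechet cont by blast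
  next
    fix R H assume RH: "C2b R \<and> C2b H"
    then show "strong_sol T (\<lambda>x. 0) (\<lambda>z s. deriv R (G R z) * s + H (G R z)) (DG R H)"
      unfolding lin_iff using DG by blast
    fix i assume "strong_sol T (\<lambda>x. 0) (\<lambda>z s. deriv R (G R z) * s + H (G R z)) i"
    then show "Xnorm T (\<lambda>z. i z - DG R H z) = 0"
      unfolding lin_iff using uniq(1) DG RH by blast
  qed
qed

end
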